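(* Let $K$ be a field and let $f(x)=ax^d+b\in K[x]$ with $a\ne0$, where $d\ge2$ is coprime to $\operatorname{char}K$. If $f$ is post-critically finite, let $n$ denote the number of elements of the strict forward orbit $\{f^i(0):i\ge1\}$ of $0$ under $f$. Then the abelianization of $\overline{\mathrm{Arb}}(f)$ is $$\overline{\mathrm{Arb}}(f)^{\mathrm{ab}}\cong\begin{cases}(\mathbb Z/d\mathbb Z)^\infty & \text{if the orbit of $0$ under $f$ is infinite},\\ \mathbb Z_d^n& \text{if $0$ is periodic under $f$},\\ (\mathbb Z/d\mathbb Z)^n & \text{if $0$ is strictly preperiodic under $f$}.\end{cases}$$
   Context: Let $t$ be transcendental over $K$, fix a separable closure $K(t)^{\mathrm{sep}}$, let $K^{\mathrm{sep}}$ be the separable closure of $K$ in it. The sets $f^{-\ell}(t)$ of roots of $f^\ell(x)=t$ in $K(t)^{\mathrm{sep}}$ ($f^\ell$ the $\ell$-fold composition) form a regular rooted $d$-ary tree with root $t$, with $\alpha\in f^{-\ell}(t)$ a child of $f(\alpha)$. $\overline{\mathrm{Arb}}(f)$ is the image of $\operatorname{Gal}(K(t)^{\mathrm{sep}}/K^{\mathrm{sep}}(t))$ in the automorphism group of this tree; it is a profinite group isomorphic to $\operatorname{Gal}(K^{\mathrm{sep}}(f^{-\infty}(t))/K^{\mathrm{sep}}(t))$, where $K^{\mathrm{sep}}(f^{-\infty}(t))=\bigcup_\ell K^{\mathrm{sep}}(f^{-\ell}(t))$. The abelianization of a profinite group is its quotient by the closure of the commutator subgroup. $\mathbb Z_d=\varprojlim_k\mathbb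 Z/d^k\mathbb Z$ is the additive group of $d$-adic integers, and $(\mathbb Z/d\mathbb Z)^\infty$ is the direct product of countably infinitely many copies of $\mathbb Z/d\mathbb Z$. *)

theory Defs
  imports
    "HOL-Algebra.Algebraic_Closure_Type"
    "HOL-Algebra.Generated_Fields"
    "HOL-Algebra.Bij"
    "HOL-Algebra.Product_Groups"
    "HOL-Algebra.Elementary_Groups"
    "HOL-Analysis.Abstract_Topology"
    "HOL-Analysis.Function_Topology"
    "HOL-Computational_Algebra.Polynomial"
begin

section \<open>Subfields, separable closures, Galois groups\<close>

text \<open>
  All fields are subfields (as sets) of one ambient field, given by a type of class \<open>field\<close>.
  \<open>ring_of_type_algebra\<close> is that type seen as a ring record.
\<close>

abbreviation is_subfield :: "'l::field set \<Rightarrow> bool" where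
  "is_subfield F \<equiv> subfield F ring_of_type_algebra"

abbreviation adjoin :: "'l::field set \<Rightarrow> 'l \<Rightarrow> 'l set" where
  "adjoin F x \<equiv> generate_field ring_of_type_algebra (insert x F)"

definition poly_over :: "'l::field set \<Rightarrow> 'l poly \<Rightarrow> bool" where
  "poly_over F p \<longleftrightarrow> (\<forall>i. Polynomial.coeff p i \<in> F)"

definition transcendental_over :: "'l::field set \<Rightarrow> 'l \<Rightarrow> bool" where
  "transcendental_over F x \<longleftrightarrow> (\<forall>p. poly_over F p \<and> p \<noteq> 0 \<longrightarrow> poly p x \<noteq> 0)"

text \<open>
  Coprimality may be tested over the ambient field, because it is invariant under field extension.
\<close>

definition separable_poly :: "'l::field poly \<Rightarrow> bool" where
  "separable_poly p \<longleftrightarrow> coprime p (pderiv p)"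

definition separable_over :: "'l::field set \<Rightarrow> 'l \<Rightarrow> bool" where
  "separable_over F x \<longleftrightarrow> (\<exists>p. poly_over F p \<and> separable_poly p \<and> poly p x = 0)"

definition separably_closed :: "'l::field set \<Rightarrow> bool" where
  "separably_closed F \<longleftrightarrow>
     (\<forall>p. poly_over F p \<and> separable_poly p \<and> Polynomial.degree p > 0 \<longrightarrow> (\<exists>x\<in>F. poly p x = 0))"

definition is_separable_closure :: "'l::field set \<Rightarrow> 'l set \<Rightarrow> bool" where
  "is_separable_closure F L \<longleftrightarrow>
     is_subfield L \<and> F \<subseteq> L \<and> (\<forall>x\<in>L. separable_over F x) \<and> separably_closed L"

definition separable_closure_in :: "'l::field set \<Rightarrow> 'l set \<Rightarrow> 'l set" where
  "separable_closure_in F L = {x\<in>L. separable_over F x}"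

text \<open>As for \<^const>\<open>Bij\<close>, automorphisms of \<open>L\<close> are extensional functions on \<open>L\<close>.\<close>

definition galois_group :: "'l::field set \<Rightarrow> 'l set \<Rightarrow> ('l \<Rightarrow> 'l) set" where
  "galois_group L F =
     {\<sigma>\<in>Bij L. (\<forall>x\<in>L. \<forall>y\<in>L. \<sigma> (x + y) = \<sigma> x + \<sigma> y \<and> \<sigma> (x * y) = \<sigma> x * \<sigma> y) \<and>
                (\<forall>x\<in>F. \<sigma> x = x)}"


section \<open>Topological groups\<close>

type_synonym 'a topgroup = "'a monoid \<times> 'a topology"

definition topgroup_iso :: "'a topgroup \<Rightarrow> 'b topgroup \<Rightarrow> bool" where
  "topgroup_iso G H \<longleftrightarrow> (\<exists>\<phi>\<in>iso (fst G) (fst H). homeomorphic_map (snd G) (snd H) \<phi>)"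

definition final_topology :: "'a topology \<Rightarrow> ('a \<Rightarrow> 'b) \<Rightarrow> 'b topology" where
  "final_topology T q =
     topology (\<lambda>U. U \<subseteq> q ` topspace T \<and> openin T {x\<in>topspace T. q x \<in> U})"

lemma openin_final_topology:
  "openin (final_topology T q) U \<longleftrightarrow> U \<subseteq> q ` topspace T \<and> openin T {x\<in>topspace T. q x \<in> U}"
proof -
  have "istopology (\<lambda>U. U \<subseteq> q ` topspace T \<and> openin T {x\<in>topspace T. q x \<in> U})"
    unfolding istopology_def
  proof (intro conjI allI impI)
    fix S S2
    assume S: "S \<subseteq> q ` topspace T \<and> openin T {x\<in>topspace T. q x \<in> S}"
      and S2: "S2 \<subseteq> q ` topspace T \<and> openin T {x\<in>topspace T. q x \<in> S2}"
    have "{x\<in>topspace T. q x \<in> S \<inter> S2} = {x\<in>topspace T. q x \<in> S} \<inter> {x\<in>topspace T. q x \<in> S2}"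
      by auto
    then show "openin T {x\<in>topspace T. q x \<in> S \<inter> S2}"
      using S S2 by auto
    show "S \<inter> S2 \<subseteq> q ` topspace T"
      using S by auto
  next
    fix \<K>
    assume K: "\<forall>U\<in>\<K>. U \<subseteq> q ` topspace T \<and> openin T {x\<in>topspace T. q x \<in> U}"
    have "{x\<in>topspace T. q x \<in> \<Union>\<K>} = (\<Union>U\<in>\<K>. {x\<in>topspace T. q x \<in> U})"
      by auto
    then show "openin T {x\<in>topspace T. q x \<in> \<Union>\<K>}"
      using K by auto
    show "\<Union>\<K> \<subseteq> q ` topspace T"
      using K by auto
  qed
  then show ?thesis
    by (simp add: final_topology_def topology_inverse')
qed

lemma topspace_final_topology: "topspace (final_topology T q) = q ` topspace T"
proof
  show "topspace (final_topology T q) \<subseteq> q ` topspace T"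
    using openin_final_topology[of T q "topspace (final_topology T q)"] by simp
  have "{x\<in>topspace T. q x \<in> q ` topspace T} = topspace T"
    by auto
  then have "openin (final_topology T q) (q ` topspace T)"
    by (simp add: openin_final_topology)
  then show "q ` topspace T \<subseteq> topspace (final_topology T q)"
    by (rule openin_subset)
qed

lemma quotient_map_final_topology: "quotient_map T (final_topology T q) q"
  by (auto simp: quotient_map_def topspace_final_topology openin_final_topology)

definition topgroup_quotient :: "'a topgroup \<Rightarrow> 'a set \<Rightarrow> 'a set topgroup" where
  "topgroup_quotient G N = (fst G Mod N, final_topology (snd G) (\<lambda>x. N #>\<^bsub>fst G\<^esub> x))"

definition topgroup_abelianization :: "'a topgroup \<Rightarrow> 'a set topgroup" where
  "topgroup_abelianization G =
     topgroup_quotient G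
       (Abstract_Topology.closure_of (snd G) (derived (fst G) (carrier (fst G))))"

definition topgroup_power :: "'a topgroup \<Rightarrow> 'i set \<Rightarrow> ('i \<Rightarrow> 'a) topgroup" where
  "topgroup_power G I = (product_group I (\<lambda>_. fst G), product_topology (\<lambda>_. snd G) I)"

definition Zmod :: "nat \<Rightarrow> int topgroup" where
  "Zmod m = (integer_mod_group m, discrete_topology (carrier (integer_mod_group m)))"

text \<open>
  The inverse limit of the groups \<open>\<int>/d^k\<int>\<close>: sequences of representatives \<open>0 \<le> x k < d^k\<close>
  that are compatible under reduction.
\<close>

definition dadic_carrier :: "nat \<Rightarrow> (nat \<Rightarrow> int) set" where
  "dadic_carrier d =
     {x. (\<forall>k. x k \<in> carrier (integer_mod_group (d ^ k))) \<and> (\<forall>k. x (Suc k) mod int (d ^ k) = x k)}"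

definition dadic :: "nat \<Rightarrow> (nat \<Rightarrow> int) topgroup" where
  "dadic d =
     ((product_group UNIV (\<lambda>k. integer_mod_group (d ^ k)))\<lparr>carrier := dadic_carrier d\<rparr>,
      subtopology
        (product_topology (\<lambda>k. discrete_topology (carrier (integer_mod_group (d ^ k)))) UNIV)
        (dadic_carrier d))"


section \<open>The preimage tree and the geometric arboreal group\<close>

text \<open>Below, \<open>L\<close> plays the role of a separable closure of \<open>K(t)\<close>.\<close>

definition tree_level :: "'l set \<Rightarrow> 'l \<Rightarrow> ('l \<Rightarrow> 'l) \<Rightarrow> nat \<Rightarrow> 'l set" where
  "tree_level L t f l = {\<alpha>\<in>L. (f ^^ l) \<alpha> = t}"

definition tree_vertices :: "'l set \<Rightarrow> 'l \<Rightarrow> ('l \<Rightarrow> 'l) \<Rightarrow> 'l set" where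
  "tree_vertices L t f = (\<Union>l. tree_level L t f l)"

definition tree_child :: "'l set \<Rightarrow> 'l \<Rightarrow> ('l \<Rightarrow> 'l) \<Rightarrow> 'l \<Rightarrow> 'l \<Rightarrow> bool" where
  "tree_child L t f \<alpha> \<beta> \<longleftrightarrow> (\<exists>l\<ge>1. \<alpha> \<in> tree_level L t f l) \<and> f \<alpha> = \<beta>"

definition tree_automorphisms :: "'l set \<Rightarrow> 'l \<Rightarrow> ('l \<Rightarrow> 'l) \<Rightarrow> ('l \<Rightarrow> 'l) set" where
  "tree_automorphisms L t f =
     {\<pi>\<in>Bij (tree_vertices L t f). \<pi> t = t \<and>
        (\<forall>\<alpha>\<in>tree_vertices L t f. \<forall>\<beta>\<in>tree_vertices L t f.
           tree_child L t f (\<pi> \<alpha>) (\<pi> \<beta>) \<longleftrightarrow> tree_child L t f \<alpha> \<beta>)}"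

text \<open>
  The profinite topology on the automorphism group of the tree, given by the finite subtrees,
  is the topology of pointwise convergence on vertices.
\<close>

definition tree_Aut :: "'l set \<Rightarrow> 'l \<Rightarrow> ('l \<Rightarrow> 'l) \<Rightarrow> ('l \<Rightarrow> 'l) topgroup" where
  "tree_Aut L t f =
     ((BijGroup (tree_vertices L t f))\<lparr>carrier := tree_automorphisms L t f\<rparr>,
      subtopology
        (product_topology (\<lambda>_. discrete_topology (tree_vertices L t f)) (tree_vertices L t f))
        (tree_automorphisms L t f))"

definition topgroup_sub :: "'a topgroup \<Rightarrow> 'a set \<Rightarrow> 'a topgroup" where
  "topgroup_sub G H = ((fst G)\<lparr>carrier := H\<rparr>, subtopology (snd G) H)"

definition geometric_Arb :: "'l::field set \<Rightarrow> 'l set \<Rightarrow> 'l \<Rightarrow> ('l \<Rightarrow> 'l) \<Rightarrow> ('l \<Rightarrow> 'l) topgroup" where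
  "geometric_Arb K L t f =
     topgroup_sub (tree_Aut L t f)
       ((\<lambda>\<sigma>. restrict \<sigma> (tree_vertices L t f)) `
          galois_group L (adjoin (separable_closure_in K L) t))"

text \<open>
  The image really lies in the automorphism group of the tree.
\<close>

lemma restrict_galois_tree_automorphism:
  assumes \<sigma>: "\<sigma> \<in> galois_group L F" and tF: "t \<in> F" and FL: "F \<subseteq> L"
    and f_L: "\<And>x. x \<in> L \<Longrightarrow> f x \<in> L" and f_\<sigma>: "\<And>x. x \<in> L \<Longrightarrow> \<sigma> (f x) = f (\<sigma> x)"
  shows "restrict \<sigma> (tree_vertices L t f) \<in> tree_automorphisms L t f"
proof -
  let ?V = "tree_vertices L t f"
  have bij: "bij_betw \<sigma> L L" and t: "\<sigma> t = t"
    using \<sigma> tF by (auto simp: galois_group_def Bij_def)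
  have L: "\<sigma> x \<in> L" if "x \<in> L" for x
    using bij that by (auto simp: bij_betw_def)
  have inj: "\<sigma> x = \<sigma> y \<longleftrightarrow> x = y" if "x \<in> L" "y \<in> L" for x y
    using bij that by (auto simp: bij_betw_def inj_on_def)
  have iter: "(f ^^ l) x \<in> L \<and> \<sigma> ((f ^^ l) x) = (f ^^ l) (\<sigma> x)" if "x \<in> L" for l x
    by (induction l) (use that f_L f_\<sigma> in auto)
  have lev: "\<sigma> x \<in> tree_level L t f l \<longleftrightarrow> x \<in> tree_level L t f l" if "x \<in> L" for x l
  proof -
    have "t \<in> L"
      using tF FL by auto
    then have "(f ^^ l) (\<sigma> x) = t \<longleftrightarrow> (f ^^ l) x = t"
      using iter[OF that, of l] inj[of "(f ^^ l) x" t] t by simp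
    then show ?thesis
      using that L by (simp add: tree_level_def)
  qed
  have VL: "?V \<subseteq> L"
    by (auto simp: tree_vertices_def tree_level_def)
  have V: "\<sigma> x \<in> ?V \<longleftrightarrow> x \<in> ?V" if "x \<in> L" for x
    using lev[OF that] by (simp add: tree_vertices_def)
  have "\<sigma> ` ?V = ?V"
  proof
    show "?V \<subseteq> \<sigma> ` ?V"
    proof
      fix y assume y: "y \<in> ?V"
      then obtain x where "x \<in> L" "y = \<sigma> x"
        using bij VL by (metis bij_betw_def imageE subsetD)
      then show "y \<in> \<sigma> ` ?V"
        using V y by auto
    qed
  qed (use V VL in auto)
  then have "bij_betw \<sigma> ?V ?V"
    using bij_betw_subset[OF bij VL] by simp
  then have "restrict \<sigma> ?V \<in> Bij ?V"
    by (simp add: Bij_def)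
  moreover have "t \<in> ?V"
    using tF FL unfolding tree_vertices_def tree_level_def by (auto intro: exI[of _ 0])
  moreover have "tree_child L t f (\<sigma> \<alpha>) (\<sigma> \<beta>) \<longleftrightarrow> tree_child L t f \<alpha> \<beta>"
    if "\<alpha> \<in> ?V" "\<beta> \<in> ?V" for \<alpha> \<beta>
  proof -
    have "\<alpha> \<in> L" "\<beta> \<in> L"
      using that VL by auto
    then have "f (\<sigma> \<alpha>) = \<sigma> \<beta> \<longleftrightarrow> f \<alpha> = \<beta>"
      using inj[of "f \<alpha>" \<beta>] f_L f_\<sigma> by simp
    then show ?thesis
      using lev[OF \<open>\<alpha> \<in> L\<close>] by (simp add: tree_child_def)
  qed
  ultimately show ?thesis
    using t by (simp add: tree_automorphisms_def)
qed


section \<open>Orbits\<close>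

definition forward_orbit :: "('a \<Rightarrow> 'a) \<Rightarrow> 'a \<Rightarrow> 'a set" where
  "forward_orbit f x = {(f ^^ i) x | i. True}"

definition strict_forward_orbit :: "('a \<Rightarrow> 'a) \<Rightarrow> 'a \<Rightarrow> 'a set" where
  "strict_forward_orbit f x = {(f ^^ i) x | i. i \<ge> 1}"

definition periodic_point :: "('a \<Rightarrow> 'a) \<Rightarrow> 'a \<Rightarrow> bool" where
  "periodic_point f x \<longleftrightarrow> (\<exists>i\<ge>1. (f ^^ i) x = x)"

definition preperiodic_point :: "('a \<Rightarrow> 'a) \<Rightarrow> 'a \<Rightarrow> bool" where
  "preperiodic_point f x \<longleftrightarrow> (\<exists>i j. i < j \<and> (f ^^ i) x = (f ^^ j) x)"

definition strictly_preperiodic_point :: "('a \<Rightarrow> 'a) \<Rightarrow> 'a \<Rightarrow> bool" where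
  "strictly_preperiodic_point f x \<longleftrightarrow> preperiodic_point f x \<and> \<not> periodic_point f x"

end

theory Submission
  imports Defs "HOL-Analysis.T1_Spaces"
begin

text \<open>
  Let \<open>k\<close> be the separable closure of \<open>K\<close>, \<open>S\<close> the strict forward orbit of \<open>0\<close>, and \<open>M\<close> the arboreal
  field over \<open>F = k(t)\<close>. As \<open>k\<close> contains all roots of unity of order prime to the characteristic, the
  abelian quotients of the Galois group of \<open>M\<close> are governed by the elements of \<open>F\<close> that become
  \<open>d\<^sup>n\<close>-th powers in \<open>M\<close> (Kummer theory).

  Which elements do so is decided by ramification. Since \<open>t - b = a y\<^sup>d\<close> and \<open>t - f(c) = a (y\<^sup>d - c\<^sup>d)\<close>
  factors over the preimages of \<open>t\<close>, the field \<open>M\<close> contains the \<open>d\<close>-th roots of \<open>t - c\<close> for \<open>c \<in> S\<close>,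
  and even all \<open>d\<^sup>n\<close>-th roots if \<open>0 \<in> S\<close>. Conversely, embedding \<open>M\<close> into Laurent series in \<open>t - c\<close>,
  respectively in a \<open>d\<close>-th root of it, shows that \<open>M\<close> is unramified outside \<open>S\<close> and has ramification
  index dividing \<open>d\<close> if \<open>0 \<notin> S\<close>. So an automorphism that fixes these radicals lies in the closure of
  the commutator subgroup.

  The radicals of \<open>t - c\<close> for distinct \<open>c\<close> are independent, because each ramifies at its own place.
  Compactness then shows that the action on the radicals identifies the abelianization with the
  product over \<open>c \<in> S\<close> of copies of \<open>\<int>/d\<close>, or of the \<open>d\<close>-adic integers if \<open>0 \<in> S\<close>.
\<close>

section \<open>Subfields and polynomials over them\<close>

text \<open>The field \<open>k\<close> is only separably closed, so zeros of a polynomial over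
  \<open>k\<close> may be inseparable and lie outside \<open>k\<close>. Hence the places are taken
  at points of the algebraic closure, and factorizations are made only after raising to a power of
  the characteristic exponent. That power is prime to \<open>d\<close>, so nothing is lost about
  d^n-th roots. Ramification is expressed without valuations: a homomorphism from \<open>L\<close>
  into an algebraic closure of a Laurent series field is built, and what matters is whether an image
  is itself a Laurent series. A parameter s with t = c + s^d absorbs the one ramified step above a
  point of a non-periodic orbit; the price is that orders of vanishing at such points are only
  divisible by d^(n-1). The closure of the commutator subgroup is reached by finite means: a
  neighbourhood of an automorphism sees finitely many vertices, and on the levels up to N the group
  has exponent dividing d^N. This number is invertible, so eigenvectors of a commuting action exist
  and only d^N-th roots have to be considered.\<close>

lemma is_subfield_iff:
  fixes A :: "'a::field set"
  shows "is_subfield A \<longleftrightarrow>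
    1 \<in> A \<and> (\<forall>x\<in>A. \<forall>y\<in>A. x - y \<in> A \<and> x * y \<in> A) \<and> (\<forall>x\<in>A. inverse x \<in> A)"
    (is "?l \<longleftrightarrow> ?r")
proof -
  let ?R = "ring_of_type_algebra :: 'a ring"
  interpret field ?R by rule
  have s [simp]: "carrier ?R = UNIV" "\<one>\<^bsub>?R\<^esub> = 1" "\<zero>\<^bsub>?R\<^esub> = 0"
    "x \<oplus>\<^bsub>?R\<^esub> y = x + y" "x \<otimes>\<^bsub>?R\<^esub> y = x * y" for x y :: 'a
    by (auto simp: ring_of_type_algebra_def)
  have neg [simp]: "\<ominus>\<^bsub>?R\<^esub> x = - x" for x :: 'a
    by (rule minus_equality) auto
  have inv [simp]: "inv\<^bsub>?R\<^esub> x = inverse x" if "x \<noteq> 0" for x :: 'a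
    by (rule inv_char) (use that in auto)
  show ?thesis
  proof
    assume l: ?l
    have "x - y \<in> A" if "x \<in> A" "y \<in> A" for x y
      using subringE(7)[OF subfieldE(1)[OF l], of x "- y"] subringE(5)[OF subfieldE(1)[OF l], of y] that
      by simp
    moreover have "inverse x \<in> A" if "x \<in> A" for x
      using subfield_m_inv(1)[OF l, of x] that inv subringE(2)[OF subfieldE(1)[OF l]]
      by (cases "x = 0") auto
    ultimately show ?r
      using subringE(3,6)[OF subfieldE(1)[OF l]] by auto
  next
    assume r: ?r
    have 0: "0 \<in> A"
      using r by (metis diff_self)
    have m: "- x \<in> A" if "x \<in> A" for x
      using r 0 that by (metis diff_0)
    have "x + y \<in> A" if "x \<in> A" "y \<in> A" for x y
      using r m that by (metis diff_minus_eq_add)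
    then show ?l
      using r m by (intro subfieldI' subringI) auto
  qed
qed

context
  fixes A :: "'a::field set"
  assumes A: "is_subfield A"
begin

lemma subfield_1: "1 \<in> A"
  and subfield_diff: "x \<in> A \<Longrightarrow> y \<in> A \<Longrightarrow> x - y \<in> A"
  and subfield_mult: "x \<in> A \<Longrightarrow> y \<in> A \<Longrightarrow> x * y \<in> A"
  and subfield_inverse: "x \<in> A \<Longrightarrow> inverse x \<in> A"
  using A unfolding is_subfield_iff by auto

lemma subfield_0: "0 \<in> A"
  using subfield_diff[OF subfield_1 subfield_1] by simp

lemma subfield_uminus: "x \<in> A \<Longrightarrow> - x \<in> A"
  using subfield_diff[OF subfield_0] by simp

lemma subfield_add: "x \<in> A \<Longrightarrow> y \<in> A \<Longrightarrow> x + y \<in> A"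
  using subfield_diff[of x "- y"] subfield_uminus[of y] by simp

lemma subfield_divide: "x \<in> A \<Longrightarrow> y \<in> A \<Longrightarrow> x / y \<in> A"
  using subfield_mult subfield_inverse by (simp add: field_class.field_divide_inverse)

lemma subfield_power: "x \<in> A \<Longrightarrow> x ^ n \<in> A"
  by (induction n) (auto intro: subfield_1 subfield_mult)

lemma subfield_sum: "(\<And>i. i \<in> I \<Longrightarrow> g i \<in> A) \<Longrightarrow> sum g I \<in> A"
  by (induction I rule: infinite_finite_induct) (auto intro: subfield_0 subfield_add)

lemma subfield_prod: "(\<And>i. i \<in> I \<Longrightarrow> g i \<in> A) \<Longrightarrow> prod g I \<in> A"
  by (induction I rule: infinite_finite_induct) (auto intro: subfield_1 subfield_mult)

lemma subfield_of_nat: "of_nat n \<in> A"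
  by (induction n) (auto intro: subfield_0 subfield_1 subfield_add)

lemmas subfield_closed = subfield_0 subfield_1 subfield_diff subfield_mult subfield_inverse
  subfield_uminus subfield_add subfield_divide subfield_power subfield_sum subfield_prod
  subfield_of_nat

lemma poly_over_0: "poly_over A 0"
  and poly_over_1: "poly_over A 1"
  and poly_over_const: "c \<in> A \<Longrightarrow> poly_over A [:c:]"
  and poly_over_monom: "c \<in> A \<Longrightarrow> poly_over A (monom c n)"
  and poly_over_add: "poly_over A p \<Longrightarrow> poly_over A q \<Longrightarrow> poly_over A (p + q)"
  and poly_over_diff: "poly_over A p \<Longrightarrow> poly_over A q \<Longrightarrow> poly_over A (p - q)"
  and poly_over_smult: "c \<in> A \<Longrightarrow> poly_over A p \<Longrightarrow> poly_over A (smult c p)"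
  and poly_over_pCons: "c \<in> A \<Longrightarrow> poly_over A p \<Longrightarrow> poly_over A (pCons c p)"
  and poly_over_pderiv: "poly_over A p \<Longrightarrow> poly_over A (pderiv p)"
  and poly_over_mult: "poly_over A p \<Longrightarrow> poly_over A q \<Longrightarrow> poly_over A (p * q)"
  by (auto simp: poly_over_def coeff_pCons coeff_pderiv coeff_mult split: nat.splits if_splits
           intro!: subfield_closed)

lemma poly_over_power: "poly_over A p \<Longrightarrow> poly_over A (p ^ n)"
  by (induction n) (auto intro: poly_over_1 poly_over_mult)

lemma poly_over_prod: "(\<And>i. i \<in> I \<Longrightarrow> poly_over A (g i)) \<Longrightarrow> poly_over A (prod g I)"
  by (induction I rule: infinite_finite_induct) (auto intro: poly_over_1 poly_over_mult)

lemma poly_over_sum: "(\<And>i. i \<in> I \<Longrightarrow> poly_over A (g i)) \<Longrightarrow> poly_over A (sum g I)"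
  by (induction I rule: infinite_finite_induct) (auto intro: poly_over_0 poly_over_add)

lemmas poly_over_intros = poly_over_0 poly_over_1 poly_over_const poly_over_monom poly_over_add
  poly_over_diff poly_over_smult poly_over_pCons poly_over_pderiv poly_over_mult poly_over_power
  poly_over_prod poly_over_sum

lemma poly_over_poly: "poly_over A p \<Longrightarrow> x \<in> A \<Longrightarrow> poly p x \<in> A"
  unfolding poly_altdef by (auto simp: poly_over_def intro!: subfield_closed)

text \<open>Division in the ambient polynomial ring says nothing about the coefficient field of the
  quotient. Long division does: each correcting monomial has a quotient of two elements of
  \<open>A\<close> as coefficient.\<close>

lemma poly_over_division:
  assumes "poly_over A p" "p \<noteq> 0" "poly_over A q"
  shows "\<exists>s r. poly_over A s \<and> poly_over A r \<and> q = p * s + r \<and> (r = 0 \<or> degree r < degree p)"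
  using assms(3)
proof (induction "degree q" arbitrary: q rule: less_induct)
  case less
  show ?case
  proof (cases "q = 0 \<or> degree q < degree p")
    case True
    then show ?thesis
      using less.prems poly_over_0 by (intro exI[of _ 0] exI[of _ q]) auto
  next
    case False
    define m where "m = monom (lead_coeff q / lead_coeff p) (degree q - degree p)"
    have m: "poly_over A m"
      unfolding m_def using less.prems assms(1) by (auto simp: poly_over_def intro!: subfield_closed)
    have m0: "m \<noteq> 0" and dm: "degree m = degree q - degree p"
      using False assms(2) by (auto simp: m_def degree_monom_eq)
    define q' where "q' = q - p * m"
    have q': "poly_over A q'"
      unfolding q'_def using less.prems m assms(1) by (intro poly_over_intros)
    have dpm: "degree (p * m) = degree q"
      using False m0 assms(2) dm by (simp add: degree_mult_eq)
    have "lead_coeff (p * m) = lead_coeff q"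
      using False assms(2) unfolding lead_coeff_mult by (simp add: m_def degree_monom_eq)
    then have c: "coeff q' (degree q) = 0"
      unfolding q'_def using dpm by simp
    have dq': "degree q' \<le> degree q"
      unfolding q'_def by (rule degree_diff_le) (auto simp: dpm)
    show ?thesis
    proof (cases "degree q' < degree q")
      case True
      from less.hyps[OF this q'] obtain s r where
        sr: "poly_over A s" "poly_over A r" "q' = p * s + r" "r = 0 \<or> degree r < degree p"
        by blast
      then have "q = p * (s + m) + r"
        unfolding q'_def by (simp add: algebra_simps)
      then show ?thesis
        using sr m poly_over_add by blast
    next
      case F: False
      then have "lead_coeff q' = 0"
        using c dq' by (metis le_neq_implies_less)
      then have "q' = 0" by simp
      then have "q = p * m + 0"
        unfolding q'_def by simp
      then show ?thesis
        using m poly_over_0 by blast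
    qed
  qed
qed

text \<open>The remainder is itself divisible by \<open>p\<close>, so its degree makes it zero and
  the cofactor is the quotient found over \<open>A\<close>.\<close>

lemma poly_over_dvd:
  assumes "poly_over A p" "p \<noteq> 0" "poly_over A q" "p dvd q"
  obtains s where "poly_over A s" "q = p * s"
proof -
  obtain s r where sr: "poly_over A s" "q = p * s + r" "r = 0 \<or> degree r < degree p"
    using poly_over_division[OF assms(1-3)] by blast
  then have "p dvd r"
    using assms(4) by (metis dvd_add_right_iff dvd_triv_left)
  then have "r = 0"
    using sr(3) by (meson dvd_imp_degree_le not_le)
  then show thesis using that sr by auto
qed

text \<open>By division with remainder, a nonzero element of least degree in the ideal generated
  over \<open>A\<close> divides the whole ideal.\<close>

lemma poly_over_bezout:
  assumes "poly_over A p" "poly_over A q" "p \<noteq> 0"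
  obtains g u v where "poly_over A g" "poly_over A u" "poly_over A v" "g = u * p + v * q"
    "g \<noteq> 0" "g dvd p" "g dvd q"
proof -
  define I where "I = {u * p + v * q |u v. poly_over A u \<and> poly_over A v}"
  have p: "p \<in> I" and q: "q \<in> I"
    unfolding I_def using poly_over_0 poly_over_1
    by (force intro: exI[of _ 1] exI[of _ 0])+
  define n where "n = (LEAST n. \<exists>g\<in>I. g \<noteq> 0 \<and> degree g = n)"
  have "\<exists>g\<in>I. g \<noteq> 0 \<and> degree g = n"
    unfolding n_def by (rule LeastI[of _ "degree p"]) (use p assms in auto)
  then obtain g where g: "g \<in> I" "g \<noteq> 0" "degree g = n" by auto
  have min: "h = 0" if "h \<in> I" "degree h < n" for h
    using that not_less_Least[of "degree h" "\<lambda>n. \<exists>g\<in>I. g \<noteq> 0 \<and> degree g = n"]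
    unfolding n_def by auto
  obtain u v where uv: "poly_over A u" "poly_over A v" "g = u * p + v * q"
    using g unfolding I_def by auto
  have Ag: "poly_over A g"
    unfolding uv using uv assms by (intro poly_over_intros)
  have "g dvd h" if h: "h \<in> I" for h
  proof -
    obtain u' v' where uv': "poly_over A u'" "poly_over A v'" "h = u' * p + v' * q"
      using h unfolding I_def by auto
    have Ah: "poly_over A h"
      unfolding uv' using uv' assms by (intro poly_over_intros)
    obtain s r where sr: "poly_over A s" "poly_over A r" "h = g * s + r" "r = 0 \<or> degree r < degree g"
      using poly_over_division[OF Ag g(2) Ah] by blast
    have "r = (u' - u * s) * p + (v' - v * s) * q"
      using sr(3) uv(3) uv'(3) by (simp add: algebra_simps)
    then have "r \<in> I"
      unfolding I_def using uv uv' sr by (auto intro!: exI poly_over_intros)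
    then have "r = 0"
      using sr(4) min g(3) by auto
    then show ?thesis using sr by simp
  qed
  then show thesis
    using that Ag uv g p q by blast
qed

end

section \<open>Minimal polynomials and the simple extension generated by one element\<close>

definition algebraic_elem :: "'a::field set \<Rightarrow> 'a \<Rightarrow> bool" where
  "algebraic_elem A x \<longleftrightarrow> (\<exists>p. poly_over A p \<and> p \<noteq> 0 \<and> poly p x = 0)"

text \<open>Least degree takes the place of irreducibility. The leading coefficient is not
  normalized, so the polynomial is determined only up to a nonzero constant of
  \<open>A\<close>.\<close>

definition min_poly :: "'a::field set \<Rightarrow> 'a \<Rightarrow> 'a poly \<Rightarrow> bool" where
  "min_poly A x p \<longleftrightarrow> poly_over A p \<and> p \<noteq> 0 \<and> poly p x = 0 \<and>
     (\<forall>q. poly_over A q \<and> q \<noteq> 0 \<and> poly q x = 0 \<longrightarrow> degree p \<le> degree q)"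

lemma min_poly_exists:
  assumes "algebraic_elem A x"
  obtains p where "min_poly A x p"
proof -
  define Q where "Q p \<longleftrightarrow> poly_over A p \<and> p \<noteq> 0 \<and> poly p x = 0" for p
  have "\<exists>p. Q p" using assms by (auto simp: algebraic_elem_def Q_def)
  then obtain p where "Q p" "\<And>q. Q q \<Longrightarrow> degree p \<le> degree q"
    using ex_has_least_nat[of Q _ degree] by blast
  then show thesis using that unfolding min_poly_def Q_def by blast
qed

lemma min_poly_dvd:
  assumes "is_subfield A" "min_poly A x p" "poly_over A q" "poly q x = 0"
  obtains s where "poly_over A s" "q = p * s"
proof -
  have p: "poly_over A p" "p \<noteq> 0" "poly p x = 0"
    using assms(2) by (auto simp: min_poly_def)
  obtain s r where sr: "poly_over A s" "poly_over A r" "q = p * s + r" "r = 0 \<or> degree r < degree p"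
    using poly_over_division[OF assms(1) p(1,2) assms(3)] by blast
  have "poly r x = 0" using sr(3) p assms(4) by simp
  then have "r = 0" using sr assms(2) unfolding min_poly_def by (meson not_le)
  then show thesis using that sr by auto
qed

lemma min_poly_degree_pos:
  assumes "min_poly A x p"
  shows "degree p > 0"
proof (rule ccontr)
  assume "\<not> degree p > 0"
  then obtain c where "p = [:c:]" by (metis degree_eq_zeroE not_gr_zero)
  then show False using assms by (auto simp: min_poly_def)
qed

lemma carrier_ring_of_type_algebra: "carrier ring_of_type_algebra = UNIV"
  by (simp add: ring_of_type_algebra_def)

lemma is_subfield_generate_field:
  fixes H :: "'a::field set"
  shows "is_subfield (generate_field ring_of_type_algebra H)"
  using field.generate_field_is_subfield[OF field_from_type_algebra, of H]
  unfolding carrier_ring_of_type_algebra by blast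

lemma generate_field_superset: "H \<subseteq> generate_field ring_of_type_algebra H"
  by (auto intro: generate_field.incl)

lemma generate_field_least:
  fixes H :: "'a::field set"
  assumes "is_subfield E" "H \<subseteq> E"
  shows "generate_field ring_of_type_algebra H \<subseteq> E"
  using field.generate_field_min_subfield1[OF field_from_type_algebra, of H E] assms
  unfolding carrier_ring_of_type_algebra by blast

text \<open>The fractions already form a subfield. This form serves transcendental and algebraic
  \<open>x\<close> alike.\<close>

lemma adjoin_eq:
  assumes A: "is_subfield A"
  shows "adjoin A x = {poly p x / poly q x |p q. poly_over A p \<and> poly_over A q \<and> poly q x \<noteq> 0}"
    (is "_ = ?E")
proof
  have "is_subfield ?E"
    unfolding is_subfield_iff
  proof (intro conjI ballI)
    show "1 \<in> ?E"
      using poly_over_1[OF A] by (auto intro!: exI[of _ 1])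
    fix y assume "y \<in> ?E"
    then obtain p q where y: "y = poly p x / poly q x" "poly_over A p" "poly_over A q" "poly q x \<noteq> 0"
      by auto
    show "inverse y \<in> ?E"
    proof (cases "poly p x = 0")
      case True
      have "inverse y = poly 0 x / poly 1 x" using y True by simp
      then show ?thesis
        using poly_over_0[OF A] poly_over_1[OF A] by (intro CollectI exI[of _ 0] exI[of _ 1]) simp
    next
      case False
      have "inverse y = poly q x / poly p x" using y by simp
      then show ?thesis using y False by blast
    qed
    fix z assume "z \<in> ?E"
    then obtain p' q' where z: "z = poly p' x / poly q' x" "poly_over A p'" "poly_over A q'" "poly q' x \<noteq> 0"
      by auto
    have "y - z = poly (p * q' - p' * q) x / poly (q * q') x"
      unfolding y(1) z(1) using y(4) z(4) by (simp add: diff_frac_eq)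
    moreover have "poly_over A (p * q' - p' * q)" "poly_over A (q * q')"
      using y z by (auto intro!: poly_over_intros[OF A])
    moreover have nz: "poly (q * q') x \<noteq> 0"
      using y z by simp
    ultimately show "y - z \<in> ?E" by blast
    have "y * z = poly (p * p') x / poly (q * q') x"
      unfolding y(1) z(1) by simp
    moreover have "poly_over A (p * p')" "poly_over A (q * q')"
      using y z by (auto intro!: poly_over_intros[OF A])
    ultimately show "y * z \<in> ?E" using nz by blast
  qed
  moreover have "insert x A \<subseteq> ?E"
  proof
    fix y assume "y \<in> insert x A"
    then consider "y = x" | "y \<in> A" by auto
    then show "y \<in> ?E"
    proof cases
      case 1
      have "y = poly [:0,1:] x / poly 1 x" "poly_over A [:0,1:]"
        using 1 by (auto intro!: poly_over_intros[OF A] subfield_closed[OF A])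
      then show ?thesis
        using poly_over_1[OF A] by (intro CollectI exI[of _ "[:0,1:]"] exI[of _ 1]) simp
    next
      case 2
      have "y = poly [:y:] x / poly 1 x" "poly_over A [:y:]"
        using 2 by (auto intro!: poly_over_intros[OF A] subfield_closed[OF A])
      then show ?thesis
        using poly_over_1[OF A] by (intro CollectI exI[of _ "[:y:]"] exI[of _ 1]) simp
    qed
  qed
  ultimately show "adjoin A x \<subseteq> ?E" by (rule generate_field_least)
  have "is_subfield (adjoin A x)" "A \<subseteq> adjoin A x" "x \<in> adjoin A x"
    using is_subfield_generate_field generate_field_superset by blast+
  then have "poly p x \<in> adjoin A x" if "poly_over A p" for p
    using that by (intro poly_over_poly) (auto simp: poly_over_def)
  then show "?E \<subseteq> adjoin A x"
    using subfield_divide[OF \<open>is_subfield (adjoin A x)\<close>] by auto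
qed

section \<open>Partial field homomorphisms\<close>

text \<open>Values outside \<open>A\<close> are left free, so one function can be tested on growing
  subfields. The target has its own type because it may be an algebraic closure of a Laurent series
  field. The condition at 1 excludes the zero map.\<close>

definition hom_on :: "'a::field set \<Rightarrow> ('a \<Rightarrow> 'b::field) \<Rightarrow> bool" where
  "hom_on A \<phi> \<longleftrightarrow> \<phi> 1 = 1 \<and> (\<forall>x\<in>A. \<forall>y\<in>A. \<phi> (x + y) = \<phi> x + \<phi> y \<and> \<phi> (x * y) = \<phi> x * \<phi> y)"

context
  fixes A :: "'a::field set" and \<phi> :: "'a \<Rightarrow> 'b::field"
  assumes A: "is_subfield A" and \<phi>: "hom_on A \<phi>"
begin

lemma hom_on_1: "\<phi> 1 = 1"
  and hom_on_add: "x \<in> A \<Longrightarrow> y \<in> A \<Longrightarrow> \<phi> (x + y) = \<phi> x + \<phi> y"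
  and hom_on_mult: "x \<in> A \<Longrightarrow> y \<in> A \<Longrightarrow> \<phi> (x * y) = \<phi> x * \<phi> y"
  using \<phi> by (auto simp: hom_on_def)

lemma hom_on_0: "\<phi> 0 = 0"
  using hom_on_add[OF subfield_0[OF A] subfield_0[OF A]] by (metis add_cancel_right_right add_0)

lemma hom_on_uminus: "x \<in> A \<Longrightarrow> \<phi> (- x) = - \<phi> x"
  using hom_on_add[of x "- x"] subfield_uminus[OF A, of x] hom_on_0 by (simp add: eq_neg_iff_add_eq_0 add.commute)

lemma hom_on_diff: "x \<in> A \<Longrightarrow> y \<in> A \<Longrightarrow> \<phi> (x - y) = \<phi> x - \<phi> y"
  using hom_on_add[of x "- y"] hom_on_uminus[of y] subfield_uminus[OF A, of y] by simp

lemma hom_on_power: "x \<in> A \<Longrightarrow> \<phi> (x ^ n) = \<phi> x ^ n"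
  by (induction n) (auto simp: hom_on_1 hom_on_mult subfield_power[OF A])

lemma hom_on_eq_0_iff: "x \<in> A \<Longrightarrow> \<phi> x = 0 \<longleftrightarrow> x = 0"
  using hom_on_mult[of x "inverse x"] hom_on_0 hom_on_1 subfield_inverse[OF A, of x]
  by (metis mult_zero_left right_inverse zero_neq_one)

lemma hom_on_eq_iff: "x \<in> A \<Longrightarrow> y \<in> A \<Longrightarrow> \<phi> x = \<phi> y \<longleftrightarrow> x = y"
  using hom_on_eq_0_iff[of "x - y"] hom_on_diff[of x y] subfield_diff[OF A, of x y] by simp

lemma hom_on_inverse: "x \<in> A \<Longrightarrow> \<phi> (inverse x) = inverse (\<phi> x)"
proof (cases "x = 0")
  case False
  assume x: "x \<in> A"
  have "\<phi> x * \<phi> (inverse x) = 1"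
    using False x by (simp add: hom_on_1 subfield_inverse[OF A] flip: hom_on_mult)
  then show ?thesis by (simp add: inverse_unique)
qed (simp add: hom_on_0)

lemma hom_on_divide: "x \<in> A \<Longrightarrow> y \<in> A \<Longrightarrow> \<phi> (x / y) = \<phi> x / \<phi> y"
  using hom_on_mult hom_on_inverse subfield_inverse[OF A] by (simp add: field_class.field_divide_inverse)

lemma hom_on_sum: "(\<And>i. i \<in> I \<Longrightarrow> g i \<in> A) \<Longrightarrow> \<phi> (sum g I) = (\<Sum>i\<in>I. \<phi> (g i))"
  by (induction I rule: infinite_finite_induct)
     (auto simp: hom_on_0 hom_on_add subfield_sum[OF A])

lemma hom_on_prod: "(\<And>i. i \<in> I \<Longrightarrow> g i \<in> A) \<Longrightarrow> \<phi> (prod g I) = (\<Prod>i\<in>I. \<phi> (g i))"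
  by (induction I rule: infinite_finite_induct)
     (auto simp: hom_on_1 hom_on_mult subfield_prod[OF A])

lemma map_poly_hom_add:
  "poly_over A p \<Longrightarrow> poly_over A q \<Longrightarrow> map_poly \<phi> (p + q) = map_poly \<phi> p + map_poly \<phi> q"
  by (rule poly_eqI) (auto simp: coeff_map_poly hom_on_0 hom_on_add poly_over_def)

lemma map_poly_hom_diff:
  "poly_over A p \<Longrightarrow> poly_over A q \<Longrightarrow> map_poly \<phi> (p - q) = map_poly \<phi> p - map_poly \<phi> q"
  by (rule poly_eqI) (auto simp: coeff_map_poly hom_on_0 hom_on_diff poly_over_def)

lemma map_poly_hom_mult:
  "poly_over A p \<Longrightarrow> poly_over A q \<Longrightarrow> map_poly \<phi> (p * q) = map_poly \<phi> p * map_poly \<phi> q"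
  by (rule poly_eqI)
     (auto simp: coeff_map_poly hom_on_0 coeff_mult hom_on_sum hom_on_mult subfield_mult[OF A] poly_over_def)

lemma map_poly_hom_eq_0_iff: "poly_over A p \<Longrightarrow> map_poly \<phi> p = 0 \<longleftrightarrow> p = 0"
  by (auto simp: poly_eq_iff coeff_map_poly hom_on_0 hom_on_eq_0_iff poly_over_def)

lemma degree_map_poly_hom: "poly_over A p \<Longrightarrow> degree (map_poly \<phi> p) = degree p"
  by (rule antisym, rule degree_le, simp add: coeff_map_poly hom_on_0 coeff_eq_0)
     (cases "p = 0"; simp add: le_degree coeff_map_poly hom_on_0 hom_on_eq_0_iff poly_over_def)

lemma hom_on_poly:
  "poly_over A p \<Longrightarrow> x \<in> A \<Longrightarrow> \<phi> (poly p x) = poly (map_poly \<phi> p) (\<phi> x)"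
  using degree_map_poly_hom[of p] unfolding poly_altdef
  by (auto simp: coeff_map_poly hom_on_0 poly_over_def hom_on_sum hom_on_mult hom_on_power subfield_closed[OF A])

end

text \<open>A fraction p(x)/q(x) goes to the corresponding fraction at \<open>y\<close>. That
  \<open>x\<close> and \<open>y\<close> satisfy corresponding equations makes this well defined, and
  covers the transcendental \<open>t\<close> as well as roots of a minimal polynomial.\<close>

lemma hom_on_extend_simple:
  fixes \<phi> :: "'a::field \<Rightarrow> 'b::field"
  assumes A: "is_subfield A" and \<phi>: "hom_on A \<phi>"
    and xy: "\<And>q. poly_over A q \<Longrightarrow> poly q x = 0 \<longleftrightarrow> poly (map_poly \<phi> q) y = 0"
  obtains \<psi> where "hom_on (adjoin A x) \<psi>" "\<And>z. z \<in> A \<Longrightarrow> \<psi> z = \<phi> z" "\<psi> x = y"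
proof -
  define P where "P z w \<longleftrightarrow> (\<exists>p q. poly_over A p \<and> poly_over A q \<and> poly q x \<noteq> 0 \<and>
    z = poly p x / poly q x \<and> w = poly (map_poly \<phi> p) y / poly (map_poly \<phi> q) y)" for z w
  define \<psi> where "\<psi> z = (THE w. P z w)" for z
  have \<psi>: "\<psi> (poly p x / poly q x) = poly (map_poly \<phi> p) y / poly (map_poly \<phi> q) y"
    if "poly_over A p" "poly_over A q" "poly q x \<noteq> 0" for p q
    unfolding \<psi>_def
  proof (rule the_equality)
    show "P (poly p x / poly q x) (poly (map_poly \<phi> p) y / poly (map_poly \<phi> q) y)"
      unfolding P_def using that by blast
    fix w assume "P (poly p x / poly q x) w"
    then obtain p' q' where w: "poly_over A p'" "poly_over A q'" "poly q' x \<noteq> 0"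
      "poly p x / poly q x = poly p' x / poly q' x" "w = poly (map_poly \<phi> p') y / poly (map_poly \<phi> q') y"
      unfolding P_def by blast
    \<comment> \<open>Equality of two fractions becomes the vanishing of one polynomial at
      \<open>x\<close>, which the hypothesis transports to \<open>y\<close>.\<close>
    have "poly (p * q' - p' * q) x = 0"
      using w that by (simp add: field_simps)
    moreover have "poly_over A (p * q' - p' * q)"
      using w that by (intro poly_over_intros[OF A])
    ultimately have "poly (map_poly \<phi> (p * q' - p' * q)) y = 0"
      using xy by blast
    then have "poly (map_poly \<phi> p) y * poly (map_poly \<phi> q') y = poly (map_poly \<phi> p') y * poly (map_poly \<phi> q) y"
      using w that by (simp add: map_poly_hom_diff[OF A \<phi>] map_poly_hom_mult[OF A \<phi>] poly_over_intros[OF A])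
    moreover have "poly (map_poly \<phi> q) y \<noteq> 0" "poly (map_poly \<phi> q') y \<noteq> 0"
      using xy w that by blast+
    ultimately show "w = poly (map_poly \<phi> p) y / poly (map_poly \<phi> q) y"
      using w(5) by (simp add: frac_eq_eq mult.commute)
  qed
  have \<psi>1: "\<psi> (poly p x) = poly (map_poly \<phi> p) y" if "poly_over A p" for p
    using \<psi>[OF that poly_over_1[OF A]] by (simp add: hom_on_1[OF A \<phi>])
  show thesis
  proof
    show "\<psi> x = y"
      using \<psi>1[of "[:0,1:]"] hom_on_0[OF A \<phi>] hom_on_1[OF A \<phi>]
      by (simp add: map_poly_pCons poly_over_intros[OF A] subfield_closed[OF A])
    show "\<psi> z = \<phi> z" if "z \<in> A" for z
      using \<psi>1[of "[:z:]"] that hom_on_0[OF A \<phi>]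
      by (simp add: map_poly_pCons poly_over_intros[OF A])
    have "\<psi> 1 = 1"
      using \<psi>1[of 1] by (simp add: poly_over_intros[OF A] hom_on_1[OF A \<phi>])
    moreover have "\<psi> (u + v) = \<psi> u + \<psi> v \<and> \<psi> (u * v) = \<psi> u * \<psi> v"
      if uv: "u \<in> adjoin A x" "v \<in> adjoin A x" for u v
    proof -
      obtain p q where u: "poly_over A p" "poly_over A q" "poly q x \<noteq> 0" "u = poly p x / poly q x"
        using uv(1) unfolding adjoin_eq[OF A] by auto
      obtain p' q' where v: "poly_over A p'" "poly_over A q'" "poly q' x \<noteq> 0" "v = poly p' x / poly q' x"
        using uv(2) unfolding adjoin_eq[OF A] by auto
      have nz: "poly (map_poly \<phi> q) y \<noteq> 0" "poly (map_poly \<phi> q') y \<noteq> 0"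
        using xy u v by blast+
      have "u + v = poly (p * q' + p' * q) x / poly (q * q') x" "u * v = poly (p * p') x / poly (q * q') x"
        unfolding u(4) v(4) using u(3) v(3) by (simp_all add: add_frac_eq)
      moreover have "poly_over A (p * q' + p' * q)" "poly_over A (p * p')" "poly_over A (q * q')" "poly (q * q') x \<noteq> 0"
        using u v by (auto intro!: poly_over_intros[OF A])
      ultimately have 1: "\<psi> (u + v) = poly (map_poly \<phi> (p * q' + p' * q)) y / poly (map_poly \<phi> (q * q')) y"
         "\<psi> (u * v) = poly (map_poly \<phi> (p * p')) y / poly (map_poly \<phi> (q * q')) y"
        using \<psi> by metis+
      have 2: "\<psi> u = poly (map_poly \<phi> p) y / poly (map_poly \<phi> q) y"
        "\<psi> v = poly (map_poly \<phi> p') y / poly (map_poly \<phi> q') y"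
        using \<psi> u v by metis+
      show ?thesis
        unfolding 1 2 using nz u(1-3) v(1-3)
        by (simp add: map_poly_hom_add[OF A \<phi>] map_poly_hom_mult[OF A \<phi>] poly_over_intros[OF A] field_simps)
    qed
    ultimately show "hom_on (adjoin A x) \<psi>"
      unfolding hom_on_def by blast
  qed
qed

text \<open>If the image of \<open>q\<close> vanishes at \<open>y\<close>, so does that of the gcd
  of \<open>p\<close> and \<open>q\<close> over \<open>A\<close>, which is therefore not constant.
  Its cofactor in \<open>p\<close> has smaller degree than \<open>p\<close> and cannot vanish at
  \<open>x\<close>, so the gcd does.\<close>

lemma min_poly_root_iff:
  fixes \<phi> :: "'a::field \<Rightarrow> 'b::field"
  assumes A: "is_subfield A" and \<phi>: "hom_on A \<phi>" and p: "min_poly A x p"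
    and y: "poly (map_poly \<phi> p) y = 0" and q: "poly_over A q"
  shows "poly q x = 0 \<longleftrightarrow> poly (map_poly \<phi> q) y = 0"
proof
  assume "poly q x = 0"
  then obtain s where "poly_over A s" "q = p * s"
    using min_poly_dvd[OF A p q] by blast
  then show "poly (map_poly \<phi> q) y = 0"
    using y p by (simp add: map_poly_hom_mult[OF A \<phi>] min_poly_def)
next
  assume qy: "poly (map_poly \<phi> q) y = 0"
  have p': "poly_over A p" "p \<noteq> 0" "poly p x = 0"
    using p by (auto simp: min_poly_def)
  obtain g u v where g: "poly_over A g" "poly_over A u" "poly_over A v" "g = u * p + v * q"
    "g \<noteq> 0" "g dvd p" "g dvd q"
    using poly_over_bezout[OF A p'(1) q p'(2)] by blast
  have gy: "poly (map_poly \<phi> g) y = 0"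
    unfolding g(4) using g p' q y qy
    by (simp add: map_poly_hom_add[OF A \<phi>] map_poly_hom_mult[OF A \<phi>] poly_over_intros[OF A])
  obtain s where s: "poly_over A s" "p = g * s"
    using poly_over_dvd[OF A g(1,5) p'(1) g(6)] by blast
  show "poly q x = 0"
  proof (cases "poly g x = 0")
    case True
    then show ?thesis using g(7) by auto
  next
    case False
    then have "poly s x = 0" "s \<noteq> 0"
      using s p' by auto
    then have "degree p \<le> degree s"
      using p s unfolding min_poly_def by blast
    then have "degree g = 0"
      using s g(5) \<open>s \<noteq> 0\<close> by (simp add: degree_mult_eq)
    then obtain c where c: "g = [:c:]"
      by (metis degree_eq_zeroE)
    then have "c \<in> A" "c \<noteq> 0"
      using g by (auto simp: poly_over_def coeff_pCons split: nat.splits)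
    then have False
      using gy c hom_on_eq_0_iff[OF A \<phi>] hom_on_0[OF A \<phi>] by (simp add: map_poly_pCons)
    then show ?thesis ..
  qed
qed

lemma hom_on_extend_algebraic:
  fixes \<phi> :: "'a::field \<Rightarrow> 'b::field"
  assumes "is_subfield A" "hom_on A \<phi>" "min_poly A x p" "poly (map_poly \<phi> p) y = 0"
  obtains \<psi> where "hom_on (adjoin A x) \<psi>" "\<And>z. z \<in> A \<Longrightarrow> \<psi> z = \<phi> z" "\<psi> x = y"
  using hom_on_extend_simple[OF assms(1,2) min_poly_root_iff[OF assms]] by blast

lemma algebraic_elem_mono: "algebraic_elem A x \<Longrightarrow> A \<subseteq> B \<Longrightarrow> algebraic_elem B x"
  by (auto simp: algebraic_elem_def poly_over_def)

text \<open>
  Partial homomorphisms are handled as relations: a single-valued relation closed under the field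
  operations, so that unions of chains are immediate in Zorn's lemma.
\<close>

lemma hom_on_extend:
  fixes \<phi> :: "'a::field \<Rightarrow> 'b::alg_closed_field"
  assumes F: "is_subfield F" and L: "is_subfield L" and FL: "F \<subseteq> L"
    and alg: "\<And>x. x \<in> L \<Longrightarrow> algebraic_elem F x" and \<phi>: "hom_on F \<phi>"
  obtains \<psi> where "hom_on L \<psi>" "\<And>x. x \<in> F \<Longrightarrow> \<psi> x = \<phi> x"
proof -
  \<comment> \<open>Closure under the field operations belongs to the predicate: it makes the domain
    of a maximal relation a subfield.\<close>
  define G where "G R \<longleftrightarrow> (\<lambda>x. (x, \<phi> x)) ` F \<subseteq> R \<and> Domain R \<subseteq> L \<and>
    (\<forall>x u y v. (x, u) \<in> R \<and> (y, v) \<in> R \<longrightarrow> (x = y \<longrightarrow> u = v) \<and> (x - y, u - v) \<in> R \<and>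
       (x * y, u * v) \<in> R \<and> (x + y, u + v) \<in> R \<and> (inverse x, inverse u) \<in> R)" for R
  have graph: "G ((\<lambda>x. (x, \<psi> x)) ` A)"
    if A: "is_subfield A" "F \<subseteq> A" "A \<subseteq> L" and \<psi>: "hom_on A \<psi>" "\<And>x. x \<in> F \<Longrightarrow> \<psi> x = \<phi> x" for A \<psi>
    unfolding G_def using that
    by (auto simp: image_iff hom_on_diff[OF A(1) \<psi>(1)] hom_on_mult[OF A(1) \<psi>(1)]
       hom_on_add[OF A(1) \<psi>(1)] hom_on_inverse[OF A(1) \<psi>(1)] intro: subfield_closed[OF A(1)])
  have "\<exists>M\<in>Collect G. \<forall>N\<in>Collect G. M \<subseteq> N \<longrightarrow> N = M"
  proof (rule subset_Zorn_nonempty)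
    show "Collect G \<noteq> {}"
      using graph[OF F subset_refl FL \<phi>] by auto
    fix C assume C: "C \<noteq> {}" "subset.chain (Collect G) C"
    have two: "\<exists>R\<in>C. G R \<and> a \<in> R \<and> b \<in> R" if ab: "a \<in> \<Union>C" "b \<in> \<Union>C" for a b
    proof -
      obtain R S where "R \<in> C" "a \<in> R" "S \<in> C" "b \<in> S" using ab by blast
      moreover have "R \<subseteq> S \<or> S \<subseteq> R" "G R" "G S"
        using C(2) calculation unfolding subset.chain_def by blast+
      ultimately show ?thesis by blast
    qed
    have CG: "G R" if "R \<in> C" for R
      using C(2) that unfolding subset.chain_def by blast
    have c1: "\<forall>x u y v. (x, u) \<in> \<Union>C \<and> (y, v) \<in> \<Union>C \<longrightarrow> (x = y \<longrightarrow> u = v) \<and> (x - y, u - v) \<in> \<Union>C \<and>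
       (x * y, u * v) \<in> \<Union>C \<and> (x + y, u + v) \<in> \<Union>C \<and> (inverse x, inverse u) \<in> \<Union>C"
    proof (intro allI impI, elim conjE)
      fix x u y v assume xy: "(x, u) \<in> \<Union>C" "(y, v) \<in> \<Union>C"
      obtain R where R: "R \<in> C" "G R" "(x, u) \<in> R" "(y, v) \<in> R"
        using two[OF xy] by blast
      then have "(x = y \<longrightarrow> u = v) \<and> (x - y, u - v) \<in> R \<and>
       (x * y, u * v) \<in> R \<and> (x + y, u + v) \<in> R \<and> (inverse x, inverse u) \<in> R"
        unfolding G_def by simp
      then show "(x = y \<longrightarrow> u = v) \<and> (x - y, u - v) \<in> \<Union>C \<and>
       (x * y, u * v) \<in> \<Union>C \<and> (x + y, u + v) \<in> \<Union>C \<and> (inverse x, inverse u) \<in> \<Union>C"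
        using R(1) by (meson UnionI)
    qed
    have c2: "(\<lambda>x. (x, \<phi> x)) ` F \<subseteq> \<Union>C"
    proof -
      obtain R where "R \<in> C" using C(1) by blast
      moreover have "(\<lambda>x. (x, \<phi> x)) ` F \<subseteq> R"
        using CG[OF \<open>R \<in> C\<close>] unfolding G_def by (rule conjunct1)
      ultimately show ?thesis by (meson Union_upper order_trans)
    qed
    have c3: "Domain (\<Union>C) \<subseteq> L"
    proof -
      have "Domain R \<subseteq> L" if "R \<in> C" for R
        using CG[OF that] unfolding G_def by simp
      then show ?thesis by auto
    qed
    show "\<Union>C \<in> Collect G"
      unfolding G_def mem_Collect_eq by (intro conjI c1 c2 c3)
  qed
  then obtain M where GM: "G M" and max: "\<And>N. G N \<Longrightarrow> M \<subseteq> N \<Longrightarrow> N = M"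
    by blast
  define A where "A = Domain M"
  define \<psi> where "\<psi> x = (THE u. (x, u) \<in> M)" for x
  have \<psi>: "\<psi> x = u" if "(x, u) \<in> M" for x u
    unfolding \<psi>_def
  proof (rule the_equality)
    fix v assume "(x, v) \<in> M"
    then show "v = u" using that GM unfolding G_def by metis
  qed (fact that)
  have Mgraph: "M = (\<lambda>x. (x, \<psi> x)) ` A"
    using \<psi> unfolding A_def by force
  have FA: "F \<subseteq> A" "A \<subseteq> L"
    using GM unfolding G_def A_def by auto
  have A: "is_subfield A"
    unfolding is_subfield_iff
  proof (intro conjI ballI)
    show "1 \<in> A" using FA subfield_1[OF F] by blast
    fix x y assume "x \<in> A" "y \<in> A"
    then obtain u v where "(x, u) \<in> M" "(y, v) \<in> M" unfolding A_def by blast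
    then have "(x - y, u - v) \<in> M" "(x * y, u * v) \<in> M"
      using GM unfolding G_def by simp_all
    then show "x - y \<in> A" "x * y \<in> A"
      unfolding A_def by auto
  next
    fix x assume "x \<in> A"
    then obtain u where "(x, u) \<in> M" unfolding A_def by blast
    then have "(inverse x, inverse u) \<in> M"
      using GM unfolding G_def by simp
    then show "inverse x \<in> A" unfolding A_def by auto
  qed
  have \<psi>F: "\<psi> x = \<phi> x" if "x \<in> F" for x
    using GM that unfolding G_def by (intro \<psi>) auto
  have hom: "hom_on A \<psi>"
    unfolding hom_on_def
  proof (intro conjI ballI)
    show "\<psi> 1 = 1"
      using \<psi>F[OF subfield_1[OF F]] hom_on_1[OF F \<phi>] by simp
    fix x y assume "x \<in> A" "y \<in> A"
    then have "(x, \<psi> x) \<in> M" "(y, \<psi> y) \<in> M" unfolding Mgraph by auto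
    then have "(x + y, \<psi> x + \<psi> y) \<in> M" "(x * y, \<psi> x * \<psi> y) \<in> M"
      using GM unfolding G_def by simp_all
    then show "\<psi> (x + y) = \<psi> x + \<psi> y" "\<psi> (x * y) = \<psi> x * \<psi> y"
      by (auto intro: \<psi>)
  qed
  have "L \<subseteq> A"
  proof
    fix x assume x: "x \<in> L"
    then have "algebraic_elem A x"
      using alg algebraic_elem_mono FA by blast
    then obtain p where p: "min_poly A x p"
      by (rule min_poly_exists)
    \<comment> \<open>The target is algebraically closed, so the transported minimal polynomial has
      a root to which \<open>x\<close> can be sent; maximality then forces \<open>x\<close> into the
      domain.\<close>
    have "degree (map_poly \<psi> p) > 0"
      using min_poly_degree_pos[OF p] p by (simp add: degree_map_poly_hom[OF A hom] min_poly_def)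
    then obtain y where "poly (map_poly \<psi> p) y = 0"
      using alg_closed_imp_poly_has_root by blast
    then obtain \<chi> where \<chi>: "hom_on (adjoin A x) \<chi>" "\<And>z. z \<in> A \<Longrightarrow> \<chi> z = \<psi> z"
      using hom_on_extend_algebraic[OF A hom p] by metis
    have sub: "is_subfield (adjoin A x)" "A \<subseteq> adjoin A x" "x \<in> adjoin A x" "adjoin A x \<subseteq> L"
      using is_subfield_generate_field generate_field_superset[of "insert x A"]
        generate_field_least[OF L, of "insert x A"] x FA by auto
    have "G ((\<lambda>z. (z, \<chi> z)) ` adjoin A x)"
      by (rule graph) (use sub FA \<chi> \<psi>F in auto)
    moreover have "M \<subseteq> (\<lambda>z. (z, \<chi> z)) ` adjoin A x"
      unfolding Mgraph using \<chi>(2) sub(2) by force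
    ultimately have "(\<lambda>z. (z, \<chi> z)) ` adjoin A x = M"
      by (rule max)
    then have "(x, \<chi> x) \<in> M" using sub(3) by blast
    then show "x \<in> A" unfolding A_def by auto
  qed
  then show thesis
    using that hom \<psi>F FA by (metis subset_antisym)
qed

section \<open>Separable extensions and Galois groups\<close>

lemma separable_poly_nonzero: "separable_poly p \<Longrightarrow> p \<noteq> 0"
  by (auto simp: separable_poly_def)

lemma separable_poly_factor:
  assumes "separable_poly (u * v)"
  shows "separable_poly u" "separable_poly v"
proof -
  have *: "separable_poly u" if "separable_poly (u * v)" for u v :: "'a poly"
    unfolding separable_poly_def
  proof (rule coprimeI)
    fix c assume "c dvd u" "c dvd pderiv u"
    then have "c dvd u * v" "c dvd pderiv (u * v)"
      by (auto simp: pderiv_mult)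
    then show "is_unit c"
      using that unfolding separable_poly_def by (meson coprime_common_divisor)
  qed
  show "separable_poly u" "separable_poly v"
    using *[of u v] *[of v u] assms by (simp_all add: mult.commute)
qed

lemma separable_poly_square:
  assumes "separable_poly (u * v)" "poly u x = 0" "poly v x = 0"
  shows False
proof -
  have "[:-x, 1:] dvd u" "[:-x, 1:] dvd v"
    using assms(2,3) by (simp_all add: poly_eq_0_iff_dvd)
  then have "[:-x, 1:] dvd u * v" "[:-x, 1:] dvd pderiv (u * v)"
    by (auto simp: pderiv_mult)
  then have "is_unit [:-x, 1:]"
    using assms(1) unfolding separable_poly_def by (meson coprime_common_divisor)
  then show False
    by (simp add: is_unit_iff_degree)
qed

lemma separable_over_mono: "separable_over A x \<Longrightarrow> A \<subseteq> B \<Longrightarrow> separable_over B x"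
  by (auto simp: separable_over_def poly_over_def)

lemma separable_over_imp_algebraic: "separable_over A x \<Longrightarrow> algebraic_elem A x"
  unfolding separable_over_def algebraic_elem_def using separable_poly_nonzero by blast

lemma separably_closed_splits:
  assumes L: "is_subfield L" "separably_closed L"
    and p: "poly_over L p" "separable_poly p"
  shows "\<exists>xs. set xs \<subseteq> L \<and> p = smult (lead_coeff p) (\<Prod>x\<leftarrow>xs. [:- x, 1:])"
  using p
proof (induction "degree p" arbitrary: p)
  case 0
  then show ?case
    by (intro exI[of _ "[]"]) (auto elim: degree_eq_zeroE)
next
  case (Suc n)
  then obtain x where x: "x \<in> L" "poly p x = 0"
    using L(2) unfolding separably_closed_def by (metis zero_less_Suc)
  have lin: "poly_over L [:-x, 1:]"
    using x by (intro poly_over_intros[OF L(1)] subfield_closed[OF L(1)])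
  obtain s where s: "poly_over L s" "p = [:-x, 1:] * s"
    using poly_over_dvd[OF L(1) lin _ Suc.prems(1)] x by (auto simp: poly_eq_0_iff_dvd)
  have s0: "s \<noteq> 0"
    using s Suc.hyps(2) by auto
  have "n = degree s"
    using Suc.hyps(2) unfolding s(2) using s0 by (subst (asm) degree_mult_eq) auto
  moreover have "separable_poly s"
    using separable_poly_factor[of "[:-x,1:]" s] Suc.prems s by simp
  ultimately obtain xs where xs: "set xs \<subseteq> L" "s = smult (lead_coeff s) (\<Prod>x\<leftarrow>xs. [:- x, 1:])"
    using Suc.hyps(1) s(1) by blast
  have "lead_coeff p = lead_coeff s"
    unfolding s(2) lead_coeff_mult by simp
  then have "p = smult (lead_coeff p) (\<Prod>x\<leftarrow>x # xs. [:- x, 1:])"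
    using xs(2) s(2) by (metis (no_types) list.simps(9) mult_smult_right prod_list.Cons)
  then show ?case
    using xs x by (intro exI[of _ "x # xs"]) auto
qed

text \<open>The polynomial already splits over \<open>L\<close> and \<open>\<psi>\<close> carries
  the linear factors along, so a larger target contributes no further roots. This is what brings
  values in a big algebraic closure back to \<open>L\<close>.\<close>

lemma separably_closed_root_image:
  fixes \<psi> :: "'a::field \<Rightarrow> 'b::field"
  assumes L: "is_subfield L" "separably_closed L" and \<psi>: "hom_on L \<psi>"
    and p: "poly_over L p" "separable_poly p" and w: "poly (map_poly \<psi> p) w = 0"
  obtains x where "x \<in> L" "poly p x = 0" "w = \<psi> x"
proof -
  have "\<exists>x\<in>L. poly p x = 0 \<and> w = \<psi> x"
    using p w
  proof (induction "degree p" arbitrary: p)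
    case 0
    then obtain c where "p = [:c:]" by (metis degree_eq_zeroE)
    moreover have "c \<noteq> 0" "c \<in> L"
      using 0 calculation by (auto simp: separable_poly_def poly_over_def coeff_pCons split: nat.splits)
    ultimately show ?case
      using 0 hom_on_eq_0_iff[OF L(1) \<psi>] hom_on_0[OF L(1) \<psi>] by (simp add: map_poly_pCons)
  next
    case (Suc n)
    then obtain x where x: "x \<in> L" "poly p x = 0"
      using L(2) unfolding separably_closed_def by (metis zero_less_Suc)
    have lin: "poly_over L [:-x, 1:]"
      using x by (intro poly_over_intros[OF L(1)] subfield_closed[OF L(1)])
    obtain s where s: "poly_over L s" "p = [:-x, 1:] * s"
      using poly_over_dvd[OF L(1) lin _ Suc.prems(1)] x by (auto simp: poly_eq_0_iff_dvd)
    have s0: "s \<noteq> 0"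
      using s Suc.hyps(2) by auto
    have "n = degree s"
      using Suc.hyps(2) unfolding s(2) using s0 by (subst (asm) degree_mult_eq) auto
    moreover have "separable_poly s"
      using separable_poly_factor[of "[:-x,1:]" s] Suc.prems s by simp
    moreover have "poly (map_poly \<psi> [:-x, 1:]) w * poly (map_poly \<psi> s) w = 0"
      using Suc.prems(3) unfolding s(2) map_poly_hom_mult[OF L(1) \<psi> lin s(1)] by simp
    then have "w = \<psi> x \<or> poly (map_poly \<psi> s) w = 0"
      using x by (simp add: map_poly_pCons hom_on_0[OF L(1) \<psi>] hom_on_1[OF L(1) \<psi>] hom_on_uminus[OF L(1) \<psi>])
    ultimately show ?case
      using Suc.hyps(1)[of s] s x by auto
  qed
  then show thesis using that by blast
qed

section \<open>Galois groups: conjugates and the fixed field\<close>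

lemma galois_group_mono: "F \<subseteq> F' \<Longrightarrow> galois_group L F' \<subseteq> galois_group L F"
  by (auto simp: galois_group_def)

lemma galois_group_hom:
  assumes "is_subfield F" "\<sigma> \<in> galois_group L F"
  shows "hom_on L \<sigma>" "\<And>x. x \<in> L \<Longrightarrow> \<sigma> x \<in> L" "\<And>x. x \<in> F \<Longrightarrow> \<sigma> x = x" "\<sigma> \<in> extensional L"
    "bij_betw \<sigma> L L"
  using assms subfield_1[OF assms(1)]
  by (auto simp: galois_group_def hom_on_def Bij_def bij_betw_def)

text \<open>Surjectivity is automatic for an algebraic extension: an injective endomorphism over
  \<open>F\<close> permutes the finitely many roots in \<open>L\<close> of each polynomial over
  \<open>F\<close>.\<close>

lemma galois_groupI:
  assumes L: "is_subfield L" "F \<subseteq> L" and alg: "\<And>x. x \<in> L \<Longrightarrow> algebraic_elem F x"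
    and \<sigma>: "hom_on L \<sigma>" "\<And>x. x \<in> L \<Longrightarrow> \<sigma> x \<in> L" "\<And>x. x \<in> F \<Longrightarrow> \<sigma> x = x" "\<sigma> \<in> extensional L"
  shows "\<sigma> \<in> galois_group L F"
proof -
  have inj: "inj_on \<sigma> L"
    by (auto simp: inj_on_def hom_on_eq_iff[OF L(1) \<sigma>(1)])
  have "x \<in> \<sigma> ` L" if x: "x \<in> L" for x
  proof -
    obtain p where p: "poly_over F p" "p \<noteq> 0" "poly p x = 0"
      using alg[OF x] by (auto simp: algebraic_elem_def)
    define R where "R = {y\<in>L. poly p y = 0}"
    have Lp: "poly_over L p"
      using p L by (auto simp: poly_over_def)
    have "map_poly \<sigma> p = p"
      using p \<sigma>(3) by (intro poly_eqI) (simp add: coeff_map_poly hom_on_0[OF L(1) \<sigma>(1)] poly_over_def)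
    then have "\<sigma> ` R \<subseteq> R"
      unfolding R_def using hom_on_poly[OF L(1) \<sigma>(1) Lp] hom_on_0[OF L(1) \<sigma>(1)] \<sigma>(2) by force
    moreover have "finite R"
      unfolding R_def using poly_roots_finite[OF p(2)] by auto
    ultimately have "\<sigma> ` R = R"
      using inj unfolding R_def by (intro endo_inj_surj) (auto intro: inj_on_subset)
    then show ?thesis
      using x p unfolding R_def by blast
  qed
  then have "bij_betw \<sigma> L L"
    using inj \<sigma>(2) unfolding bij_betw_def by blast
  then show ?thesis
    using \<sigma> by (auto simp: galois_group_def Bij_def hom_on_def)
qed

lemma to_ac_hom_on: "hom_on A to_ac"
  by (simp add: hom_on_def)

text \<open>Homomorphisms are extended into an algebraically closed target, hence the detour through
  the algebraic closure. The extension returns to the copy of \<open>L\<close>, since each element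
  is a root of a separable polynomial whose roots all lie in \<open>L\<close>.\<close>

lemma galois_group_extend:
  assumes F: "is_subfield F" and L: "is_subfield L" "separably_closed L" and FL: "F \<subseteq> L"
    and sep: "\<And>x. x \<in> L \<Longrightarrow> separable_over F x"
    and p: "min_poly F x p" and y: "y \<in> L" "poly p y = 0" and x: "x \<in> L"
  obtains \<sigma> where "\<sigma> \<in> galois_group L F" "\<sigma> x = y"
proof -
  have "poly (map_poly to_ac p) (to_ac y) = 0"
    using hom_on_poly[of UNIV to_ac p y] to_ac_hom_on[of UNIV] y by (simp add: is_subfield_iff poly_over_def)
  then obtain \<phi> where \<phi>: "hom_on (adjoin F x) \<phi>" "\<And>z. z \<in> F \<Longrightarrow> \<phi> z = to_ac z" "\<phi> x = to_ac y"
    using hom_on_extend_algebraic[OF F to_ac_hom_on p] by metis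
  have sub: "is_subfield (adjoin F x)" "F \<subseteq> adjoin F x" "x \<in> adjoin F x" "adjoin F x \<subseteq> L"
    using is_subfield_generate_field generate_field_superset[of "insert x F"]
      generate_field_least[OF L(1), of "insert x F"] x FL by auto
  have "algebraic_elem (adjoin F x) z" if "z \<in> L" for z
    using separable_over_imp_algebraic[OF sep[OF that]] algebraic_elem_mono sub(2) by blast
  then obtain \<psi> where \<psi>: "hom_on L \<psi>" "\<And>z. z \<in> adjoin F x \<Longrightarrow> \<psi> z = \<phi> z"
    using hom_on_extend[OF sub(1) L(1) sub(4) _ \<phi>(1)] by metis
  have \<psi>F: "\<psi> z = to_ac z" if "z \<in> F" for z
    using \<psi>(2) \<phi>(2) sub(2) that by auto
  have im: "\<psi> z \<in> to_ac ` L" if z: "z \<in> L" for z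
  proof -
    obtain q where q: "poly_over F q" "separable_poly q" "poly q z = 0"
      using sep[OF z] by (auto simp: separable_over_def)
    have Lq: "poly_over L q"
      using q FL by (auto simp: poly_over_def)
    have "map_poly \<psi> q = map_poly to_ac q"
      using q \<psi>F by (intro poly_eqI) (simp add: coeff_map_poly hom_on_0[OF L(1) \<psi>(1)] poly_over_def)
    moreover have "poly (map_poly \<psi> q) (\<psi> z) = 0"
      using hom_on_poly[OF L(1) \<psi>(1) Lq z] q hom_on_0[OF L(1) \<psi>(1)] by simp
    ultimately have "poly (map_poly to_ac q) (\<psi> z) = 0" by simp
    then show ?thesis
      using separably_closed_root_image[OF L to_ac_hom_on Lq q(2)] by blast
  qed
  define \<sigma> where "\<sigma> = restrict (\<lambda>z. of_ac (\<psi> z)) L"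
  have \<sigma>: "to_ac (\<sigma> z) = \<psi> z" "\<sigma> z \<in> L" if "z \<in> L" for z
    using im[OF that] that by (auto simp: \<sigma>_def)
  have "\<sigma> \<in> galois_group L F"
  proof (rule galois_groupI[OF L(1) FL])
    show "algebraic_elem F z" if "z \<in> L" for z
      using separable_over_imp_algebraic sep that by blast
    have "to_ac (\<sigma> (u + v)) = to_ac (\<sigma> u + \<sigma> v)" "to_ac (\<sigma> (u * v)) = to_ac (\<sigma> u * \<sigma> v)"
      if "u \<in> L" "v \<in> L" for u v
      using that by (simp_all add: \<sigma> subfield_closed[OF L(1)] hom_on_add[OF L(1) \<psi>(1)] hom_on_mult[OF L(1) \<psi>(1)])
    moreover have "\<sigma> 1 = 1"
      using subfield_1[OF L(1)] hom_on_1[OF L(1) \<psi>(1)] by (simp add: \<sigma>_def)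
    ultimately show "hom_on L \<sigma>"
      unfolding hom_on_def to_ac_eq_iff by blast
    show "\<sigma> z = z" if "z \<in> F" for z
      using \<psi>F[OF that] that FL by (auto simp: \<sigma>_def)
  qed (use \<sigma> in \<open>auto simp: \<sigma>_def\<close>)
  moreover have "\<sigma> x = y"
    using x \<psi>(2)[OF sub(3)] \<phi>(3) by (simp add: \<sigma>_def)
  ultimately show thesis using that by blast
qed

text \<open>If the minimal polynomial is not linear, separability gives it a second root, and some
  automorphism moves \<open>x\<close> there. If it is linear, \<open>x\<close> is a quotient of its
  coefficients up to sign.\<close>

lemma galois_group_fixed_field:
  assumes F: "is_subfield F" and L: "is_subfield L" "separably_closed L" and FL: "F \<subseteq> L"
    and sep: "\<And>x. x \<in> L \<Longrightarrow> separable_over F x"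
    and x: "x \<in> L" and fixed: "\<And>\<sigma>. \<sigma> \<in> galois_group L F \<Longrightarrow> \<sigma> x = x"
  shows "x \<in> F"
proof -
  obtain q where q: "poly_over F q" "separable_poly q" "poly q x = 0"
    using sep[OF x] by (auto simp: separable_over_def)
  obtain p where p: "min_poly F x p"
    using separable_over_imp_algebraic[OF sep[OF x]] min_poly_exists by blast
  then have pF: "poly_over F p" "poly p x = 0" "p \<noteq> 0"
    by (auto simp: min_poly_def)
  have psep: "separable_poly p"
    using min_poly_dvd[OF F p q(1,3)] q(2) separable_poly_factor by metis
  have lin: "poly_over L [:-x, 1:]"
    using x by (intro poly_over_intros[OF L(1)] subfield_closed[OF L(1)])
  have pL: "poly_over L p"
    using pF FL by (auto simp: poly_over_def)
  obtain s where s: "poly_over L s" "p = [:-x, 1:] * s"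
    using poly_over_dvd[OF L(1) lin _ pL] pF by (auto simp: poly_eq_0_iff_dvd)
  have s0: "s \<noteq> 0" using s pF by auto
  have ssep: "separable_poly s"
    using separable_poly_factor[of "[:-x,1:]" s] psep s by simp
  show ?thesis
  proof (cases "degree s > 0")
    case True
    then obtain y where y: "y \<in> L" "poly s y = 0"
      using L(2) s(1) ssep unfolding separably_closed_def by blast
    have "poly p y = 0" using y s by simp
    then obtain \<sigma> where "\<sigma> \<in> galois_group L F" "\<sigma> x = y"
      using galois_group_extend[OF F L FL sep p y(1) _ x] by blast
    then have "y = x" using fixed by auto
    then have False
      using separable_poly_square[of "[:-x,1:]" s x] psep s y by simp
    then show ?thesis ..
  next
    case False
    then obtain c where c: "s = [:c:]" by (metis degree_eq_zeroE not_gr_zero)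
    then have "p = [:- x * c, c:]" "c \<noteq> 0" using s s0 by auto
    then have "coeff p 0 = - x * c" "coeff p 1 = c" by auto
    then have "- (coeff p 0 / coeff p 1) = x" using \<open>c \<noteq> 0\<close> by simp
    then show ?thesis
      using pF subfield_closed[OF F] unfolding poly_over_def by metis
  qed
qed

section \<open>Algebraic elements over a subfield\<close>

text \<open>Gives access to dimension arguments for list polynomials, in which the leading
  coefficient comes first; hence the reversals.\<close>

lemma algebraic_elem_iff:
  fixes K :: "'a::field set"
  assumes K: "is_subfield K"
  shows "algebraic_elem K x \<longleftrightarrow> ring.algebraic ring_of_type_algebra K x"
proof -
  let ?R = "ring_of_type_algebra :: 'a ring"
  interpret ff: field ?R by rule
  have s: "carrier ?R = UNIV" "\<one>\<^bsub>?R\<^esub> = 1" "\<zero>\<^bsub>?R\<^esub> = 0"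
    "u \<oplus>\<^bsub>?R\<^esub> v = u + v" "u \<otimes>\<^bsub>?R\<^esub> v = u * v" for u v :: 'a
    by (auto simp: ring_of_type_algebra_def)
  have pw: "u [^]\<^bsub>?R\<^esub> n = u ^ n" for u :: 'a and n :: nat
    by (induction n) (simp_all add: s)
  have ev: "ff.eval ps x = poly (Poly (rev ps)) x" for ps
    by (induction ps) (simp_all add: s pw Poly_append poly_monom mult.commute)
  note sub = ff.algebraicE[OF subfieldE(1)[OF K], of x]
  show ?thesis
  proof
    assume "algebraic_elem K x"
    then obtain p where p: "poly_over K p" "p \<noteq> 0" "poly p x = 0"
      by (auto simp: algebraic_elem_def)
    define ps where "ps = rev (coeffs p)"
    have "ps \<in> carrier (univ_poly ?R K)"
      using p unfolding univ_poly_carrier[symmetric] polynomial_def ps_def s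
      by (auto simp: poly_over_def hd_rev last_coeffs_eq_coeff_degree coeffs_def)
    moreover have "ff.eval ps x = \<zero>\<^bsub>?R\<^esub>"
      unfolding ev s ps_def using p by simp
    moreover have "ps \<noteq> []" using p by (simp add: ps_def)
    ultimately show "ff.algebraic K x" using ff.algebraicI by (simp add: over_def)
  next
    assume "ff.algebraic K x"
    then obtain ps where ps: "ps \<in> carrier (univ_poly ?R K)" "ps \<noteq> []" "ff.eval ps x = \<zero>\<^bsub>?R\<^esub>"
      using sub by (auto simp: s over_def)
    have ps': "set ps \<subseteq> K" "hd ps \<noteq> 0"
      using ps unfolding univ_poly_carrier[symmetric] polynomial_def by (auto simp: s)
    have "Poly (rev ps) \<noteq> 0"
      using ps' ps(2) by (metis Poly_eq_0 last_rev last_replicate rev_is_Nil_conv replicate_empty)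
    moreover have "poly_over K (Poly (rev ps))"
      using ps' subfield_0[OF K] by (auto simp: poly_over_def nth_default_def rev_nth)
    ultimately show "algebraic_elem K x"
      unfolding algebraic_elem_def using ps(3) ev by (auto simp: s)
  qed
qed

lemma algebraic_elem_self: "is_subfield K \<Longrightarrow> x \<in> K \<Longrightarrow> algebraic_elem K x"
  unfolding algebraic_elem_def
  by (intro exI[of _ "[:- x, 1:]"]) (auto intro!: poly_over_intros subfield_closed)

lemma is_subfield_algebraic:
  fixes K :: "'a::field set"
  assumes K: "is_subfield K"
  shows "is_subfield {x. algebraic_elem K x}"
  using field.subfield_of_algebraics[OF field_from_type_algebra K]
  by (simp add: algebraic_elem_iff[OF K] over_def carrier_ring_of_type_algebra)

text \<open>The coefficients of an annihilating polynomial generate a finite extension of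
  \<open>K\<close>, and adjoining \<open>x\<close> to it keeps the dimension over \<open>K\<close>
  finite.\<close>

lemma algebraic_elem_trans:
  fixes K :: "'a::field set"
  assumes K: "is_subfield K" and x: "algebraic_elem {x. algebraic_elem K x} x"
  shows "algebraic_elem K x"
proof -
  let ?R = "ring_of_type_algebra :: 'a ring"
  interpret ff: field ?R by rule
  note c = carrier_ring_of_type_algebra
  obtain p where p: "\<And>i. algebraic_elem K (coeff p i)" "p \<noteq> 0" "poly p x = 0"
    using x by (auto simp: algebraic_elem_def[of "{x. algebraic_elem K x}"] poly_over_def)
  define xs where "xs = coeffs p"
  define E where "E = ff.finite_extension K xs"
  have alg: "(ff.algebraic over K) y" if "y \<in> set xs" for y
    using that p(1) algebraic_elem_iff[OF K] by (auto simp: xs_def coeffs_def over_def split: if_splits)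
  have xs: "set xs \<subseteq> carrier ?R" by (simp add: c)
  have E: "is_subfield E"
    unfolding E_def by (rule ff.finite_extension_is_subfield[OF K xs alg])
  have fin: "ff.finite_dimension K E"
    unfolding E_def by (rule ff.finite_extension_finite_dimension(1)[OF K xs alg])
  have "set xs \<subseteq> E"
    unfolding E_def by (rule ff.finite_extension_mem[OF subfieldE(1)[OF K] xs])
  then have "poly_over E p"
    unfolding poly_over_def xs_def using subfield_0[OF E]
    by (metis coeff_in_coeffs coeff_eq_0 in_mono linorder_le_less_linear p(2))
  then have "algebraic_elem E x"
    unfolding algebraic_elem_def using p by blast
  then have algx: "(ff.algebraic over E) x"
    by (simp add: algebraic_elem_iff[OF E] over_def)
  have "ff.finite_dimension E (ff.simple_extension E x)"
    using ff.finite_dimension_simple_extension[OF E, of x] algx by (simp add: c)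
  then have "ff.finite_dimension K (ff.simple_extension E x)"
    using ff.telescopic_base_dim(1)[OF K E fin] by blast
  then have "(ff.algebraic over K) x"
    using ff.finite_dimension_imp_algebraic[OF K ff.simple_extension_is_subring[OF subfieldE(1)[OF E]]]
      ff.simple_extension_mem[OF subfieldE(1)[OF E], of x] by (simp add: c)
  then show ?thesis
    by (simp add: algebraic_elem_iff[OF K] over_def)
qed

section \<open>Roots of unity\<close>

text \<open>Up to the invertible factor n, the derivative times X is X^n. A common divisor thus
  divides X^n and X^n - u, hence the nonzero constant u.\<close>

lemma separable_poly_root:
  fixes u :: "'a::field"
  assumes "of_nat n \<noteq> (0::'a)" "u \<noteq> 0"
  shows "separable_poly (monom 1 n - [:u:])"
  unfolding separable_poly_def
proof (rule coprimeI)
  fix c assume c: "c dvd monom 1 n - [:u:]" "c dvd pderiv (monom 1 n - [:u:])"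
  have n: "n > 0"
    using assms(1) by (cases n) auto
  have "pderiv (monom 1 n - [:u:]) * [:0, inverse (of_nat n):] = monom 1 n"
    using n assms(1) by (intro poly_eqI) (auto simp: coeff_pderiv coeff_pCons split: nat.splits)
  then have "c dvd monom 1 n"
    using c(2) by (metis dvd_mult2)
  then have "c dvd [:u:]"
    using c(1) by (metis diff_diff_eq2 add_diff_cancel_left' dvd_diff diff_add_cancel)
  then show "is_unit c"
    using assms(2) by (meson dvd_trans is_unit_const_poly_iff dvd_field_iff is_unit_triv)
qed

lemma separably_closed_nth_root:
  fixes k :: "'a::field set"
  assumes k: "is_subfield k" "separably_closed k" and n: "of_nat n \<noteq> (0::'a)" and u: "u \<in> k"
  obtains w where "w \<in> k" "w ^ n = u"
proof (cases "u = 0")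
  case True
  have "n > 0" using n by (cases n) auto
  then show thesis using that[of 0] True subfield_0[OF k(1)] by simp
next
  case False
  have n0: "n > 0" using n by (cases n) auto
  have "poly_over k (monom 1 n - [:u:])"
    using u by (intro poly_over_intros[OF k(1)] subfield_closed[OF k(1)])
  moreover have "coeff (monom 1 n - [:u:]) n = 1"
    using n0 by (cases n) (auto simp: coeff_pCons)
  then have "degree (monom 1 n - [:u:]) > 0"
    using n0 le_degree[of "monom 1 n - [:u:]" n] by simp
  ultimately obtain w where "w \<in> k" "poly (monom 1 n - [:u:]) w = 0"
    using k(2) separable_poly_root[OF n False] unfolding separably_closed_def by blast
  then show thesis using that by (simp add: poly_monom)
qed

text \<open>X^n - 1 splits over \<open>k\<close>; homogenizing with X = u/v gives the product, and v
  = 0 is treated by itself.\<close>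

lemma separably_closed_power_diff:
  fixes k :: "'a::field set"
  assumes k: "is_subfield k" "separably_closed k" and n: "of_nat n \<noteq> (0::'a)"
  obtains xs where "set xs \<subseteq> k" "length xs = n" "\<And>x. x \<in> set xs \<Longrightarrow> x ^ n = 1"
    "\<And>u v. u ^ n - v ^ n = (\<Prod>x\<leftarrow>xs. u - x * v)"
proof -
  let ?p = "monom 1 n - [:1:] :: 'a poly"
  have n0: "n > 0" using n by (cases n) auto
  have p: "poly_over k ?p"
    by (intro poly_over_intros[OF k(1)] subfield_closed[OF k(1)])
  obtain xs where xs: "set xs \<subseteq> k" "?p = smult (lead_coeff ?p) (\<Prod>x\<leftarrow>xs. [:- x, 1:])"
    using separably_closed_splits[OF k p separable_poly_root[OF n]] by auto
  have deg: "degree ?p = n"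
  proof (rule antisym)
    show "degree ?p \<le> n" by (rule degree_le) (use n0 in \<open>auto simp: coeff_pCons split: nat.splits\<close>)
    show "n \<le> degree ?p" by (rule le_degree) (use n0 in \<open>auto simp: coeff_pCons split: nat.splits\<close>)
  qed
  have lc: "lead_coeff ?p = 1"
    unfolding deg using n0 by (auto simp: coeff_pCons split: nat.splits)
  have eq: "?p = (\<Prod>x\<leftarrow>xs. [:- x, 1:])"
    using xs(2) unfolding lc by simp
  have dl: "degree (\<Prod>x\<leftarrow>xs. [:- x, 1:]) = length xs" for xs :: "'a list"
  proof (induction xs)
    case (Cons x xs)
    have "(\<Prod>x\<leftarrow>xs. [:- x, 1:]) \<noteq> 0" by (auto simp: prod_list_zero_iff)
    then show ?case using Cons by (simp add: degree_mult_eq del: mult_pCons_left)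
  qed simp
  have len: "length xs = n"
    using deg unfolding eq dl by simp
  have ev: "poly (\<Prod>x\<leftarrow>xs. [:- x, 1:]) w = (\<Prod>x\<leftarrow>xs. w - x)" for w and xs :: "'a list"
    by (induction xs) (auto simp: algebra_simps)
  have ev': "w ^ n - 1 = (\<Prod>x\<leftarrow>xs. w - x)" for w
    using ev[of xs w] unfolding eq[symmetric] by (simp add: poly_monom)
  have "u ^ n - v ^ n = (\<Prod>x\<leftarrow>xs. u - x * v)" for u v
  proof (cases "v = 0")
    case True
    have "(\<Prod>x\<leftarrow>xs. u - x * v) = u ^ length xs"
      unfolding True by (induction xs) auto
    then show ?thesis using True n0 len by simp
  next
    case False
    have "(\<Prod>x\<leftarrow>xs. u - x * v) = v ^ length xs * (\<Prod>x\<leftarrow>xs. u / v - x)"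
      using False by (induction xs) (auto simp: field_simps)
    also have "\<dots> = v ^ n * ((u / v) ^ n - 1)"
      unfolding len ev' ..
    also have "\<dots> = u ^ n - v ^ n"
      using False by (simp add: power_divide right_diff_distrib)
    finally show ?thesis ..
  qed
  moreover have "x ^ n = 1" if "x \<in> set xs" for x
  proof -
    have "(\<Prod>y\<leftarrow>xs. x - y) = 0"
      using that by (auto simp: prod_list_zero_iff)
    then show ?thesis using ev'[of x] by simp
  qed
  ultimately show thesis using that xs(1) len by blast
qed

definition primitive_root :: "nat \<Rightarrow> 'a::field \<Rightarrow> bool" where
  "primitive_root n z \<longleftrightarrow> (\<forall>j. z ^ j = 1 \<longleftrightarrow> n dvd j)"

lemma primitive_rootD: "primitive_root n z \<Longrightarrow> z ^ n = 1"
  by (simp add: primitive_root_def)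

lemma primitive_root_coprime_mult:
  assumes "primitive_root u x" "primitive_root v y" "coprime u v"
  shows "primitive_root (u * v) (x * y)"
  unfolding primitive_root_def
proof (intro allI iffI)
  fix j assume j: "(x * y) ^ j = 1"
  have "(x ^ (j * v)) * (y ^ v) ^ j = 1"
    using arg_cong[OF j, of "\<lambda>z. z ^ v"] by (simp add: power_mult_distrib mult.commute flip: power_mult)
  then have "u dvd j * v"
    using assms(1) primitive_rootD[OF assms(2)] by (simp add: primitive_root_def)
  moreover have "(y ^ (j * u)) * (x ^ u) ^ j = 1"
    using arg_cong[OF j, of "\<lambda>z. z ^ u"] by (simp add: power_mult_distrib mult.commute flip: power_mult)
  then have "v dvd j * u"
    using assms(2) primitive_rootD[OF assms(1)] by (simp add: primitive_root_def)
  ultimately show "u * v dvd j"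
    using assms(3) by (metis coprime_commute coprime_dvd_mult_left_iff divides_mult)
next
  fix j assume "u * v dvd j"
  then have "u dvd j" "v dvd j"
    using dvd_mult_left dvd_mult_right by blast+
  then show "(x * y) ^ j = 1"
    using assms(1,2) unfolding primitive_root_def by (metis power_mult_distrib mult_1)
qed

text \<open>By Bezout a relation z^j = 1 also holds with j replaced by gcd(j, p^v), a power p^i. The
  second hypothesis on \<open>z\<close> excludes i < v.\<close>

lemma primitive_root_prime_power:
  assumes p: "prime p" and v: "v > 0" and z: "z ^ (p ^ v) = 1" "z ^ (p ^ (v - 1)) \<noteq> 1"
  shows "primitive_root (p ^ v) z"
  unfolding primitive_root_def
proof (intro allI iffI)
  fix j assume j: "z ^ j = 1"
  have "z ^ gcd j (p ^ v) = 1"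
  proof (cases "j = 0")
    case False
    obtain a b where "a * j = b * p ^ v + gcd j (p ^ v)"
      using bezout_nat[OF False] by (metis mult.commute)
    then have "z ^ (b * p ^ v + gcd j (p ^ v)) = 1"
      using j by (metis mult.commute power_mult power_one)
    then show ?thesis
      using z(1) by (simp add: power_add mult.commute[of b] power_mult)
  qed (use z in simp)
  moreover obtain i where i: "i \<le> v" "gcd j (p ^ v) = p ^ i"
    using divides_primepow_nat[OF p, of "gcd j (p ^ v)" v] by auto
  ultimately have "\<not> i \<le> v - 1"
    using z(2) by (metis le_imp_power_dvd dvdE power_mult power_one)
  then have "i = v" using i by simp
  then show "p ^ v dvd j"
    using i by (metis gcd_dvd1)
next
  fix j assume "p ^ v dvd j"
  then show "z ^ j = 1"
    using z(1) by (metis dvdE power_mult power_one)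
qed

text \<open>Coprime multiplication reduces to prime powers. For n = p^v the root is taken from (X^n
  - 1)/(X^(n/p) - 1); separability of X^n - 1 keeps it from being an (n/p)-th root of unity.\<close>

lemma primitive_root_exists:
  fixes k :: "'a::field set"
  assumes k: "is_subfield k" "separably_closed k" and n: "of_nat n \<noteq> (0::'a)"
  obtains z where "z \<in> k" "primitive_root n z"
proof -
  have "\<exists>z\<in>k. primitive_root n z"
    using n
  proof (induction n rule: less_induct)
    case (less n)
    have n0: "n > 0" using less.prems by (cases n) auto
    show ?case
    proof (cases "n = 1")
      case True
      then show ?thesis
        using subfield_1[OF k(1)] by (intro bexI[of _ 1]) (auto simp: primitive_root_def)
    next
      case False
      then obtain p where p: "prime p" "p dvd n"
        using prime_factor_nat by blast
      define v where "v = multiplicity p n"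
      obtain m where m: "n = p ^ v * m" "\<not> p dvd m"
        using multiplicity_decompose'[of n p] n0 p unfolding v_def
        by (metis not_prime_unit gr_implies_not0)
      have v: "v > 0"
        using p n0 unfolding v_def by (simp add: prime_multiplicity_gt_zero_iff)
      have nz: "of_nat (p ^ v) \<noteq> (0::'a)" "of_nat m \<noteq> (0::'a)"
        using less.prems unfolding m by auto
      show ?thesis
      proof (cases "m = 1")
        case False
        have "m > 0" using n0 m by (cases m) auto
        then have "p ^ v < n" "m < n"
          using False m one_less_power[OF prime_gt_1_nat[OF p(1)] v] prime_gt_0_nat[OF p(1)] by auto
        then obtain x y where "x \<in> k" "primitive_root (p ^ v) x" "y \<in> k" "primitive_root m y"
          using less.IH nz by blast
        moreover have "coprime (p ^ v) m"
          using p m(2) by (simp add: prime_imp_coprime)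
        ultimately show ?thesis
          using primitive_root_coprime_mult m(1) subfield_mult[OF k(1)] by metis
      next
        case True
        define q where "q = p ^ (v - 1)"
        have nq: "n = q * p"
          using m True v unfolding q_def by (cases v) auto
        have q0: "q > 0" using p prime_gt_0_nat unfolding q_def by simp
        let ?s = "\<Sum>i<p. monom 1 (q * i) :: 'a poly"
        have fac: "monom 1 n - [:1:] = (monom 1 q - [:1:]) * ?s"
          using power_diff_1_eq[of "monom 1 q :: 'a poly" p] p prime_gt_0_nat[OF p(1)]
          by (simp add: nq monom_power one_pCons mult.commute)
        have ps: "poly_over k ?s"
          by (intro poly_over_intros[OF k(1)] subfield_closed[OF k(1)])
        have sep: "separable_poly ((monom 1 q - [:1:]) * ?s)"
          unfolding fac[symmetric] by (rule separable_poly_root[OF less.prems]) simp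
        have "coeff ?s q = (\<Sum>i<p. if i = 1 then 1 else 0)"
          unfolding coeff_sum by (rule sum.cong) (use q0 in auto)
        also have "\<dots> = 1"
          using prime_gt_1_nat[OF p(1)] by (subst sum.delta) auto
        finally have "degree ?s > 0"
          using q0 le_degree[of ?s q] by simp
        then obtain z where z: "z \<in> k" "poly ?s z = 0"
          using k(2) ps separable_poly_factor(2)[OF sep] unfolding separably_closed_def by blast
        have "z ^ q \<noteq> 1"
          using separable_poly_square[OF sep _ z(2)] by (auto simp: poly_monom)
        moreover have "z ^ n = 1"
          using arg_cong[OF fac, of "\<lambda>f. poly f z"] z by (simp add: poly_monom)
        ultimately have "primitive_root (p ^ v) z"
          using primitive_root_prime_power[OF p(1) v] m True unfolding q_def by simp
        then show ?thesis using z m True by auto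
      qed
    qed
  qed
  then show thesis using that by blast
qed

section \<open>Purely inseparable elements\<close>

text \<open>Powers of the characteristic exponent; the value 1 in characteristic zero lets both
  cases run together.\<close>

definition pexp :: "'a::field itself \<Rightarrow> nat \<Rightarrow> nat" where
  "pexp _ n = (if CHAR('a) = 0 then 1 else CHAR('a) ^ n)"

lemma coprime_pexp:
  assumes "of_nat m \<noteq> (0::'a::field)"
  shows "coprime (pexp TYPE('a) n) m"
proof (cases "CHAR('a) = 0")
  case False
  then have "prime CHAR('a)" using prime_CHAR_semidom by blast
  moreover have "\<not> CHAR('a) dvd m" using assms by (simp add: of_nat_eq_0_iff_char_dvd)
  ultimately show ?thesis using False by (simp add: pexp_def prime_imp_coprime)
qed (simp add: pexp_def)

lemma power_pexp_diff:
  fixes p q :: "'a::field alg_closure poly"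
  shows "(p - q) ^ pexp TYPE('a) n = p ^ pexp TYPE('a) n - q ^ pexp TYPE('a) n"
proof (cases "CHAR('a) = 0")
  case False
  then have "prime CHAR('a)" using prime_CHAR_semidom by blast
  then have "prime CHAR('a alg_closure poly)" by simp
  then have "((p - q) + q) ^ (CHAR('a) ^ n) = (p - q) ^ (CHAR('a) ^ n) + q ^ (CHAR('a) ^ n)"
    by (rule freshmans_dream') simp
  then show ?thesis using False by (simp add: pexp_def)
qed (simp add: pexp_def)

text \<open>Induction on the degree. If the derivative is nonzero, its gcd with \<open>p\<close> is
  either constant, which makes \<open>p\<close> separable with all its roots coming from
  \<open>k\<close>, or it splits \<open>p\<close> into two smaller factors. If the derivative
  vanishes, \<open>p\<close> is a polynomial in X^CHAR, and \<open>c ^ CHAR('a)\<close> is a root of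
  one of smaller degree.\<close>

lemma purely_inseparable:
  fixes k :: "'a::field set" and c :: "'a alg_closure"
  assumes k: "is_subfield k" "separably_closed k"
    and p: "poly_over k p" "p \<noteq> 0" "poly (map_poly to_ac p) c = 0"
  shows "\<exists>n. c ^ pexp TYPE('a) n \<in> to_ac ` k"
  using p
proof (induction "degree p" arbitrary: p c rule: less_induct)
  case less
  note hom = to_ac_hom_on[of k]
  have dp: "degree p > 0"
  proof (rule ccontr)
    assume "\<not> ?thesis"
    then obtain a where "p = [:a:]" by (metis degree_eq_zeroE not_gr_zero)
    then show False using less.prems by (simp add: map_poly_pCons)
  qed
  show ?case
  proof (cases "pderiv p = 0")
    case False
    obtain g u v where g: "poly_over k g" "poly_over k u" "poly_over k v" "g = u * p + v * pderiv p"
      "g \<noteq> 0" "g dvd p" "g dvd pderiv p"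
      using poly_over_bezout[OF k(1) less.prems(1) poly_over_pderiv[OF k(1) less.prems(1)] less.prems(2)] by blast
    show ?thesis
    proof (cases "degree g = 0")
      case True
      then have "is_unit g" using g(5) by (simp add: is_unit_iff_degree)
      have "separable_poly p"
        unfolding separable_poly_def
      proof (rule coprimeI)
        fix h assume "h dvd p" "h dvd pderiv p"
        then have "h dvd g" unfolding g(4) by simp
        then show "is_unit h" using \<open>is_unit g\<close> dvd_trans by blast
      qed
      then obtain x where "x \<in> k" "c = to_ac x"
        using separably_closed_root_image[OF k hom less.prems(1) _ less.prems(3)] by blast
      then show ?thesis by (intro exI[of _ 0]) (simp add: pexp_def)
    next
      case dg: False
      obtain s where s: "poly_over k s" "p = g * s"
        using poly_over_dvd[OF k(1) g(1,5) less.prems(1) g(6)] by blast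
      have s0: "s \<noteq> 0" using s less.prems by auto
      have "degree g \<le> degree (pderiv p)"
        using g(7) False by (rule dvd_imp_degree_le)
      then have g1: "degree g < degree p"
        using dp degree_le[of "degree p - 1" "pderiv p"] by (auto simp: coeff_pderiv coeff_eq_0)
      have s1: "degree s < degree p"
        using dg g(5) s0 unfolding s(2) by (simp add: degree_mult_eq)
      have "poly (map_poly to_ac g) c * poly (map_poly to_ac s) c = 0"
        using less.prems(3) unfolding s(2) map_poly_hom_mult[OF k(1) hom g(1) s(1)] by simp
      then show ?thesis
        using less.hyps[OF g1 g(1,5)] less.hyps[OF s1 s(1) s0] by auto
    qed
  next
    case True
    let ?q = "CHAR('a)"
    have z: "of_nat i * coeff p i = 0" if "i > 0" for i
      using arg_cong[OF True, of "\<lambda>f. coeff f (i - 1)"] that by (simp add: coeff_pderiv)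
    have q0: "?q \<noteq> 0"
    proof
      assume "?q = 0"
      then have "of_nat (degree p) \<noteq> (0::'a)" using dp by (simp add: CHAR_eq0_iff)
      then show False using z[OF dp] less.prems(2) by simp
    qed
    then have prime: "prime ?q" using prime_CHAR_semidom by blast
    have z': "coeff p i = 0" if "\<not> ?q dvd i" for i
      using z[of i] that by (cases "i = 0") (auto simp: of_nat_eq_0_iff_char_dvd)
    \<comment> \<open>The polynomial with p(X) = h(X^CHAR).\<close>
    define h where "h = Poly (map (\<lambda>j. coeff p (?q * j)) [0..<Suc (degree p)])"
    have ch: "coeff h j = coeff p (?q * j)" for j
    proof (cases "j \<le> degree p")
      case True
      then show ?thesis unfolding h_def by (simp add: nth_default_def del: upt_Suc)
    next
      case False
      then have "degree p < ?q * j"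
        using q0 by (metis less_le_trans linorder_not_le mult_le_mono1 nat_mult_1 less_one)
      then show ?thesis using False unfolding h_def by (simp add: nth_default_def coeff_eq_0 del: upt_Suc)
    qed
    have "poly (map_poly to_ac p) c = (\<Sum>i\<le>?q * degree p. to_ac (coeff p i) * c ^ i)"
      using q0 unfolding poly_altdef
      by (intro sum.mono_neutral_cong_left)
         (auto simp: degree_map_poly_hom[OF is_subfield_iff[THEN iffD2] to_ac_hom_on, of UNIV] coeff_map_poly poly_over_def coeff_eq_0)
    also have "\<dots> = (\<Sum>i\<in>(\<lambda>j. ?q * j) ` {..degree p}. to_ac (coeff p i) * c ^ i)"
    proof (rule sum.mono_neutral_right)
      show "\<forall>i\<in>{..?q * degree p} - (\<lambda>j. ?q * j) ` {..degree p}. to_ac (coeff p i) * c ^ i = 0"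
      proof
        fix i assume i: "i \<in> {..?q * degree p} - (\<lambda>j. ?q * j) ` {..degree p}"
        have "\<not> ?q dvd i"
        proof
          assume "?q dvd i"
          then obtain j where "i = ?q * j" by auto
          then show False using i q0 by auto
        qed
        then show "to_ac (coeff p i) * c ^ i = 0" using z' by simp
      qed
    qed (use q0 in auto)
    also have "\<dots> = (\<Sum>j\<le>degree p. to_ac (coeff h j) * (c ^ ?q) ^ j)"
      using q0 by (subst sum.reindex) (auto simp: inj_on_def ch power_mult)
    also have "\<dots> = poly (map_poly to_ac h) (c ^ ?q)"
      unfolding poly_altdef
    proof (rule sum.mono_neutral_cong_right)
      have "degree h \<le> degree p"
        by (rule degree_le) (use q0 in \<open>auto simp: ch intro!: coeff_eq_0 intro: less_le_trans\<close>)
      moreover have dh: "degree (map_poly to_ac h) = degree h"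
        by (rule degree_map_poly) simp
      ultimately show "{..degree (map_poly to_ac h)} \<subseteq> {..degree p}"
        by auto
      show "\<forall>i\<in>{..degree p} - {..degree (map_poly to_ac h)}. to_ac (coeff h i) * (c ^ ?q) ^ i = 0"
        unfolding dh by (auto simp: coeff_eq_0)
    qed (auto simp: coeff_map_poly)
    finally have h3: "poly (map_poly to_ac h) (c ^ ?q) = 0"
      using less.prems(3) by simp
    have h1: "poly_over k h"
      using less.prems(1) by (auto simp: poly_over_def ch)
    obtain m where m: "degree p = ?q * m"
      using z'[of "degree p"] less.prems(2) by (auto elim: dvdE)
    have "coeff h m \<noteq> 0"
      using m less.prems(2) by (simp add: ch flip: m)
    then have h2: "h \<noteq> 0" by auto
    have "degree h \<le> m"
    proof (rule degree_le, intro allI impI)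
      fix i assume "m < i"
      then have "degree p < ?q * i" using m q0 by simp
      then show "coeff h i = 0" by (simp add: ch coeff_eq_0)
    qed
    also have "m < degree p"
      using m dp prime_gt_1_nat[OF prime] by (cases "m = 0") auto
    finally have "degree h < degree p" .
    from less.hyps[OF this h1 h2 h3] obtain n where "(c ^ ?q) ^ pexp TYPE('a) n \<in> to_ac ` k"
      by blast
    then have "c ^ pexp TYPE('a) (Suc n) \<in> to_ac ` k"
      using q0 by (simp add: pexp_def flip: power_mult)
    then show ?thesis ..
  qed
qed

section \<open>Roots of formal power series\<close>

text \<open>First-order Taylor expansion. It isolates the derivative of the n-th power, whose
  invertibility is behind both the lifting of roots and the transport of vanishing orders along the
  tree.\<close>

lemma power_add_quadratic:
  fixes u v :: "'a::comm_ring_1"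
  shows "\<exists>r. (u + v) ^ n = u ^ n + of_nat n * u ^ (n - 1) * v + v ^ 2 * r"
proof (induction n)
  case (Suc n)
  then obtain r where r: "(u + v) ^ n = u ^ n + of_nat n * u ^ (n - 1) * v + v ^ 2 * r"
    by blast
  have "of_nat n * u ^ n = of_nat n * u ^ (n - 1) * u"
    by (cases n) (simp_all add: mult_ac)
  then have "(u + v) ^ Suc n = u ^ Suc n + of_nat (Suc n) * u ^ (Suc n - 1) * v
      + v ^ 2 * (of_nat n * u ^ (n - 1) + u * r + v * r)"
    by (simp add: r power2_eq_square algebra_simps)
  then show ?case by blast
qed (auto intro: exI[of _ 0])

lemma fps_power_nth_cong:
  fixes g h :: "'a::comm_ring_1 fps"
  assumes "\<And>i. i \<le> n \<Longrightarrow> g $ i = h $ i"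
  shows "i \<le> n \<Longrightarrow> (g ^ m) $ i = (h ^ m) $ i"
proof (induction m arbitrary: i)
  case (Suc m)
  have "(g ^ Suc m) $ i = (\<Sum>j=0..i. g $ j * (g ^ m) $ (i - j))"
    by (simp add: fps_mult_nth)
  also have "\<dots> = (\<Sum>j=0..i. h $ j * (h ^ m) $ (i - j))"
    by (rule sum.cong) (use Suc assms in auto)
  finally show ?case by (simp add: fps_mult_nth)
qed simp

text \<open>Hensel lifting, one coefficient at a time: the derivative n w0^(n-1) is invertible, so
  the next coefficient solves a linear equation.\<close>

lemma fps_unit_nth_root:
  fixes P :: "'a::alg_closed_field fps"
  assumes n: "of_nat n \<noteq> (0::'a)" and P: "P $ 0 \<noteq> 0"
  obtains w where "w ^ n = P"
proof -
  have n0: "n > 0" using n by (cases n) auto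
  obtain w0 where w0: "w0 ^ n = P $ 0" using nth_root_exists[OF n0] by blast
  have w00: "w0 \<noteq> 0" using w0 P n0 by (metis zero_power)
  define Q where "Q i w \<longleftrightarrow> w $ 0 = w0 \<and> (\<forall>j\<le>i. (w ^ n) $ j = P $ j)" for i and w :: "'a fps"
  have Q0: "Q 0 (fps_const w0)"
    unfolding Q_def by (simp add: fps_const_power w0)
  have step: "\<exists>w'. Q (Suc i) w' \<and> (\<forall>j\<le>i. w' $ j = w $ j)" if "Q i w" for i w
  proof -
    \<comment> \<open>Chosen so that the linear term cancels the error in degree
      \<open>Suc i\<close>; the quadratic term starts only in degree
      \<open>2 * Suc i\<close>.\<close>
    define c where "c = (P $ Suc i - (w ^ n) $ Suc i) / (of_nat n * w0 ^ (n - 1))"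
    define v where "v = fps_X ^ Suc i * fps_const c"
    obtain r where r: "(w + v) ^ n = w ^ n + of_nat n * w ^ (n - 1) * v + v ^ 2 * r"
      using power_add_quadratic by blast
    have "v ^ 2 = fps_X ^ (2 * Suc i) * fps_const c ^ 2"
      by (simp only: v_def power_mult_distrib power_mult[symmetric] mult.commute[of _ 2])
    then have "v ^ 2 * r = fps_X ^ (2 * Suc i) * (fps_const c ^ 2 * r)"
      by (simp only: mult.assoc)
    then have v2: "(v ^ 2 * r) $ j = 0" if "j \<le> Suc i" for j
      using that by (simp only: fps_X_power_mult_nth) auto
    have v1': "of_nat n * w ^ (n - 1) * v = fps_X ^ Suc i * (fps_const c * (of_nat n * w ^ (n - 1)))"
      by (simp add: v_def mult_ac)
    have wn0: "(w ^ (n - 1)) $ 0 = w0 ^ (n - 1)"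
      using that by (simp add: Q_def fps_nth_power_0)
    have v1: "(of_nat n * w ^ (n - 1) * v) $ j = (if j = Suc i then P $ Suc i - (w ^ n) $ Suc i else 0)"
      if "j \<le> Suc i" for j
      unfolding v1' fps_X_power_mult_nth using that n w00 wn0
      by (auto simp: c_def fps_of_nat[symmetric] simp del: fps_of_nat)
    have "v $ j = 0" if "j \<le> i" for j
      using that by (simp add: v_def fps_X_power_mult_nth del: power_Suc)
    then have "(w + v) $ j = w $ j" if "j \<le> i" for j
      using that by simp
    moreover have "Q (Suc i) (w + v)"
      unfolding Q_def
    proof (intro conjI allI impI)
      show "(w + v) $ 0 = w0" using calculation[of 0] \<open>Q i w\<close> by (simp add: Q_def)
      show "((w + v) ^ n) $ j = P $ j" if "j \<le> Suc i" for j
        using that v1[OF that] v2[OF that] \<open>Q i w\<close> unfolding r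
        by (cases "j = Suc i") (auto simp: Q_def)
    qed
    ultimately show ?thesis by blast
  qed
  obtain W where W: "\<And>i. Q i (W i)" "\<And>i. \<forall>j\<le>i. W (Suc i) $ j = W i $ j"
    using dependent_nat_choice[of Q "\<lambda>i w w'. \<forall>j\<le>i. w' $ j = w $ j"] Q0 step by blast
  have mono: "W (i + m) $ j = W i $ j" if "j \<le> i" for i j m
    by (induction m) (use W(2) that in auto)
  \<comment> \<open>The stages agree up to their own index, so the diagonal agrees with
    \<open>W i\<close> through degree i.\<close>
  define w where "w = Abs_fps (\<lambda>i. W i $ i)"
  have "w $ j = W i $ j" if "j \<le> i" for i j
    using mono[of j j "i - j"] that by (simp add: w_def)
  then have "(w ^ n) $ i = (W i ^ n) $ i" for i
    by (intro fps_power_nth_cong[of i]) auto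
  then have "w ^ n = P"
    using W(1) by (auto simp: fps_eq_iff Q_def)
  then show thesis by (rule that)
qed

lemma fps_nth_root:
  fixes P :: "'a::alg_closed_field fps"
  assumes n: "of_nat n \<noteq> (0::'a)" and P: "P \<noteq> 0" "n dvd subdegree P"
  obtains w where "w ^ n = P"
proof -
  obtain m where m: "subdegree P = n * m" using P(2) by auto
  have "fps_shift (subdegree P) P $ 0 \<noteq> 0" using P(1) by simp
  then obtain w where w: "w ^ n = fps_shift (subdegree P) P"
    using fps_unit_nth_root[OF n] by blast
  have "(w * fps_X ^ m) ^ n = fps_shift (subdegree P) P * fps_X ^ subdegree P"
    by (simp add: power_mult_distrib w m mult.commute flip: power_mult)
  also have "\<dots> = P" by (rule subdegree_decompose[symmetric])
  finally show thesis by (rule that)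
qed

text \<open>Substituting c + s^e turns X - c into s^e, while the cofactor prime to X - c keeps a
  nonzero constant term.\<close>

lemma subdegree_fps_of_poly_shift:
  fixes P :: "'a::field poly"
  assumes "P \<noteq> 0" "e > 0"
  shows "subdegree (fps_of_poly (pcompose P (monom 1 e + [:c:]))) = e * order c P"
proof -
  let ?m = "monom 1 e + [:c:]"
  obtain q where q: "P = [:- c, 1:] ^ order c P * q" "\<not> [:- c, 1:] dvd q"
    using order_decomp[OF assms(1)] by blast
  have "pcompose [:- c, 1:] ?m = monom 1 e"
    by (simp add: pcompose_pCons one_pCons)
  moreover have "pcompose (u ^ n) ?m = pcompose u ?m ^ n" for u n
    by (induction n) (simp_all add: pcompose_mult pcompose_1)
  ultimately have *: "pcompose P ?m = monom 1 e ^ order c P * pcompose q ?m"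
    by (subst q(1)) (simp add: pcompose_mult)
  have nz: "fps_of_poly (pcompose q ?m) $ 0 \<noteq> 0"
    using q(2) assms(2) by (simp add: poly_0_coeff_0[symmetric] poly_pcompose poly_monom zero_power flip: poly_eq_0_iff_dvd)
  have "subdegree (fps_of_poly (pcompose q ?m)) = 0" "fps_of_poly (pcompose q ?m) \<noteq> 0"
    by (rule subdegree_eq_0[OF nz], metis nz fps_zero_nth)
  with * show ?thesis
    by (simp add: fps_of_poly_mult fps_of_poly_power fps_of_poly_monom' fps_X_power_subdegree
        subdegree_mult subdegree_power)
qed

section \<open>Embedding into Laurent series\<close>

text \<open>The algebraic closure around the Laurent series is the target into which homomorphisms
  of \<open>L\<close> are extended; genuine Laurent series are then recognized by
  \<open>range to_ac\<close>.\<close>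

definition lau :: "'a::field alg_closure fps \<Rightarrow> 'a alg_closure fls alg_closure" where
  "lau P = to_ac (fps_to_fls P)"

lemma lau_simps [simp]:
  "lau 0 = 0" "lau 1 = 1" "lau (P + Q) = lau P + lau Q" "lau (P - Q) = lau P - lau Q"
  "lau (P * Q) = lau P * lau Q" "lau (P ^ n) = lau P ^ n" "lau P = lau Q \<longleftrightarrow> P = Q"
  by (simp_all add: lau_def fls_times_fps_to_fls fps_to_fls_power)

lemma lau_eq_0_iff [simp]: "lau P = 0 \<longleftrightarrow> P = 0"
  by (simp add: lau_def)

definition lau_const :: "'a::field \<Rightarrow> 'a alg_closure fls alg_closure" where
  "lau_const x = lau (fps_const (to_ac x))"

lemma lau_const_hom_on: "hom_on A lau_const"
  by (simp add: hom_on_def lau_const_def flip: fps_const_add fps_const_mult)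

lemma lau_const_0 [simp]: "lau_const 0 = 0"
  by (simp add: lau_const_def)

lemma poly_lau_const:
  "poly (map_poly lau_const q) (lau (fps_const c + fps_X ^ e)) =
     lau (fps_of_poly (pcompose (map_poly to_ac q) (monom 1 e + [:c:])))"
proof (induction q)
  case (pCons u q)
  then show ?case
    by (simp add: map_poly_pCons pcompose_pCons fps_of_poly_add fps_of_poly_mult fps_of_poly_monom'
        fps_of_poly_const lau_const_def add.commute del: lau_simps(7))
qed simp

text \<open>One root is a power series because \<open>n\<close> divides the order of vanishing.
  Every other root differs from it by an n-th root of unity, and these are constants; so no
  fractional power of the parameter appears.\<close>

lemma lau_root:
  fixes x :: "'a::field alg_closure fls alg_closure"
  assumes n: "of_nat n \<noteq> (0::'a)" and P: "P \<noteq> 0" "n dvd subdegree P" and x: "x ^ n = lau P"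
  obtains B where "x = lau B" "B ^ n = P"
proof -
  have n': "of_nat n \<noteq> (0 :: 'a alg_closure)"
    using n by (simp add: of_nat_eq_0_iff_char_dvd)
  obtain w where w: "w ^ n = P"
    using fps_nth_root[OF n' P] by blast
  let ?\<psi> = "\<lambda>x. lau (fps_const x)"
  have U: "is_subfield (UNIV :: 'a alg_closure set)"
    by (simp add: is_subfield_iff)
  have sc: "separably_closed (UNIV :: 'a alg_closure set)"
    by (auto simp: separably_closed_def alg_closed_imp_poly_has_root)
  have hom: "hom_on UNIV ?\<psi>"
    by (simp add: hom_on_def flip: fps_const_add fps_const_mult)
  have "n > 0" using n by (cases n) auto
  then have w0: "lau w \<noteq> 0" using w P by (auto simp: power_0_left)
  have "poly (map_poly ?\<psi> (monom 1 n - [:1:])) (x / lau w) = 0"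
    using x w0 by (simp add: map_poly_hom_diff[OF U hom] poly_over_def map_poly_monom map_poly_pCons poly_monom
        power_divide flip: w)
  then obtain z where z: "poly (monom 1 n - [:1:]) z = 0" "x / lau w = ?\<psi> z"
    using separably_closed_root_image[OF U sc hom _ separable_poly_root[OF n', of 1]]
    by (auto simp: poly_over_def)
  show thesis
  proof (rule that)
    show "x = lau (fps_const z * w)"
      using z(2) w0 by (simp add: field_simps)
    show "(fps_const z * w) ^ n = P"
      using z(1) by (simp add: power_mult_distrib w fps_const_power poly_monom)
  qed
qed

section \<open>Unicritical maps over a separably closed field\<close>

text \<open>The application takes for \<open>k\<close> the constants of a separable closure
  \<open>L\<close> of K(t). Over a separably closed \<open>k\<close>, the roots of unity of order
  prime to the characteristic are constants and fixed by every automorphism.\<close>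

locale unicritical =
  fixes k L :: "'l::field set" and t a b :: 'l and d :: nat
  assumes k: "is_subfield k" "separably_closed k"
    and L: "is_subfield L" "separably_closed L"
    and FL: "adjoin k t \<subseteq> L"
    and sep: "\<And>x. x \<in> L \<Longrightarrow> separable_over (adjoin k t) x"
    and trans: "transcendental_over k t"
    and a: "a \<in> k" "a \<noteq> 0" and b: "b \<in> k"
    and d: "d \<ge> 2" "of_nat d \<noteq> (0::'l)"
begin

definition f where "f x = a * x ^ d + b"

abbreviation "F \<equiv> adjoin k t"
abbreviation "S \<equiv> strict_forward_orbit f 0"
abbreviation "T \<equiv> tree_vertices L t f"

definition M where "M = generate_field ring_of_type_algebra (F \<union> T)"

lemma F: "is_subfield F" "k \<subseteq> F" "t \<in> F" "k \<subseteq> L" "t \<in> L"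
  using is_subfield_generate_field generate_field_superset[of "insert t k"] FL by auto

lemma d0: "d > 0"
  using d by simp

lemma of_nat_d_power: "of_nat (d ^ n) \<noteq> (0::'l)"
  using d by simp

lemma f_L: "x \<in> L \<Longrightarrow> f x \<in> L"
  unfolding f_def using a b F by (intro subfield_closed[OF L(1)]) auto

lemma f_k: "x \<in> k \<Longrightarrow> f x \<in> k"
  unfolding f_def using a b by (intro subfield_closed[OF k(1)]) auto

lemma T_L: "T \<subseteq> L"
  by (auto simp: tree_vertices_def tree_level_def)

lemma t_T: "t \<in> T"
  using F by (auto simp: tree_vertices_def tree_level_def intro: exI[of _ 0])

lemma M: "is_subfield M" "F \<subseteq> M" "T \<subseteq> M" "M \<subseteq> L"
  unfolding M_def
  using is_subfield_generate_field generate_field_superset[of "F \<union> T"]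
    generate_field_least[OF L(1), of "F \<union> T"] FL T_L by auto

lemma S_k: "S \<subseteq> k"
proof -
  have "(f ^^ i) 0 \<in> k" for i
    by (induction i) (auto intro: f_k subfield_0[OF k(1)])
  then show ?thesis by (auto simp: strict_forward_orbit_def)
qed

lemma f_0: "f 0 = b"
  using d by (simp add: f_def)

lemma b_S: "b \<in> S"
  unfolding strict_forward_orbit_def using f_0 by (auto intro!: exI[of _ 1])

lemma f_S: "x \<in> S \<Longrightarrow> f x \<in> S"
  unfolding strict_forward_orbit_def by (auto intro: exI[of _ "Suc _"])

lemma S_induct [consumes 1, case_names base step]:
  assumes "x \<in> S" "P b" "\<And>y. y \<in> S \<Longrightarrow> P y \<Longrightarrow> P (f y)"
  shows "P x"
proof -
  have "(f ^^ Suc i) 0 \<in> S \<and> P ((f ^^ Suc i) 0)" for i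
    by (induction i) (use assms f_0 b_S f_S in auto)
  then show ?thesis
    using assms(1) unfolding strict_forward_orbit_def by (auto simp: Suc_le_eq gr0_conv_Suc)
qed

lemma periodic_iff: "periodic_point f 0 \<longleftrightarrow> 0 \<in> S"
  by (auto simp: periodic_point_def strict_forward_orbit_def)

lemma trans_poly: "poly_over k p \<Longrightarrow> poly p t = 0 \<longleftrightarrow> p = 0"
  using trans by (auto simp: transcendental_over_def)

text \<open>Both \<open>t\<close> and c + s^e with e > 0 are transcendental over the constants, so
  one can be sent to the other. The point \<open>c\<close> ranges over the algebraic closure to
  include inseparable zeros; e = 1 makes t - c the parameter, e = d makes it a d-th power.\<close>

lemma place:
  assumes "e > 0"
  obtains \<psi> where "hom_on L \<psi>" "\<And>x. x \<in> k \<Longrightarrow> \<psi> x = lau_const x"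
    "\<psi> t = lau (fps_const c + fps_X ^ e)"
proof -
  have "poly q t = 0 \<longleftrightarrow> poly (map_poly lau_const q) (lau (fps_const c + fps_X ^ e)) = 0"
    if "poly_over k q" for q
  proof -
    have "degree (monom 1 e + [:c:]) > 0"
      using assms le_degree[of "monom 1 e + [:c:]" e] by (cases e) (auto simp: coeff_pCons)
    then have "pcompose (map_poly to_ac q) (monom 1 e + [:c:]) = 0 \<longleftrightarrow> q = 0"
      using map_poly_hom_eq_0_iff[OF k(1) to_ac_hom_on that] by (simp add: pcompose_eq_0_iff)
    then show ?thesis
      unfolding poly_lau_const using trans_poly[OF that] fps_of_poly_eq_iff[of _ 0] by simp
  qed
  then obtain \<phi> where \<phi>: "hom_on F \<phi>" "\<And>z. z \<in> k \<Longrightarrow> \<phi> z = lau_const z"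
    "\<phi> t = lau (fps_const c + fps_X ^ e)"
    using hom_on_extend_simple[OF k(1) lau_const_hom_on] by metis
  obtain \<psi> where "hom_on L \<psi>" "\<And>x. x \<in> F \<Longrightarrow> \<psi> x = \<phi> x"
    using hom_on_extend[OF F(1) L(1) FL _ \<phi>(1)] separable_over_imp_algebraic[OF sep] by metis
  then show thesis
    using that \<phi> F by (metis subsetD)
qed

lemma place_poly:
  assumes "hom_on L \<psi>" "\<And>x. x \<in> k \<Longrightarrow> \<psi> x = lau_const x"
    "\<psi> t = lau (fps_const c + fps_X ^ e)" "poly_over k p"
  shows "\<psi> (poly p t) = lau (fps_of_poly (pcompose (map_poly to_ac p) (monom 1 e + [:c:])))"
proof -
  have "poly_over L p"
    using assms(4) F(4) by (auto simp: poly_over_def)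
  then have "\<psi> (poly p t) = poly (map_poly \<psi> p) (\<psi> t)"
    using hom_on_poly[OF L(1) assms(1)] F(5) by blast
  also have "map_poly \<psi> p = map_poly lau_const p"
    using assms(2,4) by (intro poly_eqI) (simp add: coeff_map_poly hom_on_0[OF L(1) assms(1)] poly_over_def)
  finally show ?thesis
    using poly_lau_const assms(3) by metis
qed

text \<open>
  Climbing the tree from \<open>t = c + s\<^sup>e\<close>, each vertex is a power series \<open>B\<close> in \<open>s\<close>. Extracting the
  next \<open>d\<close>-th root is harmless as long as \<open>B - b\<close> is a unit. If not, the path from \<open>c\<close> meets the
  critical value, which uses up the factor \<open>e = d\<close>; without periodicity this happens only once.
\<close>

lemma place_tree:
  assumes \<psi>: "hom_on L \<psi>" "\<And>x. x \<in> k \<Longrightarrow> \<psi> x = lau_const x" "\<psi> t = lau (fps_const c + fps_X ^ e)"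
    and c: "c \<notin> to_ac ` S \<or> e = d \<and> 0 \<notin> S" and e: "e > 0" and x: "x \<in> T"
  shows "\<exists>B. \<psi> x = lau B"
proof -
  \<comment> \<open>The invariant of the climb. Off the orbit the constant term differs from
    \<open>b\<close>, so the next root is that of a unit; otherwise subtracting the constant term
    leaves order exactly \<open>d\<close>, so a root exists even when the constant term is
    \<open>b\<close>.\<close>
  define I where "I B \<longleftrightarrow> B $ 0 \<notin> to_ac ` S \<or> subdegree (B - fps_const (B $ 0)) = d \<and> 0 \<notin> S"
    for B :: "'l alg_closure fps"
  have "\<exists>B. \<psi> x = lau B \<and> I B" if "x \<in> L" "(f ^^ l) x = t" for x l
    using that
  proof (induction l arbitrary: x)
    case 0
    have "I (fps_const c + fps_X ^ e)"
      using c e by (auto simp: I_def fps_X_power_subdegree)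
    then show ?case using 0 \<psi>(3) by (metis funpow_0)
  next
    case (Suc l)
    have "f x \<in> L" "(f ^^ l) (f x) = t"
      using Suc.prems f_L by (simp_all add: funpow_swap1)
    then obtain G where G: "\<psi> (f x) = lau G" "I G"
      using Suc.IH by blast
    define P where "P = fps_const (inverse (to_ac a)) * (G - fps_const (to_ac b))"
    have a0: "to_ac a \<noteq> 0" using a by simp
    have sP: "subdegree P = subdegree (G - fps_const (to_ac b))"
      using a0 by (cases "G - fps_const (to_ac b) = 0") (auto simp: P_def subdegree_mult)
    have P0: "P $ 0 = inverse (to_ac a) * (G $ 0 - to_ac b)"
      by (simp add: P_def)
    have "P \<noteq> 0 \<and> d dvd subdegree P"
    proof (cases "G $ 0 = to_ac b")
      case True
      then have "subdegree P = d"
        using G(2) b_S sP by (auto simp: I_def)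
      then show ?thesis using d0 by auto
    next
      case False
      then have "P $ 0 \<noteq> 0" using P0 a0 by simp
      then show ?thesis by auto
    qed
    moreover have "\<psi> x ^ d = lau P"
    proof -
      have "\<psi> (f x) = lau_const a * \<psi> x ^ d + lau_const b"
        unfolding f_def using Suc.prems a b F \<psi>(2)
        by (simp add: hom_on_add[OF L(1) \<psi>(1)] hom_on_mult[OF L(1) \<psi>(1)] hom_on_power[OF L(1) \<psi>(1)]
            subfield_closed[OF L(1)] subset_iff)
      then have "lau_const a * \<psi> x ^ d = lau (G - fps_const (to_ac b))"
        using G(1) by (simp add: lau_const_def)
      then have "lau_const (inverse a) * (lau_const a * \<psi> x ^ d) = lau P"
        by (simp add: P_def lau_const_def)
      moreover have "lau_const (inverse a) * lau_const a = 1"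
        using a by (simp add: lau_const_def flip: lau_simps(5))
      ultimately show ?thesis by (simp add: mult.assoc[symmetric])
    qed
    ultimately obtain B where B: "\<psi> x = lau B" "B ^ d = P"
      using lau_root[OF d(2)] by metis
    define B0 where "B0 = B $ 0"
    have B0: "to_ac a * B0 ^ d + to_ac b = G $ 0"
      using P0 a0 unfolding B(2)[symmetric] B0_def by (simp add: fps_nth_power_0 field_simps)
    have fS: "G $ 0 \<in> to_ac ` S" if B0S: "B0 \<in> to_ac ` S"
    proof -
      obtain s where "s \<in> S" "B0 = to_ac s" using B0S by blast
      then have "G $ 0 = to_ac (f s)" "f s \<in> S"
        using B0 f_S by (simp_all add: f_def)
      then show ?thesis by blast
    qed
    \<comment> \<open>If the critical value has just been met, \<open>B0\<close> is 0 and off the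
      orbit. If \<open>B0\<close> lies in \<open>S\<close>, it is nonzero, the root there is
      unramified (\<open>Q\<close> is a unit), and the order \<open>d\<close> of the parent is
      handed down.\<close>
    have "I B"
    proof (cases "B0 \<in> to_ac ` S")
      case True
      then have G': "subdegree (G - fps_const (G $ 0)) = d" "0 \<notin> S"
        using G(2) fS by (auto simp: I_def)
      then have "B0 \<noteq> 0" using True by auto
      define E where "E = B - fps_const B0"
      have E0: "E $ 0 = 0" by (simp add: E_def B0_def)
      obtain r where r: "(fps_const B0 + E) ^ d =
          fps_const B0 ^ d + of_nat d * fps_const B0 ^ (d - 1) * E + E ^ 2 * r"
        using power_add_quadratic by blast
      define Q where "Q = of_nat d * fps_const B0 ^ (d - 1) + E * r"
      have "of_nat d \<noteq> (0 :: 'l alg_closure)"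
        using d(2) by (simp add: of_nat_eq_0_iff_char_dvd)
      then have Q0: "Q $ 0 \<noteq> 0"
        using \<open>B0 \<noteq> 0\<close> E0 by (simp add: Q_def fps_nth_power_0)
      have "P - fps_const (B0 ^ d) = E * Q"
        using r unfolding E_def[symmetric] B(2)[symmetric]
        by (simp add: Q_def E_def fps_const_power algebra_simps power2_eq_square)
      moreover have "P - fps_const (B0 ^ d) = fps_const (inverse (to_ac a)) * (G - fps_const (G $ 0))"
      proof -
        have "B0 ^ d = P $ 0"
          unfolding B(2)[symmetric] B0_def by (simp add: fps_nth_power_0)
        then show ?thesis
          unfolding P0 by (intro fps_ext) (simp add: P_def right_diff_distrib)
      qed
      ultimately have EQ: "E * Q = fps_const (inverse (to_ac a)) * (G - fps_const (G $ 0))"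
        by simp
      have "G - fps_const (G $ 0) \<noteq> 0" using G'(1) d0 by auto
      then have "subdegree (E * Q) = d" "E * Q \<noteq> 0"
        unfolding EQ using a0 G'(1) by (simp_all add: subdegree_mult)
      then have "subdegree E = d"
        using Q0 by (auto simp: subdegree_mult)
      then show ?thesis
        using G'(2) by (simp add: I_def E_def B0_def)
    qed (simp add: I_def B0_def)
    then show ?case using B(1) by blast
  qed
  then show ?thesis
    using x by (auto simp: tree_vertices_def tree_level_def)
qed

section \<open>Powers in the arboreal field and orders of vanishing\<close>

lemma laurent_subfield:
  assumes \<psi>: "hom_on L \<psi>"
  shows "is_subfield {x\<in>L. \<psi> x \<in> range to_ac}"
  unfolding is_subfield_iff
  by (auto simp: subfield_closed[OF L(1)] hom_on_diff[OF L(1) \<psi>] hom_on_mult[OF L(1) \<psi>]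
      hom_on_inverse[OF L(1) \<psi>] hom_on_1[OF L(1) \<psi>]
      simp flip: to_ac_diff to_ac_mult to_ac_inverse intro: range_eqI[of _ _ 1])

lemma laurent_F:
  assumes "hom_on L \<psi>" "\<And>x. x \<in> k \<Longrightarrow> \<psi> x = lau_const x" "\<psi> t = lau (fps_const c + fps_X ^ e)"
  shows "F \<subseteq> {x\<in>L. \<psi> x \<in> range to_ac}"
proof (rule generate_field_least[OF laurent_subfield[OF assms(1)]])
  have "\<psi> t \<in> range to_ac"
    unfolding assms(3) unfolding lau_def by blast
  then show "insert t k \<subseteq> {x\<in>L. \<psi> x \<in> range to_ac}"
    using F assms(2) by (auto simp: lau_const_def lau_def)
qed

text \<open>The place sends \<open>F\<close> and the tree, hence all of \<open>M\<close>, to genuine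
  Laurent series. Comparing subdegrees in \<open>r ^ m = poly p t\<close> gives the divisibility;
  the substitution contributes the factor \<open>e\<close>.\<close>

lemma kummer_order:
  fixes c :: "'l alg_closure"
  assumes c: "c \<notin> to_ac ` S \<or> e = d \<and> 0 \<notin> S" and e: "e > 0"
    and p: "poly_over k p" "p \<noteq> 0" and r: "r \<in> M" "r ^ m = poly p t"
  shows "m dvd e * order c (map_poly to_ac p)"
proof -
  obtain \<psi> where \<psi>: "hom_on L \<psi>" "\<And>x. x \<in> k \<Longrightarrow> \<psi> x = lau_const x"
    "\<psi> t = lau (fps_const c + fps_X ^ e)"
    using place[OF e] by blast
  have "T \<subseteq> {x\<in>L. \<psi> x \<in> range to_ac}"
    using place_tree[OF \<psi> c e] T_L by (force simp: lau_def)
  then have "M \<subseteq> {x\<in>L. \<psi> x \<in> range to_ac}"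
    unfolding M_def using laurent_F[OF \<psi>] by (intro generate_field_least[OF laurent_subfield[OF \<psi>(1)]]) auto
  then obtain R where R: "\<psi> r = to_ac R" "r \<in> L"
    using r by blast
  let ?P = "fps_of_poly (pcompose (map_poly to_ac p) (monom 1 e + [:c:]))"
  have "to_ac (R ^ m) = lau ?P"
    using place_poly[OF \<psi> p(1)] R r(2) by (metis hom_on_power[OF L(1) \<psi>(1)] to_ac_power)
  then have "R ^ m = fps_to_fls ?P"
    unfolding lau_def by (simp only: to_ac_eq_iff)
  then have "int m * fls_subdegree R = int (subdegree ?P)"
    by (metis fls_subdegree_pow fls_subdegree_fls_to_fps)
  also have "subdegree ?P = e * order c (map_poly to_ac p)"
    using map_poly_hom_eq_0_iff[OF k(1) to_ac_hom_on p(1)] p(2) e by (intro subdegree_fps_of_poly_shift) auto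
  finally show ?thesis
    by (metis dvd_triv_left int_dvd_int_iff)
qed

end

lemma alg_closed_order_factorization:
  fixes p :: "'a::alg_closed_field poly"
  assumes "p \<noteq> 0"
  shows "\<exists>Z. finite Z \<and> p = smult (lead_coeff p) (\<Prod>x\<in>Z. [:- x, 1:] ^ order x p)"
proof -
  obtain A where A: "p = smult (lead_coeff p) (\<Prod>x\<in>#A. [:- x, 1:])"
    using alg_closed_imp_factorization[OF assms] by blast
  have lc: "lead_coeff p \<noteq> 0" using assms by simp
  have P: "proots (\<Prod>x\<in>#B. [:- x, 1:]) = B" for B :: "'a multiset"
  proof (induction B)
    case (add x B)
    have "(\<Prod>x\<in>#B. [:- x, 1:]) \<noteq> 0" by auto
    then show ?case using add by (simp add: proots_mult del: mult_pCons_left)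
  qed simp
  have "proots p = A"
    by (subst A) (simp only: proots_smult[OF lc] P)
  then have "order x p = count A x" for x
    using count_proots[OF assms, of x] by simp
  then have "p = smult (lead_coeff p) (\<Prod>x\<in>set_mset A. [:- x, 1:] ^ order x p)"
    using A by (simp add: image_prod_mset_multiplicity)
  then show ?thesis by blast
qed

context unicritical
begin

abbreviation "\<Gamma> \<equiv> galois_group L F"

section \<open>Roots contained in the arboreal field\<close>

lemma unity_root_k:
  assumes "of_nat n \<noteq> (0::'l)" "x ^ n = 1"
  shows "x \<in> k"
proof -
  obtain xs where xs: "set xs \<subseteq> k" "\<And>u v. u ^ n - v ^ n = (\<Prod>x\<leftarrow>xs. u - x * v)"
    using separably_closed_power_diff[OF k assms(1)] by metis
  have "(\<Prod>y\<leftarrow>xs. x - y * 1) = 0"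
    unfolding xs(2)[symmetric] using assms(2) by simp
  then show ?thesis using xs(1) by (auto simp: prod_list_zero_iff)
qed

lemma T_child: "x \<in> L \<Longrightarrow> f x \<in> T \<Longrightarrow> x \<in> T"
proof -
  assume x: "x \<in> L" "f x \<in> T"
  then obtain l where "(f ^^ l) (f x) = t"
    by (auto simp: tree_vertices_def tree_level_def)
  then have "(f ^^ Suc l) x = t"
    by (simp add: funpow_swap1)
  then show "x \<in> T"
    using x unfolding tree_vertices_def tree_level_def by blast
qed

lemma nth_root_L:
  assumes "of_nat n \<noteq> (0::'l)" "x \<in> L"
  obtains y where "y \<in> L" "y ^ n = x"
  using separably_closed_nth_root[OF L assms] by blast

lemma T_has_child:
  assumes "x \<in> T"
  obtains y where "y \<in> T" "y \<in> L" "f y = x"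
proof -
  have "(x - b) / a \<in> L"
    using assms T_L a b F by (intro subfield_closed[OF L(1)]) auto
  then obtain y where "y \<in> L" "y ^ d = (x - b) / a"
    using nth_root_L[OF d(2)] by blast
  then show thesis
    using that[of y] T_child[of y] assms a by (simp add: f_def)
qed

lemma f_inj_unity: "x ^ d = 1 \<Longrightarrow> f (y / x) = f y"
  by (simp add: f_def power_divide)

definition M_root :: "nat \<Rightarrow> 'l \<Rightarrow> bool" where
  "M_root n x \<longleftrightarrow> (\<exists>y\<in>M. y ^ n = x)"

lemma M_root_mult: "M_root n x \<Longrightarrow> M_root n y \<Longrightarrow> M_root n (x * y)"
  unfolding M_root_def by (metis power_mult_distrib subfield_mult[OF M(1)])

lemma M_root_k:
  assumes "of_nat n \<noteq> (0::'l)" "x \<in> k"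
  shows "M_root n x"
  using separably_closed_nth_root[OF k assms] F M unfolding M_root_def by (metis subset_iff)

lemma M_root_prod_list: "of_nat n \<noteq> (0::'l) \<Longrightarrow> (\<And>x. x \<in> set xs \<Longrightarrow> M_root n (g x)) \<Longrightarrow> M_root n (\<Prod>x\<leftarrow>xs. g x)"
  by (induction xs) (auto intro: M_root_mult M_root_k subfield_1[OF k(1)])

text \<open>All vertices are treated together because the inner induction along the orbit passes
  from \<open>x\<close> to all its children y/z with z^d = 1. The outer induction supplies one more
  d-th root: if 0 is in \<open>S\<close>, each vertex y = y - 0 is already a d^n-th power, and
  otherwise n = 0 at this point.\<close>

lemma M_root_T:
  assumes "0 \<in> S \<or> n \<le> 1" "c \<in> S" "x \<in> T"
  shows "M_root (d ^ n) (x - c)"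
  using assms
proof (induction n arbitrary: c x)
  case 0
  then have "x - c \<in> M"
    using M F S_k by (intro subfield_diff[OF M(1)]) auto
  then show ?case by (auto simp: M_root_def)
next
  case (Suc n)
  have pow: "M_root (d ^ n) y" if "y \<in> T" for y
  proof (cases "0 \<in> S")
    case True
    then show ?thesis using Suc.IH[of 0 y] that by simp
  next
    case False
    then show ?thesis using Suc.prems that M by (auto simp: M_root_def)
  qed
  note nz = of_nat_d_power[of "Suc n"]
  from Suc.prems(2,3) show ?case
  proof (induction c arbitrary: x rule: S_induct)
    case base
    obtain y where y: "y \<in> T" "f y = x" using T_has_child[OF base] by blast
    have "x - b = a * y ^ d" using y(2) by (auto simp: f_def)
    moreover have "M_root (d ^ Suc n) (y ^ d)"
      using pow[OF y(1)] unfolding M_root_def by (auto simp: power_mult mult.commute[of d])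
    ultimately show ?case
      using M_root_mult[OF M_root_k[OF nz a(1)]] by simp
  next
    case (step c)
    obtain y where y: "y \<in> T" "y \<in> L" "f y = x" using T_has_child[OF step.prems] by blast
    obtain xs where xs: "set xs \<subseteq> k" "\<And>x. x \<in> set xs \<Longrightarrow> x ^ d = 1"
      "\<And>u v. u ^ d - v ^ d = (\<Prod>x\<leftarrow>xs. u - x * v)"
      using separably_closed_power_diff[OF k d(2)] by metis
    have "x - f c = a * (y ^ d - c ^ d)"
      using y(3) by (auto simp: f_def algebra_simps)
    also have "\<dots> = a * (\<Prod>z\<leftarrow>xs. y - z * c)"
      unfolding xs(3) ..
    finally have eq: "x - f c = a * (\<Prod>z\<leftarrow>xs. y - z * c)" .
    have "M_root (d ^ Suc n) (y - z * c)" if z: "z \<in> set xs" for z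
    proof -
      have zk: "z \<in> k" "z \<noteq> 0" using xs(1) xs(2)[OF z] z d0 by (auto simp: zero_power)
      have "y / z \<in> L" using y zk F by (intro subfield_closed[OF L(1)]) auto
      moreover have "f (y / z) = x" using f_inj_unity xs(2) z y by simp
      ultimately have "y / z \<in> T" using T_child step.prems by simp
      then have "M_root (d ^ Suc n) (y / z - c)" by (rule step.IH)
      moreover have "y - z * c = z * (y / z - c)" using zk by (simp add: field_simps)
      ultimately show ?thesis using M_root_mult[OF M_root_k[OF nz zk(1)]] by metis
    qed
    then show ?case
      unfolding eq by (intro M_root_mult M_root_k[OF nz a(1)] M_root_prod_list nz)
  qed
qed

text \<open>
  Each passage of the critical orbit through \<open>0\<close> contributes another \<open>d\<close>-th root. Hence the arboreal
  field contains the \<open>d\<^sup>n\<close>-th roots of \<open>t - c\<close> for all \<open>n\<close> if \<open>0\<close> is periodic, but only its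
  \<open>d\<close>-th roots otherwise.
\<close>

definition rad :: "nat \<Rightarrow> nat" where
  "rad n = (if 0 \<in> S then d ^ n else d)"

lemma of_nat_rad: "of_nat (rad n) \<noteq> (0::'l)"
  using d by (simp add: rad_def)

lemma t_notin_k: "t \<notin> k"
proof
  assume "t \<in> k"
  then have "poly_over k [:- t, 1:]"
    by (intro poly_over_intros[OF k(1)] subfield_closed[OF k(1)])
  then show False using trans_poly[of "[:- t, 1:]"] by simp
qed

text \<open>One root exists in \<open>M\<close>, and any other differs from it by a root of unity in
  \<open>k\<close>.\<close>

lemma radical_M:
  assumes "c \<in> S" "w ^ rad n = t - c"
  shows "w \<in> M"
proof -
  have "M_root (rad n) (t - c)"
    using M_root_T[of n c t] M_root_T[of 1 c t] assms(1) t_T by (auto simp: rad_def)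
  then obtain y where y: "y \<in> M" "y ^ rad n = t - c" by (auto simp: M_root_def)
  have "t \<noteq> c" using t_notin_k S_k assms(1) by auto
  moreover have "rad n > 0" using of_nat_rad[of n] by (cases "rad n") auto
  ultimately have "y \<noteq> 0" using y by (auto simp: power_0_left)
  have "(w / y) ^ rad n = 1"
    using assms(2) y \<open>t \<noteq> c\<close> by (simp add: power_divide)
  then have "w / y \<in> M"
    using unity_root_k[OF of_nat_rad] F M by blast
  then have "w / y * y \<in> M" using y subfield_mult[OF M(1)] by blast
  then show ?thesis using \<open>y \<noteq> 0\<close> by simp
qed

section \<open>Kummer classes split by the arboreal field\<close>

lemma \<Gamma>_fix: "\<sigma> \<in> \<Gamma> \<Longrightarrow> x \<in> F \<Longrightarrow> \<sigma> x = x"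
  using galois_group_hom[OF F(1)] by blast

text \<open>A zero of \<open>p\<close> off the orbit has order divisible by d^n; one on the orbit
  contributes a power of a radical of t - c. So some r^q agrees, up to a root of unity in
  \<open>k\<close>, with a product of elements fixed by \<sigma>. Here \<open>q\<close> is a power
  of the characteristic exponent that puts the factors (X - c)^q over \<open>k\<close>. It is prime
  to d^n, so fixing r^q and r^(d^n) amounts to fixing \<open>r\<close>.\<close>

lemma radicals_fixed_imp_power:
  assumes \<sigma>: "\<sigma> \<in> \<Gamma>"
    and rads: "\<And>c n w. c \<in> S \<Longrightarrow> w \<in> L \<Longrightarrow> w ^ rad n = t - c \<Longrightarrow> \<sigma> w = w"
    and p: "poly_over k p" "p \<noteq> 0" and r: "r \<in> M" "r ^ (d ^ n) = poly p t" and n: "n > 0"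
  shows "\<sigma> r = r"
proof -
  let ?m = "d ^ n"
  note hom = galois_group_hom(1)[OF F(1) \<sigma>]
  let ?P = "map_poly to_ac p"
  have U: "is_subfield (UNIV :: 'l set)" by (simp add: is_subfield_iff)
  note acU = to_ac_hom_on[of "UNIV :: 'l set"]
  have P0: "?P \<noteq> 0"
    using map_poly_hom_eq_0_iff[OF k(1) to_ac_hom_on p(1)] p(2) by simp
  have lcP: "lead_coeff ?P = to_ac (lead_coeff p)"
    by (simp add: degree_map_poly coeff_map_poly)
  obtain Z where Z: "finite Z" "?P = smult (to_ac (lead_coeff p)) (\<Prod>x\<in>Z. [:- x, 1:] ^ order x ?P)"
    using alg_closed_order_factorization[OF P0] unfolding lcP by blast
  obtain N where N: "\<And>c. c \<in> Z \<Longrightarrow> order c ?P > 0 \<Longrightarrow> c ^ pexp TYPE('l) N \<in> to_ac ` k"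
  proof -
    have "\<exists>e. order c ?P > 0 \<longrightarrow> c ^ pexp TYPE('l) e \<in> to_ac ` k" if "c \<in> Z" for c
      using purely_inseparable[OF k p(1,2), of c] order_root[of ?P c] P0 by auto
    then obtain e where e: "\<And>c. c \<in> Z \<Longrightarrow> order c ?P > 0 \<Longrightarrow> c ^ pexp TYPE('l) (e c) \<in> to_ac ` k"
      by metis
    \<comment> \<open>One exponent serves all zeros, since the sum bounds each individual
      exponent.\<close>
    define N where "N = sum e Z"
    have "c ^ pexp TYPE('l) N \<in> to_ac ` k" if "c \<in> Z" "order c ?P > 0" for c
    proof -
      have "e c \<le> N" unfolding N_def using that Z(1) by (simp add: member_le_sum)
      then have "pexp TYPE('l) N = pexp TYPE('l) (e c) * pexp TYPE('l) (N - e c)"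
        by (simp add: pexp_def flip: power_add)
      then show ?thesis
        using e[OF that] subfield_power[OF k(1)] by (auto simp: power_mult simp flip: to_ac_power)
    qed
    then show thesis using that by blast
  qed
  define q where "q = pexp TYPE('l) N"
  \<comment> \<open>On the orbit the factor is prescribed explicitly, so that its value at
    \<open>t\<close> is known to be (t - s)^q.\<close>
  have "\<exists>h. poly_over k h \<and> (order c ?P > 0 \<longrightarrow> map_poly to_ac h = [:- c, 1:] ^ q) \<and>
      (\<forall>s\<in>S. c = to_ac s \<longrightarrow> h = [:- s, 1:] ^ q)" if c: "c \<in> Z" for c
  proof (cases "c \<in> to_ac ` S")
    case True
    then obtain s where s: "s \<in> S" "c = to_ac s" by blast
    have "poly_over k ([:- s, 1:] ^ q)"
      using s S_k by (intro poly_over_intros[OF k(1)] subfield_closed[OF k(1)]) auto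
    moreover have "map_poly to_ac (u ^ i) = map_poly to_ac u ^ i" for u :: "'l poly" and i
      by (induction i) (auto simp: map_poly_hom_mult[OF U acU] poly_over_def)
    ultimately show ?thesis
      using s by (intro exI[of _ "[:- s, 1:] ^ q"]) (auto simp: map_poly_pCons)
  next
    case False
    show ?thesis
    proof (cases "order c ?P > 0")
      case True
      then obtain g where g: "g \<in> k" "c ^ q = to_ac g"
        using N[OF c] unfolding q_def by auto
      have "[:- c, 1:] = monom 1 1 - [:c:]"
        by (simp add: monom_altdef)
      then have "[:- c, 1:] ^ q = monom 1 q - [:c ^ q:]"
        unfolding q_def by (simp only: power_pexp_diff) (simp add: monom_power poly_const_pow)
      then have "map_poly to_ac (monom 1 q - [:g:]) = [:- c, 1:] ^ q"
        using g by (simp add: map_poly_hom_diff[OF U acU] poly_over_def map_poly_monom map_poly_pCons)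
      moreover have "poly_over k (monom 1 q - [:g:])"
        using g by (intro poly_over_intros[OF k(1)] subfield_closed[OF k(1)])
      ultimately show ?thesis using False by blast
    next
      case F: False
      \<comment> \<open>A default value: this factor only occurs with exponent zero.\<close>
      show ?thesis using False F poly_over_0[OF k(1)] by (intro exI[of _ 0]) auto
    qed
  qed
  then obtain h where h: "\<And>c. c \<in> Z \<Longrightarrow> poly_over k (h c)"
    "\<And>c. c \<in> Z \<Longrightarrow> order c ?P > 0 \<Longrightarrow> map_poly to_ac (h c) = [:- c, 1:] ^ q"
    "\<And>s. to_ac s \<in> Z \<Longrightarrow> s \<in> S \<Longrightarrow> h (to_ac s) = [:- s, 1:] ^ q"
    by metis
  have hP: "map_poly to_ac (h c ^ order c ?P) = ([:- c, 1:] ^ q) ^ order c ?P" if "c \<in> Z" for c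
  proof (cases "order c ?P > 0")
    case True
    have "map_poly to_ac (u ^ i) = map_poly to_ac u ^ i" for u :: "'l poly" and i
      by (induction i) (auto simp: map_poly_hom_mult[OF U acU] poly_over_def)
    then show ?thesis using h(2)[OF that True] by simp
  qed simp
  have "map_poly to_ac (p ^ q) = map_poly to_ac (smult (lead_coeff p ^ q) (\<Prod>c\<in>Z. h c ^ order c ?P))"
  proof -
    have pw: "map_poly to_ac (u ^ i) = map_poly to_ac u ^ i" for u :: "'l poly" and i
      by (induction i) (auto simp: map_poly_hom_mult[OF U acU] poly_over_def)
    have pr: "map_poly to_ac (prod g I) = (\<Prod>i\<in>I. map_poly to_ac (g i))" for g :: "'x \<Rightarrow> 'l poly" and I
      by (induction I rule: infinite_finite_induct) (auto simp: map_poly_hom_mult[OF U acU] poly_over_def)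
    have "map_poly to_ac (p ^ q) = ?P ^ q" by (rule pw)
    also have "\<dots> = smult (to_ac (lead_coeff p)) (\<Prod>x\<in>Z. [:- x, 1:] ^ order x ?P) ^ q"
      using Z(2) by simp
    also have "\<dots> = smult (to_ac (lead_coeff p) ^ q) (\<Prod>c\<in>Z. ([:- c, 1:] ^ q) ^ order c ?P)"
      by (simp add: smult_power prod_power_distrib mult.commute flip: power_mult)
    also have "(\<Prod>c\<in>Z. ([:- c, 1:] ^ q) ^ order c ?P) = (\<Prod>c\<in>Z. map_poly to_ac (h c ^ order c ?P))"
      using hP by (intro prod.cong) auto
    also have "smult (to_ac (lead_coeff p) ^ q) \<dots> = map_poly to_ac (smult (lead_coeff p ^ q) (\<Prod>c\<in>Z. h c ^ order c ?P))"
      by (simp add: pr map_poly_smult)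
    finally show ?thesis .
  qed
  then have eq: "p ^ q = smult (lead_coeff p ^ q) (\<Prod>c\<in>Z. h c ^ order c ?P)"
    by (simp add: poly_eq_iff coeff_map_poly flip: to_ac_power to_ac_mult)
  have pq: "poly p t ^ q = lead_coeff p ^ q * (\<Prod>c\<in>Z. poly (h c) t ^ order c ?P)"
    using arg_cong[OF eq, of "\<lambda>p. poly p t"] by (simp add: poly_prod)
  have fac: "\<exists>u\<in>L. \<sigma> u = u \<and> u ^ ?m = poly (h c) t ^ order c ?P" if c: "c \<in> Z" for c
  proof (cases "c \<in> to_ac ` S")
    case False
    then obtain j where j: "order c ?P = ?m * j"
      using kummer_order[of c 1 p r ?m] p r by auto
    have "poly (h c) t ^ j \<in> F"
      using h(1)[OF c] F by (intro subfield_closed[OF F(1)] poly_over_poly[OF F(1)]) (auto simp: poly_over_def)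
    then have "\<sigma> (poly (h c) t ^ j) = poly (h c) t ^ j" "poly (h c) t ^ j \<in> L"
      using \<Gamma>_fix[OF \<sigma>] FL by auto
    then show ?thesis
      using j by (intro bexI[of _ "poly (h c) t ^ j"]) (auto simp: mult.commute simp flip: power_mult)
  next
    case True
    then obtain s where s: "s \<in> S" "c = to_ac s" by blast
    then have hc: "poly (h c) t = (t - s) ^ q"
      using h(3) c by simp
    have tsL: "t - s \<in> L"
      using s S_k F by (intro subfield_closed[OF L(1)]) auto
    have fixpow: "\<sigma> (w ^ i) = w ^ i" "w ^ i \<in> L" if "w \<in> L" "\<sigma> w = w" for w i
      using that by (simp_all add: hom_on_power[OF L(1) hom] subfield_power[OF L(1)])
    show ?thesis
    proof (cases "0 \<in> S")
      case True
      obtain w where w: "w \<in> L" "w ^ ?m = t - s"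
        using nth_root_L[OF of_nat_d_power tsL] by blast
      then have "\<sigma> w = w" using rads[of s w n] s True by (simp add: rad_def)
      then show ?thesis
        using fixpow[OF w(1), of "q * order c ?P"] unfolding hc w(2)[symmetric]
        by (intro bexI[of _ "w ^ (q * order c ?P)"]) (auto simp: mult_ac simp flip: power_mult)
    next
      case False
      \<comment> \<open>The place with e = d gives away one factor \<open>d\<close> of the
        divisibility, which the d-th root of t - s makes up for.\<close>
      have "?m dvd d * order c ?P"
        using kummer_order[of c d p r ?m] False d0 p r by auto
      moreover obtain n' where n': "n = Suc n'" using n by (cases n) auto
      ultimately obtain j where j: "order c ?P = d ^ n' * j"
        using d0 by auto
      obtain w where w: "w \<in> L" "w ^ d = t - s"
        using nth_root_L[OF d(2) tsL] by blast
      then have "\<sigma> w = w" using rads[of s w n] s False by (simp add: rad_def)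
      then show ?thesis
        using fixpow[OF w(1), of "q * j"] unfolding hc w(2)[symmetric] j n'
        by (intro bexI[of _ "w ^ (q * j)"]) (auto simp: mult_ac simp flip: power_mult)
    qed
  qed
  have "lead_coeff p \<in> k" using p by (simp add: poly_over_def)
  then obtain v where v: "v \<in> k" "v ^ ?m = lead_coeff p ^ q"
    using separably_closed_nth_root[OF k of_nat_d_power subfield_power[OF k(1)]] by metis
  obtain u where u: "\<And>c. c \<in> Z \<Longrightarrow> u c \<in> L \<and> \<sigma> (u c) = u c \<and> u c ^ ?m = poly (h c) t ^ order c ?P"
    using fac by metis
  define V where "V = v * (\<Prod>c\<in>Z. u c)"
  have vL: "v \<in> L" "\<sigma> v = v" using v F \<Gamma>_fix[OF \<sigma>] by auto
  have VL: "V \<in> L" unfolding V_def using u vL by (intro subfield_closed[OF L(1)]) auto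
  have \<sigma>V: "\<sigma> V = V"
    unfolding V_def using u vL
    by (simp add: hom_on_mult[OF L(1) hom] hom_on_prod[OF L(1) hom] subfield_prod[OF L(1)])
  have Vm: "V ^ ?m = poly p t ^ q"
  proof -
    have "(\<Prod>c\<in>Z. u c) ^ ?m = (\<Prod>c\<in>Z. poly (h c) t ^ order c ?P)"
      unfolding prod_power_distrib using u by (intro prod.cong) auto
    then show ?thesis unfolding V_def pq by (simp add: power_mult_distrib v)
  qed
  have rL: "r \<in> L" using r M by auto
  have pt: "poly p t \<noteq> 0" using trans_poly p by simp
  have m0: "?m > 0" using d0 by simp
  have r0: "r \<noteq> 0" using r pt m0 by (auto simp: power_0_left)
  have V0: "V \<noteq> 0"
    using Vm pt m0 by (metis power_0_left power_not_zero not_gr_zero)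
  \<comment> \<open>Both r^q and \<open>V\<close> are m-th roots of the same element, so their
    quotient is a constant and fixed by \<sigma>.\<close>
  have "(r ^ q / V) ^ ?m = 1"
    using Vm r(2) pt by (simp add: power_divide power_mult[symmetric] mult.commute[of q])
       (simp add: power_mult)
  then have "r ^ q / V \<in> k" by (rule unity_root_k[OF of_nat_d_power])
  then have "r ^ q / V \<in> F" using F by auto
  then have "\<sigma> (r ^ q / V) = r ^ q / V" by (rule \<Gamma>_fix[OF \<sigma>])
  then have "\<sigma> r ^ q / V = r ^ q / V"
    using rL VL \<sigma>V by (simp add: hom_on_divide[OF L(1) hom] hom_on_power[OF L(1) hom] subfield_power[OF L(1)])
  then have e1: "\<sigma> r ^ q = r ^ q" using V0 by simp
  have "poly p t \<in> F"
    using p F by (intro poly_over_poly[OF F(1)]) (auto simp: poly_over_def)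
  then have "\<sigma> (r ^ ?m) = r ^ ?m" using r(2) \<Gamma>_fix[OF \<sigma>] by simp
  then have e2: "\<sigma> r ^ ?m = r ^ ?m"
    using rL by (simp add: hom_on_power[OF L(1) hom])
  define z where "z = \<sigma> r / r"
  have z: "z ^ q = 1" "z ^ ?m = 1"
    using e1 e2 r0 by (auto simp: z_def power_divide)
  have "coprime ?m q"
    unfolding q_def using coprime_pexp[OF of_nat_d_power] by (simp add: coprime_commute)
  then obtain i j where "?m * i = q * j + 1"
    using bezout_nat[of ?m q] m0 by auto
  then have "z ^ (q * j + 1) = 1"
    using z(2) by (metis power_mult power_one)
  then have "z = 1"
    using z(1) by (simp add: power_mult)
  then show ?thesis
    using r0 by (simp add: z_def)
qed

text \<open>Clearing denominators: with m = d^n, multiplying \<open>r\<close> by q(t) replaces p/q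
  by the polynomial p q^(m-1).\<close>

lemma radicals_fixed:
  assumes \<sigma>: "\<sigma> \<in> \<Gamma>"
    and rads: "\<And>c n w. c \<in> S \<Longrightarrow> w \<in> L \<Longrightarrow> w ^ rad n = t - c \<Longrightarrow> \<sigma> w = w"
    and r: "r \<in> M" "r ^ (d ^ n) \<in> F" and n: "n > 0"
  shows "\<sigma> r = r"
proof -
  note hom = galois_group_hom(1)[OF F(1) \<sigma>]
  let ?m = "d ^ n"
  obtain p q where pq: "poly_over k p" "poly_over k q" "poly q t \<noteq> 0" "r ^ ?m = poly p t / poly q t"
    using r(2) unfolding adjoin_eq[OF k(1)] by auto
  have rL: "r \<in> L" using r M by auto
  have m0: "?m > 0" using d0 by simp
  show ?thesis
  proof (cases "p = 0")
    case True
    then have "r = 0" using pq by simp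
    then show ?thesis using hom_on_0[OF L(1) hom] by simp
  next
    case False
    have qF: "poly q t \<in> F"
      using pq F by (intro poly_over_poly[OF F(1)]) (auto simp: poly_over_def)
    have "\<sigma> (r * poly q t) = r * poly q t"
    proof (rule radicals_fixed_imp_power[OF \<sigma> rads _ _ _ _ n])
      show "poly_over k (p * q ^ (?m - 1))"
        using pq by (intro poly_over_intros[OF k(1)])
      show "p * q ^ (?m - 1) \<noteq> 0" using False pq by auto
      show "r * poly q t \<in> M" using r qF M by (intro subfield_closed[OF M(1)]) auto
      have "poly q t ^ ?m = poly q t * poly q t ^ (?m - 1)"
        using m0 by (simp flip: power_Suc)
      then show "(r * poly q t) ^ ?m = poly (p * q ^ (?m - 1)) t"
        using pq by (simp add: power_mult_distrib)
    qed auto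
    moreover have "\<sigma> (r * poly q t) = \<sigma> r * poly q t"
      using rL qF FL \<Gamma>_fix[OF \<sigma>] by (subst hom_on_mult[OF L(1) hom]) auto
    ultimately show ?thesis using pq by simp
  qed
qed

section \<open>Independence of the Kummer radicals\<close>

text \<open>
  At the place \<open>t = c\<close> the elements of \<open>J\<close> are unramified, whereas \<open>w\<close> is totally ramified.
\<close>

lemma radical_independent:
  assumes c: "c \<in> k" and J: "J \<subseteq> L"
    and Jr: "\<And>x. x \<in> J \<Longrightarrow> \<exists>n c'. of_nat n \<noteq> (0::'l) \<and> c' \<in> k \<and> c' \<noteq> c \<and> x ^ n = t - c'"
    and m: "of_nat m \<noteq> (0::'l)" and w: "w \<in> L" "w ^ m = t - c" and z: "z ^ m = 1"
  obtains \<sigma> where "\<sigma> \<in> \<Gamma>" "\<And>x. x \<in> J \<Longrightarrow> \<sigma> x = x" "\<sigma> w = z * w"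
proof -
  define F1 where "F1 = generate_field ring_of_type_algebra (F \<union> J)"
  have F1: "is_subfield F1" "F \<subseteq> F1" "J \<subseteq> F1" "F1 \<subseteq> L"
    unfolding F1_def using is_subfield_generate_field generate_field_superset[of "F \<union> J"]
      generate_field_least[OF L(1), of "F \<union> J"] FL J by auto
  have m0: "m > 0" using m by (cases m) auto
  obtain \<psi> where \<psi>: "hom_on L \<psi>" "\<And>x. x \<in> k \<Longrightarrow> \<psi> x = lau_const x"
    "\<psi> t = lau (fps_const (to_ac c) + fps_X ^ 1)"
    using place[of 1] by auto
  have \<psi>t: "\<psi> (t - c') = lau (fps_const (to_ac (c - c')) + fps_X)" if "c' \<in> k" for c'
  proof -
    have "c' \<in> L" "t \<in> L" using that F by auto
    then show ?thesis
      using that \<psi> by (simp add: hom_on_diff[OF L(1) \<psi>(1)] lau_const_def flip: fps_const_sub)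
  qed
  have JR: "\<psi> x \<in> range to_ac" if x: "x \<in> J" for x
  proof -
    obtain n c' where n: "of_nat n \<noteq> (0::'l)" "c' \<in> k" "c' \<noteq> c" "x ^ n = t - c'"
      using Jr[OF x] by blast
    let ?P = "fps_const (to_ac (c - c')) + fps_X"
    have P0: "?P $ 0 \<noteq> 0" using n(3) by simp
    have "\<psi> x ^ n = lau ?P"
      using \<psi>t[OF n(2)] n(4) x J hom_on_power[OF L(1) \<psi>(1)] by (metis subset_iff)
    moreover have "?P \<noteq> 0" using P0 by (metis fps_zero_nth)
    moreover have "n dvd subdegree ?P" using P0 subdegree_eq_0 by (metis dvd_0_right)
    ultimately obtain B where "\<psi> x = lau B"
      using lau_root[OF n(1)] by metis
    then show ?thesis by (simp add: lau_def)
  qed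
  have F1R: "F1 \<subseteq> {x\<in>L. \<psi> x \<in> range to_ac}"
    unfolding F1_def using laurent_F[OF \<psi>] J JR by (intro generate_field_least[OF laurent_subfield[OF \<psi>(1)]]) auto
  have sep1: "separable_over F1 x" if "x \<in> L" for x
    using sep[OF that] F1 separable_over_mono by blast
  obtain p where p: "min_poly F1 w p"
    using separable_over_imp_algebraic[OF sep1[OF w(1)]] min_poly_exists by blast
  then have p': "poly_over F1 p" "p \<noteq> 0" by (auto simp: min_poly_def)
  let ?u = "t - c"
  let ?q = "monom 1 m - [:?u:]"
  have uF: "?u \<in> F" using c F by (intro subfield_closed[OF F(1)]) auto
  have u0: "?u \<noteq> 0" using t_notin_k c by auto
  have q1: "poly_over F1 ?q" using uF F1 by (intro poly_over_diff[OF F1(1)] poly_over_monom[OF F1(1)] poly_over_const[OF F1(1)] subfield_1[OF F1(1)]) auto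
  have qw: "poly ?q w = 0" using w by (simp add: poly_monom)
  have qsep: "separable_poly ?q" by (rule separable_poly_root[OF m u0])
  obtain s where s: "poly_over F1 s" "?q = p * s" using min_poly_dvd[OF F1(1) p q1 qw] by blast
  have s0: "s \<noteq> 0" using s qsep separable_poly_nonzero by fastforce
  have psep: "separable_poly p" using separable_poly_factor s qsep by metis
  have pL: "poly_over L p" using p' F1 by (auto simp: poly_over_def)
  obtain xs where xs: "set xs \<subseteq> L" "p = smult (lead_coeff p) (\<Prod>x\<leftarrow>xs. [:- x, 1:])"
    using separably_closed_splits[OF L pL psep] by blast
  have lc: "lead_coeff p \<noteq> 0" using p' by simp
  have dl: "degree (\<Prod>x\<leftarrow>xs. [:- x, 1:]) = length xs" for xs :: "'l list"
  proof (induction xs)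
    case (Cons x xs)
    have "(\<Prod>x\<leftarrow>xs. [:- x, 1:]) \<noteq> 0" by (auto simp: prod_list_zero_iff)
    then show ?case using Cons by (simp add: degree_mult_eq del: mult_pCons_left)
  qed simp
  have dp: "degree p = length xs"
    using dl[of xs] lc by (subst xs(2)) simp
  have ev: "poly (\<Prod>x\<leftarrow>xs. [:- x, 1:]) y = (\<Prod>x\<leftarrow>xs. y - x)" for y and xs :: "'l list"
    by (induction xs) (auto simp: algebra_simps)
  have xm: "x ^ m = ?u" if "x \<in> set xs" for x
  proof -
    have "poly p x = 0"
      by (subst xs(2)) (use that in \<open>auto simp: ev prod_list_zero_iff\<close>)
    then have "poly ?q x = 0" unfolding s(2) by simp
    then show ?thesis by (simp add: poly_monom)
  qed
  \<comment> \<open>Up to sign the product of the conjugates of \<open>w\<close> over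
    \<open>F1\<close>. It lies in \<open>F1\<close>, so its order at the place is an
    integer.\<close>
  define v where "v = coeff p 0 / lead_coeff p"
  have v: "v \<in> F1"
    unfolding v_def using p'(1) by (intro subfield_closed[OF F1(1)]) (auto simp: poly_over_def)
  have "poly p 0 = lead_coeff p * (\<Prod>x\<leftarrow>xs. 0 - x)"
    by (subst xs(2)) (simp only: poly_smult ev)
  then have "v = (\<Prod>x\<leftarrow>xs. - x)"
    using lc by (simp add: v_def poly_0_coeff_0)
  moreover have "(\<Prod>x\<leftarrow>ys. - x) ^ m = ((-1) ^ m * ?u) ^ length ys" if "set ys \<subseteq> set xs" for ys
  proof -
    have "(- x) ^ m = (-1) ^ m * ?u" if "x \<in> set xs" for x
      using xm[OF that] power_minus[of x m] by simp
    then show ?thesis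
      using that by (induction ys) (simp_all add: power_mult_distrib del: mult_minus_left)
  qed
  ultimately have vm: "v ^ m = ((-1) ^ m * ?u) ^ length xs" by simp
  obtain V where V: "\<psi> v = to_ac V" "v \<in> L" using v F1R by blast
  have pm: "(-1) ^ m * ?u \<in> L"
    using uF FL by (intro subfield_mult[OF L(1)] subfield_power[OF L(1)] subfield_uminus[OF L(1)] subfield_1[OF L(1)]) auto
  have "\<psi> ((-1) ^ m * ?u) = (-1) ^ m * lau fps_X"
  proof -
    have "\<psi> (-1) = -1"
      using hom_on_uminus[OF L(1) \<psi>(1) subfield_1[OF L(1)]] hom_on_1[OF L(1) \<psi>(1)] by simp
    moreover have "-1 \<in> L" "?u \<in> L" using uF FL subfield_uminus[OF L(1) subfield_1[OF L(1)]] by auto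
    ultimately show ?thesis
      using \<psi>t[OF c] by (simp add: hom_on_mult[OF L(1) \<psi>(1)] hom_on_power[OF L(1) \<psi>(1)] subfield_power[OF L(1)])
  qed
  then have "to_ac V ^ m = ((-1) ^ m * lau fps_X) ^ length xs"
    using arg_cong[OF vm, of \<psi>] V pm by (simp add: hom_on_power[OF L(1) \<psi>(1)])
  then have "to_ac (V ^ m) = to_ac (((-1) ^ m * fls_X) ^ length xs)"
    by (simp add: lau_def)
  then have "V ^ m = ((-1) ^ m * fls_X) ^ length xs"
    by (simp only: to_ac_eq_iff)
  \<comment> \<open>Orders at the place: the left side is a multiple of \<open>m\<close>, the right
    side is the degree of \<open>p\<close>.\<close>
  then have "int m * fls_subdegree V = int (length xs) * fls_subdegree ((-1) ^ m * fls_X :: 'l alg_closure fls)"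
    by (metis fls_subdegree_pow)
  also have "fls_subdegree ((-1) ^ m * fls_X :: 'l alg_closure fls) = 1"
    by (cases "even m") auto
  finally have "m dvd length xs"
    by (metis dvd_triv_left int_dvd_int_iff mult.right_neutral)
  moreover have "length xs > 0" using min_poly_degree_pos[OF p] dp by simp
  ultimately have "m \<le> degree p" unfolding dp by (rule dvd_imp_le)
  moreover have "degree ?q \<le> m"
    by (rule degree_le) (use m0 in \<open>auto simp: coeff_pCons split: nat.splits\<close>)
  moreover have "degree ?q = degree p + degree s"
    unfolding s(2) using s0 p' by (simp add: degree_mult_eq)
  \<comment> \<open>So X^m - (t - c) is the minimal polynomial of \<open>w\<close> up to a constant,
    and z w is a conjugate of \<open>w\<close>.\<close>
  ultimately have "degree s = 0" by linarith
  then obtain e where e: "s = [:e:]" by (metis degree_eq_zeroE)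
  then have e0: "e \<noteq> 0" using s0 by auto
  have zk: "z \<in> L" using unity_root_k[OF m z] F by auto
  have "poly ?q (z * w) = 0" using z w by (simp add: poly_monom power_mult_distrib)
  then have pz: "poly p (z * w) = 0" unfolding s(2) e using e0 by simp
  obtain \<sigma> where \<sigma>: "\<sigma> \<in> galois_group L F1" "\<sigma> w = z * w"
    using galois_group_extend[OF F1(1) L F1(4) sep1 p subfield_mult[OF L(1) zk w(1)] pz w(1)] by blast
  show thesis
  proof (rule that)
    show "\<sigma> \<in> \<Gamma>" using \<sigma>(1) galois_group_mono[OF F1(2)] by blast
    show "\<sigma> x = x" if "x \<in> J" for x
      using galois_group_hom(3)[OF F1(1) \<sigma>(1)] F1(3) that by blast
  qed (use \<sigma> in auto)
qed

end

lemma map_poly_hom_prod: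
  assumes "is_subfield A" "hom_on A \<phi>" "\<And>i. i \<in> I \<Longrightarrow> poly_over A (g i)"
  shows "map_poly \<phi> (\<Prod>i\<in>I. g i) = (\<Prod>i\<in>I. map_poly \<phi> (g i))"
  using assms(3)
  by (induction I rule: infinite_finite_induct)
     (auto simp: map_poly_hom_mult[OF assms(1,2)] poly_over_prod[OF assms(1)] hom_on_1[OF assms(1,2)]
        map_poly_pCons hom_on_0[OF assms(1,2)] one_pCons)

lemma is_subfield_INT:
  "is_subfield A \<Longrightarrow> (\<And>i. i \<in> I \<Longrightarrow> is_subfield (B i)) \<Longrightarrow> is_subfield (A \<inter> (\<Inter>i\<in>I. B i))"
  unfolding is_subfield_iff by auto

context unicritical
begin

section \<open>The commutator subgroup and the radicals\<close>

lemma \<Gamma>_hom: "\<sigma> \<in> \<Gamma> \<Longrightarrow> hom_on L \<sigma>"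
  and \<Gamma>_L: "\<sigma> \<in> \<Gamma> \<Longrightarrow> x \<in> L \<Longrightarrow> \<sigma> x \<in> L"
  using galois_group_hom[OF F(1)] by blast+

lemma hom_on_comp: "\<sigma> \<in> \<Gamma> \<Longrightarrow> hom_on L \<phi> \<Longrightarrow> hom_on L (\<lambda>x. \<phi> (\<sigma> x))"
  using \<Gamma>_hom[of \<sigma>] \<Gamma>_L[of \<sigma>] by (auto simp: hom_on_def)

lemma eq_on_subfield:
  assumes "hom_on L \<phi>" "hom_on L \<psi>"
  shows "is_subfield {x\<in>L. \<phi> x = \<psi> x}"
  unfolding is_subfield_iff
  by (auto simp: subfield_closed[OF L(1)] hom_on_diff[OF L(1) assms(1)] hom_on_diff[OF L(1) assms(2)]
    hom_on_mult[OF L(1) assms(1)] hom_on_mult[OF L(1) assms(2)]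
    hom_on_inverse[OF L(1) assms(1)] hom_on_inverse[OF L(1) assms(2)]
    hom_on_1[OF L(1) assms(1)] hom_on_1[OF L(1) assms(2)])

text \<open>Equalizers are subfields and \<open>M\<close> is generated by \<open>F\<close> and the
  tree. Identities between automorphisms thus need only be verified on vertices.\<close>

lemma eq_on_M:
  assumes "hom_on L \<phi>" "hom_on L \<psi>" "\<And>x. x \<in> F \<Longrightarrow> \<phi> x = \<psi> x" "\<And>x. x \<in> T \<Longrightarrow> \<phi> x = \<psi> x"
    and "x \<in> M"
  shows "\<phi> x = \<psi> x"
proof -
  have "M \<subseteq> {x\<in>L. \<phi> x = \<psi> x}"
    unfolding M_def using assms FL T_L by (intro generate_field_least[OF eq_on_subfield]) auto
  then show ?thesis using assms(5) by blast
qed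

lemma \<Gamma>_f: "\<sigma> \<in> \<Gamma> \<Longrightarrow> x \<in> L \<Longrightarrow> \<sigma> (f x) = f (\<sigma> x)"
proof -
  assume \<sigma>: "\<sigma> \<in> \<Gamma>" and x: "x \<in> L"
  note h = \<Gamma>_hom[OF \<sigma>]
  have "a \<in> L" "b \<in> L" "\<sigma> a = a" "\<sigma> b = b"
    using a b F \<Gamma>_fix[OF \<sigma>] by auto
  then show ?thesis
    unfolding f_def using x
    by (simp add: hom_on_add[OF L(1) h] hom_on_mult[OF L(1) h] hom_on_power[OF L(1) h] subfield_closed[OF L(1)])
qed

lemma \<Gamma>_level:
  assumes "\<sigma> \<in> \<Gamma>" "x \<in> tree_level L t f l"
  shows "\<sigma> x \<in> tree_level L t f l"
proof -
  have iter: "(f ^^ l) x \<in> L \<and> \<sigma> ((f ^^ l) x) = (f ^^ l) (\<sigma> x)" if "x \<in> L" for x l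
  proof (induction l)
    case (Suc l)
    then show ?case using f_L \<Gamma>_f[OF assms(1), of "(f ^^ l) x"] by simp
  qed (use that in simp)
  then have "(f ^^ l) (\<sigma> x) = t"
    using assms(2) \<Gamma>_fix[OF assms(1) F(3)] by (auto simp: tree_level_def)
  then show ?thesis
    using assms \<Gamma>_L by (simp add: tree_level_def)
qed

lemma \<Gamma>_T: "\<sigma> \<in> \<Gamma> \<Longrightarrow> x \<in> T \<Longrightarrow> \<sigma> x \<in> T"
  using \<Gamma>_level by (auto simp: tree_vertices_def)

lemma finite_level: "finite (tree_level L t f l)"
proof (induction l)
  case 0
  have "tree_level L t f 0 \<subseteq> {t}" by (auto simp: tree_level_def)
  then show ?case by (rule finite_subset) simp
next
  case (Suc l)
  have "finite {x. f x = y}" for y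
  proof -
    have "finite {x. poly (monom a d - [:y - b:]) x = 0}"
      by (rule poly_roots_finite)
         (use a d0 in \<open>auto simp: poly_eq_iff coeff_pCons intro!: exI[of _ d] split: nat.splits\<close>)
    then show ?thesis by (simp add: f_def poly_monom algebra_simps eq_diff_eq)
  qed
  moreover have "tree_level L t f (Suc l) \<subseteq> (\<Union>y\<in>tree_level L t f l. {x. f x = y})"
    using f_L by (auto simp: tree_level_def funpow_swap1)
  ultimately show ?case
    using Suc by (meson finite_UN_I finite_subset)
qed

lemma alg_L: "x \<in> L \<Longrightarrow> algebraic_elem F x"
  by (rule separable_over_imp_algebraic[OF sep])

text \<open>A plain iterate need not be extensional; its restriction to \<open>L\<close> has the
  same values there and belongs to the group.\<close>

lemma \<Gamma>_funpow:
  assumes "\<sigma> \<in> \<Gamma>"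
  shows "\<exists>\<rho>\<in>\<Gamma>. \<forall>x\<in>L. \<rho> x = (\<sigma> ^^ n) x"
proof -
  have h: "hom_on L (\<sigma> ^^ n)" "\<And>x. x \<in> L \<Longrightarrow> (\<sigma> ^^ n) x \<in> L" "\<And>x. x \<in> F \<Longrightarrow> (\<sigma> ^^ n) x = x"
  proof -
    have "hom_on L (\<sigma> ^^ n) \<and> (\<forall>x\<in>L. (\<sigma> ^^ n) x \<in> L) \<and> (\<forall>x\<in>F. (\<sigma> ^^ n) x = x)"
      using \<Gamma>_hom[OF assms] \<Gamma>_L[OF assms] \<Gamma>_fix[OF assms]
      by (induction n) (auto simp: hom_on_def)
    then show "hom_on L (\<sigma> ^^ n)" "\<And>x. x \<in> L \<Longrightarrow> (\<sigma> ^^ n) x \<in> L" "\<And>x. x \<in> F \<Longrightarrow> (\<sigma> ^^ n) x = x"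
      by auto
  qed
  have "restrict (\<sigma> ^^ n) L \<in> \<Gamma>"
    by (rule galois_groupI[OF L(1) FL])
       (use h FL alg_L in \<open>auto simp: hom_on_def subfield_closed[OF L(1)]\<close>)
  then show ?thesis by (intro bexI[of _ "restrict (\<sigma> ^^ n) L"]) auto
qed

text \<open>Let \<rho> = \<sigma>^(d^n) fix the parent of \<open>x\<close>. Then \<rho> multiplies
  \<open>x\<close> by a d-th root of unity, which lies in \<open>k\<close>, is fixed by \<rho>, and
  disappears in \<rho>^d. Each level costs one factor \<open>d\<close>.\<close>

lemma \<Gamma>_exponent:
  assumes "\<sigma> \<in> \<Gamma>" "x \<in> tree_level L t f l" "l \<le> n"
  shows "(\<sigma> ^^ (d ^ n)) x = x"
  using assms(2,3)
proof (induction n arbitrary: l x)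
  case 0
  then have "x = t" by (simp add: tree_level_def)
  then show ?case using \<Gamma>_fix[OF assms(1) F(3)] by simp
next
  case (Suc n)
  obtain \<rho> where \<rho>: "\<rho> \<in> \<Gamma>" "\<And>x. x \<in> L \<Longrightarrow> \<rho> x = (\<sigma> ^^ (d ^ n)) x"
    using \<Gamma>_funpow[OF assms(1)] by blast
  have iter: "(\<sigma> ^^ (d ^ Suc n)) x = (\<rho> ^^ d) x" if "x \<in> L" for x
  proof -
    have "(\<rho> ^^ i) x = ((\<sigma> ^^ (d ^ n)) ^^ i) x \<and> (\<rho> ^^ i) x \<in> L" for i
    proof (induction i)
      case (Suc i)
      have "(\<rho> ^^ Suc i) x = \<rho> ((\<rho> ^^ i) x)" by simp
      also have "\<dots> = (\<sigma> ^^ (d ^ n)) ((\<rho> ^^ i) x)" using \<rho>(2) Suc by blast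
      also have "\<dots> = ((\<sigma> ^^ (d ^ n)) ^^ Suc i) x" using Suc by simp
      finally have "(\<rho> ^^ Suc i) x = ((\<sigma> ^^ (d ^ n)) ^^ Suc i) x" .
      moreover have "(\<rho> ^^ Suc i) x \<in> L"
        using \<Gamma>_L[OF \<rho>(1) conjunct2[OF Suc]] by simp
      ultimately show ?case by blast
    qed (use that in simp)
    then show ?thesis by (simp add: funpow_mult mult.commute)
  qed
  have xL: "x \<in> L" using Suc.prems by (simp add: tree_level_def)
  have "(\<rho> ^^ d) x = x"
  proof (cases l)
    case 0
    then have "x = t" using Suc.prems by (simp add: tree_level_def)
    then have "(\<rho> ^^ i) x = x" for i using \<Gamma>_fix[OF \<rho>(1) F(3)] by (induction i) auto
    then show ?thesis .
  next
    case (Suc l')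
    then have fx: "f x \<in> tree_level L t f l'"
      using Suc.prems xL f_L by (simp add: tree_level_def funpow_swap1)
    then have "\<rho> (f x) = f x"
      using Suc.IH[OF fx] Suc.prems Suc \<rho>(2) f_L xL by auto
    then have "f (\<rho> x) = f x" using \<Gamma>_f[OF \<rho>(1) xL] by simp
    then have pd: "\<rho> x ^ d = x ^ d" using a by (simp add: f_def)
    show ?thesis
    proof (cases "x = 0")
      case True
      have "(\<rho> ^^ i) 0 = 0" for i
        using hom_on_0[OF L(1) \<Gamma>_hom[OF \<rho>(1)]] by (induction i) auto
      then show ?thesis using True by simp
    next
      case False
      define z where "z = \<rho> x / x"
      have z: "z ^ d = 1" using pd False by (simp add: z_def power_divide)
      then have "z \<in> k" using unity_root_k d(2) by blast
      then have zF: "\<rho> z = z" "z \<in> L" using \<Gamma>_fix[OF \<rho>(1)] F by auto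
      have "(\<rho> ^^ i) x = z ^ i * x" for i
      proof (induction i)
        case (Suc i)
        have "z ^ i \<in> L" "\<rho> (z ^ i) = z ^ i"
          using zF by (simp_all add: subfield_power[OF L(1)] hom_on_power[OF L(1) \<Gamma>_hom[OF \<rho>(1)]])
        then have "\<rho> (z ^ i * x) = z ^ i * (z * x)"
          using xL False by (simp add: hom_on_mult[OF L(1) \<Gamma>_hom[OF \<rho>(1)]] z_def)
        then show ?case using Suc by (simp add: mult_ac)
      qed simp
      then show ?thesis using z by simp
    qed
  qed
  then show ?case using iter[OF xL] by simp
qed

text \<open>
  If \<open>x\<close> is fixed by commutators and moved by \<open>\<sigma>\<close>, then so is some common eigenvector of the group,
  obtained from the projections \<open>\<Sum>\<^sub>j \<zeta>\<^sup>j \<tau>\<^sup>j x\<close> one \<open>\<tau>\<close> at a time; a common eigenvector is a Kummer radical.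
\<close>

lemma eigenvector:
  assumes W: "is_subfield W" "F \<subseteq> W" "W \<subseteq> L" and stable: "\<And>\<tau> x. \<tau> \<in> \<Gamma> \<Longrightarrow> x \<in> W \<Longrightarrow> \<tau> x \<in> W"
    and comm: "\<And>\<tau> \<tau>' x. \<tau> \<in> \<Gamma> \<Longrightarrow> \<tau>' \<in> \<Gamma> \<Longrightarrow> x \<in> W \<Longrightarrow> \<tau> (\<tau>' x) = \<tau>' (\<tau> x)"
    and expo: "\<And>\<tau> x. \<tau> \<in> \<Gamma> \<Longrightarrow> x \<in> W \<Longrightarrow> (\<tau> ^^ m) x = x" and m: "of_nat m \<noteq> (0::'l)"
    and \<sigma>: "\<sigma> \<in> \<Gamma>" "x \<in> W" "\<sigma> x \<noteq> x" and G: "finite G" "G \<subseteq> \<Gamma>"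
  shows "\<exists>y\<in>W. \<sigma> y \<noteq> y \<and> (\<forall>\<tau>\<in>G. \<exists>z. z ^ m = 1 \<and> \<tau> y = z * y)"
  using G
proof (induction G rule: finite_induct)
  case empty
  then show ?case using \<sigma> by blast
next
  case (insert \<tau> G)
  then obtain y where y: "y \<in> W" "\<sigma> y \<noteq> y" "\<And>\<rho>. \<rho> \<in> G \<Longrightarrow> \<exists>z. z ^ m = 1 \<and> \<rho> y = z * y"
    by blast
  have \<tau>: "\<tau> \<in> \<Gamma>" using insert.prems by blast
  obtain \<omega> where \<omega>: "\<omega> \<in> k" "primitive_root m \<omega>"
    using primitive_root_exists[OF k m] by blast
  have m0: "m > 0" using m by (cases m) auto
  have \<omega>m: "\<omega> ^ m = 1" using primitive_rootD[OF \<omega>(2)] .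
  have \<omega>0: "\<omega> \<noteq> 0" using \<omega>m m0 by (auto simp: zero_power)
  have \<omega>W: "\<omega> ^ i \<in> W" for i using \<omega> F W by (intro subfield_power[OF W(1)]) auto
  have \<omega>fix: "\<rho> (\<omega> ^ i) = \<omega> ^ i" if "\<rho> \<in> \<Gamma>" for \<rho> i
    using \<Gamma>_fix[OF that] \<omega> F by (meson subfield_power subsetD)
  have pW: "(\<tau> ^^ j) y \<in> W" for j by (induction j) (use y stable \<tau> in auto)
  \<comment> \<open>Lagrange resolvents: up to the factor \<open>m\<close>, the projections of
    \<open>y\<close> to the eigenspaces of \<tau>.\<close>
  define c where "c i = (\<Sum>j<m. \<omega> ^ (i * j) * (\<tau> ^^ j) y)" for i
  have cW: "c i \<in> W" for i
    unfolding c_def using \<omega>W pW by (intro subfield_sum[OF W(1)] subfield_mult[OF W(1)])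
  have apply_c: "\<rho> (c i) = (\<Sum>j<m. \<omega> ^ (i * j) * \<rho> ((\<tau> ^^ j) y))" if "\<rho> \<in> \<Gamma>" for \<rho> i
  proof -
    note h = \<Gamma>_hom[OF that]
    have "\<rho> (c i) = (\<Sum>j<m. \<rho> (\<omega> ^ (i * j) * (\<tau> ^^ j) y))"
      unfolding c_def using \<omega>W pW W(3) by (intro hom_on_sum[OF L(1) h] subfield_mult[OF L(1)]) auto
    also have "\<dots> = (\<Sum>j<m. \<omega> ^ (i * j) * \<rho> ((\<tau> ^^ j) y))"
      using \<omega>W pW W(3) \<omega>fix[OF that] by (intro sum.cong refl) (auto simp: hom_on_mult[OF L(1) h] subset_iff)
    finally show ?thesis .
  qed
  \<comment> \<open>By orthogonality only j = 0 survives. As \<open>m\<close> is invertible and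
    \<sigma> moves \<open>y\<close>, it must move some resolvent.\<close>
  have sumc: "(\<Sum>i<m. c i) = of_nat m * y"
  proof -
    have "(\<Sum>i<m. c i) = (\<Sum>j<m. (\<Sum>i<m. (\<omega> ^ j) ^ i) * (\<tau> ^^ j) y)"
      unfolding c_def by (subst sum.swap) (simp add: sum_distrib_right sum_distrib_left mult.commute flip: power_mult)
    also have "\<dots> = (\<Sum>j<m. if j = 0 then of_nat m * y else 0)"
    proof (intro sum.cong refl)
      fix j assume j: "j \<in> {..<m}"
      show "(\<Sum>i<m. (\<omega> ^ j) ^ i) * (\<tau> ^^ j) y = (if j = 0 then of_nat m * y else 0)"
      proof (cases "j = 0")
        case False
        then have "\<not> m dvd j" using j by (auto dest: dvd_imp_le)
        then have ne: "\<omega> ^ j \<noteq> 1" using \<omega>(2) by (simp add: primitive_root_def)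
        have "(\<omega> ^ j - 1) * (\<Sum>i<m. (\<omega> ^ j) ^ i) = (\<omega> ^ j) ^ m - 1"
          by (rule power_diff_1_eq[symmetric])
        also have "\<dots> = 0" using \<omega>m by (metis power_mult mult.commute power_one diff_self)
        finally show ?thesis using ne False by simp
      qed simp
    qed
    also have "\<dots> = of_nat m * y" using m0 by simp
    finally show ?thesis .
  qed
  obtain i where i: "i < m" "\<sigma> (c i) \<noteq> c i"
  proof -
    have "\<exists>i<m. \<sigma> (c i) \<noteq> c i"
    proof (rule ccontr)
      assume "\<not> ?thesis"
      then have "\<sigma> (\<Sum>i<m. c i) = (\<Sum>i<m. c i)"
        using cW W(3) hom_on_sum[OF L(1) \<Gamma>_hom[OF \<sigma>(1)], of "{..<m}" c] by auto
      then have "\<sigma> (of_nat m * y) = of_nat m * y" unfolding sumc .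
      moreover have "\<sigma> (of_nat m * y) = of_nat m * \<sigma> y"
        using hom_on_mult[OF L(1) \<Gamma>_hom[OF \<sigma>(1)] subfield_of_nat[OF L(1)]] y(1) W(3)
          \<Gamma>_fix[OF \<sigma>(1) subfield_of_nat[OF F(1)]] by auto
      ultimately show False using y(2) m by simp
    qed
    then show thesis using that by blast
  qed
  \<comment> \<open>Earlier eigenvalue equations survive because \<rho> and \<tau> commute on
    \<open>W\<close> and both fix the constants.\<close>
  have "\<exists>z. z ^ m = 1 \<and> \<rho> (c i) = z * c i" if \<rho>: "\<rho> \<in> G" for \<rho>
  proof -
    obtain z where z: "z ^ m = 1" "\<rho> y = z * y" using y(3)[OF \<rho>] by blast
    have \<rho>\<Gamma>: "\<rho> \<in> \<Gamma>" using \<rho> insert.prems by blast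
    have zk: "z \<in> k" using unity_root_k[OF m z(1)] .
    have "\<rho> ((\<tau> ^^ j) y) = z * (\<tau> ^^ j) y" for j
    proof (induction j)
      case (Suc j)
      have "\<rho> ((\<tau> ^^ Suc j) y) = \<tau> (\<rho> ((\<tau> ^^ j) y))"
        using comm[OF \<rho>\<Gamma> \<tau> pW] by simp
      also have "\<dots> = z * (\<tau> ^^ Suc j) y"
        using Suc \<Gamma>_fix[OF \<tau>, of z] zk F W(3) pW[of j]
        by (simp add: hom_on_mult[OF L(1) \<Gamma>_hom[OF \<tau>]] subset_iff)
      finally show ?case .
    qed (simp add: z)
    then have "\<rho> (c i) = z * c i"
      unfolding apply_c[OF \<rho>\<Gamma>] unfolding c_def sum_distrib_left by (intro sum.cong) (auto simp: mult_ac)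
    then show ?thesis using z by blast
  qed
  \<comment> \<open>Applying \<tau> shifts the sum cyclically, since \<tau>^m fixes
    \<open>y\<close>.\<close>
  moreover have "\<tau> (c i) = inverse (\<omega> ^ i) * c i"
  proof -
    define g where "g j = \<omega> ^ (i * j) * (\<tau> ^^ j) y" for j
    have "\<omega> ^ i * \<tau> (c i) = (\<Sum>j<m. g (Suc j))"
      unfolding apply_c[OF \<tau>] sum_distrib_left g_def
      by (intro sum.cong refl) (simp add: power_add mult_ac)
    also have "\<dots> = (\<Sum>j<m. g j) + g m - g 0"
      using sum.lessThan_Suc_shift[of g m] sum.lessThan_Suc[of g m] by simp
    also have "g m = g 0"
      using expo[OF \<tau> y(1)] \<omega>m by (simp add: g_def power_mult mult.commute[of i])
    finally have "\<omega> ^ i * \<tau> (c i) = c i" by (simp add: c_def g_def)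
    then show ?thesis using \<omega>0 by (simp add: field_simps)
  qed
  moreover have "inverse (\<omega> ^ i) ^ m = 1"
    using \<omega>m by (metis inverse_1 mult.commute power_inverse power_mult power_one)
  ultimately have "\<forall>\<rho>\<in>insert \<tau> G. \<exists>z. z ^ m = 1 \<and> \<rho> (c i) = z * c i"
    by blast
  then show ?case using cW i(2) by blast
qed

text \<open>Powers of a transcendental element are distinct. Infinitude is what later allows a
  combination of vertices that separates automorphisms.\<close>

lemma infinite_F: "infinite F"
proof
  assume fin: "finite F"
  have "inj (\<lambda>n::nat. t ^ n)"
  proof (rule injI)
    fix i j :: nat assume "t ^ i = t ^ j"
    then have "poly (monom 1 i - monom 1 j) t = 0" by (simp add: poly_monom)
    moreover have "poly_over k (monom 1 i - monom 1 j)"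
      by (intro poly_over_intros[OF k(1)] subfield_closed[OF k(1)])
    ultimately have "monom 1 i = (monom 1 j :: 'l poly)" using trans_poly by (metis eq_iff_diff_eq_0)
    then have "degree (monom 1 i :: 'l poly) = degree (monom 1 j :: 'l poly)" by simp
    then show "i = j" by (simp add: degree_monom_eq)
  qed
  moreover have "range (\<lambda>n::nat. t ^ n) \<subseteq> F"
    using F subfield_power[OF F(1)] by blast
  ultimately show False using fin by (meson finite_subset range_inj_infinite)
qed

text \<open>\<open>D\<close> stands for the automorphisms whose restriction to the tree lies in the
  commutator subgroup, so the conditions on it are read on \<open>T\<close>. On the part of
  \<open>M\<close> seen by finitely many levels, the group acts on the elements fixed by
  \<open>D\<close> through commuting maps of exponent d^N; if \<sigma> moved one, it would move an
  eigenvector, which is a Kummer radical. So \<sigma> fixes them, hence preserves the polynomial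
  whose roots are the \<open>D\<close>-conjugates of a separating element.\<close>

lemma radicals_fixed_dense:
  assumes D: "D \<subseteq> \<Gamma>" "\<delta>0 \<in> D" "\<And>\<delta> \<delta>'. \<delta> \<in> D \<Longrightarrow> \<delta>' \<in> D \<Longrightarrow> \<exists>\<delta>''\<in>D. \<forall>x\<in>T. \<delta>'' x = \<delta> (\<delta>' x)"
    and comm: "\<And>\<tau> \<tau>'. \<tau> \<in> \<Gamma> \<Longrightarrow> \<tau>' \<in> \<Gamma> \<Longrightarrow> \<exists>\<epsilon>\<in>D. \<forall>x\<in>T. \<tau> (\<tau>' x) = \<tau>' (\<tau> (\<epsilon> x))"
    and \<sigma>: "\<sigma> \<in> \<Gamma>"
    and rads: "\<And>c n w. c \<in> S \<Longrightarrow> w \<in> L \<Longrightarrow> w ^ rad n = t - c \<Longrightarrow> \<sigma> w = w"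
    and A: "finite A" "A \<subseteq> T"
  shows "\<exists>\<tau>\<in>D. \<forall>x\<in>A. \<tau> x = \<sigma> x"
proof -
  have "\<exists>g. \<forall>x\<in>A. x \<in> tree_level L t f (g x)"
    using A(2) unfolding tree_vertices_def by (intro bchoice) auto
  then obtain g where g: "\<And>x. x \<in> A \<Longrightarrow> x \<in> tree_level L t f (g x)" by blast
  \<comment> \<open>The sum bounds every level that occurs in \<open>A\<close>; the successor makes
    \<open>N\<close> positive, as required for applying \<open>radicals_fixed\<close>.\<close>
  define N where "N = Suc (sum g A)"
  define B where "B = (\<Union>l\<le>N. tree_level L t f l)"
  have AB: "A \<subseteq> B"
    unfolding B_def N_def using g member_le_sum[of _ A g] A(1) by fastforce
  have finB: "finite B" unfolding B_def using finite_level by auto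
  have BT: "B \<subseteq> T" "B \<subseteq> L" unfolding B_def tree_vertices_def tree_level_def by auto
  have \<Gamma>B: "\<tau> x \<in> B" if "\<tau> \<in> \<Gamma>" "x \<in> B" for \<tau> x
    using that \<Gamma>_level unfolding B_def by blast
  define m where "m = d ^ N"
  have m: "of_nat m \<noteq> (0::'l)" unfolding m_def by (rule of_nat_d_power)
  \<comment> \<open>The common equalizer in \<open>M\<close> of all pairs agreeing on
    \<open>B\<close> plays the part of the field generated by \<open>F\<close> and \<open>B\<close>;
    in this form the action on \<open>B\<close> determines the action on \<open>E\<close> by
    construction.\<close>
  define PP where "PP = {p \<in> \<Gamma> \<times> \<Gamma>. \<forall>\<beta>\<in>B. fst p \<beta> = snd p \<beta>}"
  define E where "E = M \<inter> (\<Inter>p\<in>PP. {x\<in>L. fst p x = snd p x})"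
  define W where "W = {x\<in>E. \<forall>\<delta>\<in>D. \<delta> x = x}"
  note homs = hom_on_diff[OF L(1) \<Gamma>_hom] hom_on_mult[OF L(1) \<Gamma>_hom] hom_on_inverse[OF L(1) \<Gamma>_hom]
     hom_on_1[OF L(1) \<Gamma>_hom]
  have inL: "x \<in> L" if "x \<in> M" for x using that M by blast
  have E: "is_subfield E"
    unfolding E_def PP_def by (intro is_subfield_INT M eq_on_subfield \<Gamma>_hom) auto
  have EM: "E \<subseteq> M" unfolding E_def by blast
  have ED: "\<tau> x = \<tau>' x" if "x \<in> E" "\<tau> \<in> \<Gamma>" "\<tau>' \<in> \<Gamma>" "\<forall>\<beta>\<in>B. \<tau> \<beta> = \<tau>' \<beta>" for x \<tau> \<tau>'
  proof -
    have "(\<tau>, \<tau>') \<in> PP" using that by (simp add: PP_def)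
    then show ?thesis using that(1) unfolding E_def by fastforce
  qed
  have EI: "x \<in> E" if x: "x \<in> M"
    "\<And>\<tau> \<tau>'. \<tau> \<in> \<Gamma> \<Longrightarrow> \<tau>' \<in> \<Gamma> \<Longrightarrow> \<forall>\<beta>\<in>B. \<tau> \<beta> = \<tau>' \<beta> \<Longrightarrow> \<tau> x = \<tau>' x" for x
  proof -
    have "fst p x = snd p x" if "p \<in> PP" for p
      using x(2)[of "fst p" "snd p"] that by (auto simp: PP_def)
    then show ?thesis using x(1) inL[OF x(1)] unfolding E_def by blast
  qed
  have FE: "F \<subseteq> E"
  proof
    fix x assume "x \<in> F"
    then show "x \<in> E" using M(2) \<Gamma>_fix by (intro EI) (blast, metis)
  qed
  have BE: "B \<subseteq> E"
  proof
    fix x assume "x \<in> B"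
    then show "x \<in> E" using M(3) BT(1) by (intro EI) auto
  qed
  have \<Gamma>M: "\<tau> x \<in> M" if \<tau>: "\<tau> \<in> \<Gamma>" and x: "x \<in> M" for \<tau> x
  proof -
    have "is_subfield {x\<in>L. \<tau> x \<in> M}"
      unfolding is_subfield_iff
      by (auto simp: subfield_closed[OF L(1)] subfield_closed[OF M(1)] homs[OF \<tau>])
    moreover have "F \<union> T \<subseteq> {x\<in>L. \<tau> x \<in> M}"
      using \<Gamma>_fix[OF \<tau>] \<Gamma>_T[OF \<tau>] M FL T_L by auto
    ultimately have "M \<subseteq> {x\<in>L. \<tau> x \<in> M}"
      unfolding M_def by (rule generate_field_least)
    then show ?thesis using x by blast
  qed
  have \<Gamma>E: "\<tau> x \<in> E" if \<tau>: "\<tau> \<in> \<Gamma>" and x: "x \<in> E" for \<tau> x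
  proof -
    have "\<rho> (\<tau> x) = \<rho>' (\<tau> x)" if \<rho>: "\<rho> \<in> \<Gamma>" "\<rho>' \<in> \<Gamma>" "\<forall>\<beta>\<in>B. \<rho> \<beta> = \<rho>' \<beta>" for \<rho> \<rho>'
    proof -
      have comp: "restrict (\<lambda>x. \<rho> (\<tau> x)) L \<in> \<Gamma>" if "\<rho> \<in> \<Gamma>" for \<rho>
      proof (rule galois_groupI[OF L(1) FL alg_L])
        show "hom_on L (restrict (\<lambda>x. \<rho> (\<tau> x)) L)"
          using hom_on_comp[OF \<tau> \<Gamma>_hom[OF that]] by (auto simp: hom_on_def subfield_closed[OF L(1)])
        show "restrict (\<lambda>x. \<rho> (\<tau> x)) L x = x" if "x \<in> F" for x
          using that FL \<Gamma>_fix[OF \<tau>] \<Gamma>_fix[OF \<open>\<rho> \<in> \<Gamma>\<close>] by auto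
      qed (use \<Gamma>_L \<tau> that in auto)
      have "\<forall>\<beta>\<in>B. restrict (\<lambda>x. \<rho> (\<tau> x)) L \<beta> = restrict (\<lambda>x. \<rho>' (\<tau> x)) L \<beta>"
        using \<rho>(3) \<Gamma>B[OF \<tau>] by auto
      then have "restrict (\<lambda>x. \<rho> (\<tau> x)) L x = restrict (\<lambda>x. \<rho>' (\<tau> x)) L x"
        by (intro ED[OF x comp[OF \<rho>(1)] comp[OF \<rho>(2)]])
      moreover have "x \<in> L" using x EM inL by blast
      ultimately show ?thesis by simp
    qed
    then show ?thesis using \<Gamma>M[OF \<tau>] x EM by (intro EI) auto
  qed
  have WL: "W \<subseteq> L" "W \<subseteq> M" "W \<subseteq> E" using EM M by (auto simp: W_def)
  have W: "is_subfield W"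
  proof -
    have "W = E \<inter> (\<Inter>\<delta>\<in>D. {x\<in>L. \<delta> x = x})"
      using WL unfolding W_def by auto
    also have "is_subfield \<dots>"
    proof (rule is_subfield_INT[OF E])
      fix \<delta> assume "\<delta> \<in> D"
      moreover have "hom_on L (\<lambda>x. x)" by (simp add: hom_on_def)
      ultimately show "is_subfield {x\<in>L. \<delta> x = x}"
        using eq_on_subfield \<Gamma>_hom D(1) by blast
    qed
    finally show ?thesis .
  qed
  have FW: "F \<subseteq> W" unfolding W_def using FE D(1) \<Gamma>_fix by blast
  \<comment> \<open>On the tree, hence on \<open>M\<close>, the commutator of the two is given by
    some \<epsilon> in \<open>D\<close>, and \<epsilon> is the identity on \<open>W\<close>.\<close>
  have swap: "\<tau> (\<tau>' x) = \<tau>' (\<tau> x)" if \<tau>: "\<tau> \<in> \<Gamma>" "\<tau>' \<in> \<Gamma>" and x: "x \<in> W" for \<tau> \<tau>' x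
  proof -
    obtain \<epsilon> where \<epsilon>: "\<epsilon> \<in> D" "\<And>x. x \<in> T \<Longrightarrow> \<tau> (\<tau>' x) = \<tau>' (\<tau> (\<epsilon> x))"
      using comm[OF \<tau>] by blast
    then have \<epsilon>\<Gamma>: "\<epsilon> \<in> \<Gamma>" using D(1) by blast
    have "\<tau> (\<tau>' x) = \<tau>' (\<tau> (\<epsilon> x))"
    proof (rule eq_on_M[of "\<lambda>x. \<tau> (\<tau>' x)" "\<lambda>x. \<tau>' (\<tau> (\<epsilon> x))"])
      show "hom_on L (\<lambda>x. \<tau> (\<tau>' x))" using hom_on_comp \<tau> \<Gamma>_hom by blast
      show "hom_on L (\<lambda>x. \<tau>' (\<tau> (\<epsilon> x)))"
        using hom_on_comp[OF \<epsilon>\<Gamma> hom_on_comp[OF \<tau>(1) \<Gamma>_hom[OF \<tau>(2)]]] .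
      show "x \<in> M" using x WL by blast
      show "\<tau> (\<tau>' x) = \<tau>' (\<tau> (\<epsilon> x))" if "x \<in> F" for x
        using that \<Gamma>_fix[OF \<tau>(1)] \<Gamma>_fix[OF \<tau>(2)] \<Gamma>_fix[OF \<epsilon>\<Gamma>] by simp
    qed (use \<epsilon> in auto)
    moreover have "\<epsilon> x = x" using x \<epsilon>(1) unfolding W_def by blast
    ultimately show ?thesis by simp
  qed
  have \<Gamma>W: "\<tau> x \<in> W" if \<tau>: "\<tau> \<in> \<Gamma>" and x: "x \<in> W" for \<tau> x
  proof -
    have "\<delta> (\<tau> x) = \<tau> x" if "\<delta> \<in> D" for \<delta>
    proof -
      have "\<delta> x = x" using x that unfolding W_def by blast
      moreover have "\<delta> \<in> \<Gamma>" using that D(1) by blast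
      ultimately show ?thesis using swap[OF _ \<tau> x, of \<delta>] by simp
    qed
    then show ?thesis using \<Gamma>E[OF \<tau>] x unfolding W_def by blast
  qed
  have expo: "(\<tau> ^^ m) x = x" if \<tau>: "\<tau> \<in> \<Gamma>" and x: "x \<in> W" for \<tau> x
  proof -
    obtain \<rho> where \<rho>: "\<rho> \<in> \<Gamma>" "\<And>x. x \<in> L \<Longrightarrow> \<rho> x = (\<tau> ^^ m) x"
      using \<Gamma>_funpow[OF \<tau>] by blast
    obtain \<iota> where \<iota>: "\<iota> \<in> \<Gamma>" "\<And>x. x \<in> L \<Longrightarrow> \<iota> x = (\<tau> ^^ 0) x"
      using \<Gamma>_funpow[OF \<tau>] by blast
    have "\<forall>\<beta>\<in>B. \<rho> \<beta> = \<iota> \<beta>"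
      using \<rho>(2) \<iota>(2) BT(2) \<Gamma>_exponent[OF \<tau>] unfolding B_def m_def by auto
    then have "\<rho> x = \<iota> x"
      using x \<rho>(1) \<iota>(1) unfolding W_def by (intro ED) auto
    then show ?thesis using \<rho>(2) \<iota>(2) x WL by auto
  qed
  have fixed: "\<sigma> x = x" if x: "x \<in> W" for x
  proof (rule ccontr)
    assume neq: "\<sigma> x \<noteq> x"
    have "finite ((\<lambda>\<tau>. restrict \<tau> B) ` \<Gamma>)"
      by (rule finite_subset[OF _ finite_PiE[of B "\<lambda>_. B"]]) (use \<Gamma>B finB in auto)
    \<comment> \<open>Finitely many representatives suffice for the eigenvector: on
      \<open>B\<close>, and so on \<open>W\<close>, every automorphism agrees with one of
      them.\<close>
    then obtain G where G: "G \<subseteq> \<Gamma>" "finite G" "(\<lambda>\<tau>. restrict \<tau> B) ` \<Gamma> = (\<lambda>\<tau>. restrict \<tau> B) ` G"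
      by (meson finite_subset_image subset_refl)
    have "\<exists>y\<in>W. \<sigma> y \<noteq> y \<and> (\<forall>\<tau>\<in>G. \<exists>z. z ^ m = 1 \<and> \<tau> y = z * y)"
      by (rule eigenvector[of W m \<sigma> x G])
         (fact W FW WL(1) \<Gamma>W swap expo m \<sigma> x neq G(2) G(1))+
    then obtain y where y: "y \<in> W" "\<sigma> y \<noteq> y" "\<And>\<tau>. \<tau> \<in> G \<Longrightarrow> \<exists>z. z ^ m = 1 \<and> \<tau> y = z * y"
      by blast
    have yL: "y \<in> L" using y WL by blast
    have "\<tau> (y ^ m) = y ^ m" if \<tau>: "\<tau> \<in> \<Gamma>" for \<tau>
    proof -
      have "restrict \<tau> B \<in> (\<lambda>\<tau>. restrict \<tau> B) ` G" using G(3) \<tau> by blast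
      then obtain \<rho> where \<rho>: "\<rho> \<in> G" "restrict \<tau> B = restrict \<rho> B" by blast
      then have "\<forall>\<beta>\<in>B. \<tau> \<beta> = \<rho> \<beta>" by (metis restrict_apply')
      then have "\<tau> y = \<rho> y"
        using y(1) \<rho> G \<tau> unfolding W_def by (intro ED) auto
      then obtain z where "z ^ m = 1" "\<tau> y = z * y" using y(3) \<rho> by metis
      then show ?thesis
        using yL by (simp add: hom_on_power[OF L(1) \<Gamma>_hom[OF \<tau>]] power_mult_distrib)
    qed
    then have "y ^ m \<in> F"
      using galois_group_fixed_field[OF F(1) L FL sep subfield_power[OF L(1) yL]] by blast
    then have "y ^ (d ^ N) \<in> F" unfolding m_def .
    moreover have "y \<in> M" "N > 0" using y(1) WL unfolding N_def by auto
    ultimately have "\<sigma> y = y"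
      using radicals_fixed[OF \<sigma>] rads by blast
    then show False using y(2) by blast
  qed
  obtain \<alpha> n where \<alpha>: "B = \<alpha> ` {..<n::nat}"
    using finB by (metis finite_imp_nat_seg_image_inj_on lessThan_def)
  \<comment> \<open>At \<mu> this takes the value \<sigma> y - \<tau> y for the combination y of
    vertices defined below. Only finitely many \<open>Q \<tau>\<close> occur, so some \<mu> in the
    infinite field \<open>F\<close> is a root of none of the nonzero ones, and \<open>y\<close> then
    separates the actions on \<open>B\<close>.\<close>
  define Q where "Q \<tau> = (\<Sum>i<n. monom (\<sigma> (\<alpha> i) - \<tau> (\<alpha> i)) i)" for \<tau>
  have Qc: "coeff (Q \<tau>) i = \<sigma> (\<alpha> i) - \<tau> (\<alpha> i)" if "i < n" for \<tau> i
    using that by (simp add: Q_def coeff_sum)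
  have "finite (Q ` \<Gamma>)"
  proof -
    have "Q ` \<Gamma> \<subseteq> Q ` (PiE B (\<lambda>_. B))"
    proof
      fix q assume "q \<in> Q ` \<Gamma>"
      then obtain \<tau> where \<tau>: "\<tau> \<in> \<Gamma>" "q = Q \<tau>" by blast
      have "Q (restrict \<tau> B) = Q \<tau>"
        unfolding Q_def by (intro sum.cong refl) (use \<alpha> in auto)
      moreover have "restrict \<tau> B \<in> PiE B (\<lambda>_. B)" using \<Gamma>B[OF \<tau>(1)] by auto
      ultimately show "q \<in> Q ` (PiE B (\<lambda>_. B))" using \<tau> by (metis imageI)
    qed
    then show ?thesis using finB by (meson finite_PiE finite_imageI finite_subset)
  qed
  then have "finite (\<Union>q\<in>Q ` \<Gamma> - {0}. {x. poly q x = 0})"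
    using poly_roots_finite by blast
  then have "\<not> F \<subseteq> (\<Union>q\<in>Q ` \<Gamma> - {0}. {x. poly q x = 0})"
    using infinite_F finite_subset by blast
  then obtain \<mu> where \<mu>: "\<mu> \<in> F" "\<And>q. q \<in> Q ` \<Gamma> \<Longrightarrow> q \<noteq> 0 \<Longrightarrow> poly q \<mu> \<noteq> 0"
    by blast
  define y where "y = (\<Sum>i<n. \<alpha> i * \<mu> ^ i)"
  have \<alpha>B: "\<alpha> i \<in> B" if "i < n" for i using that \<alpha> by blast
  have yE: "y \<in> E"
    unfolding y_def using \<alpha>B BE \<mu>(1) FE
    by (intro subfield_sum[OF E] subfield_mult[OF E] subfield_power[OF E]) auto
  have \<tau>y: "\<tau> y = (\<Sum>i<n. \<tau> (\<alpha> i) * \<mu> ^ i)" if "\<tau> \<in> \<Gamma>" for \<tau>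
  proof -
    note h = \<Gamma>_hom[OF that]
    have 1: "\<alpha> i \<in> L" if "i < n" for i using \<alpha>B[OF that] BT by blast
    have 2: "\<mu> ^ i \<in> L" "\<tau> (\<mu> ^ i) = \<mu> ^ i" for i
      using \<mu>(1) FL subfield_power[OF F(1) \<mu>(1)] \<Gamma>_fix[OF that] by auto
    have "\<tau> y = (\<Sum>i<n. \<tau> (\<alpha> i * \<mu> ^ i))"
      unfolding y_def using 1 2 by (intro hom_on_sum[OF L(1) h] subfield_mult[OF L(1)]) auto
    also have "\<dots> = (\<Sum>i<n. \<tau> (\<alpha> i) * \<mu> ^ i)"
      using 1 2 by (intro sum.cong refl) (simp add: hom_on_mult[OF L(1) h])
    finally show ?thesis .
  qed
  have sep_y: "\<tau> x = \<sigma> x" if \<tau>: "\<tau> \<in> \<Gamma>" and eq: "\<sigma> y = \<tau> y" and x: "x \<in> B" for \<tau> x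
  proof -
    have "poly (Q \<tau>) \<mu> = \<sigma> y - \<tau> y"
      unfolding \<tau>y[OF \<tau>] \<tau>y[OF \<sigma>] Q_def by (simp add: poly_sum poly_monom left_diff_distrib sum_subtractf)
    then have "Q \<tau> = 0" using eq \<mu>(2) \<tau> by force
    obtain i where "i < n" "x = \<alpha> i" using x \<alpha> by blast
    then show ?thesis using Qc[of i \<tau>] \<open>Q \<tau> = 0\<close> by simp
  qed
  define Y where "Y = (\<lambda>\<tau>. \<tau> y) ` D"
  have YE: "Y \<subseteq> E" unfolding Y_def using \<Gamma>E yE D(1) by blast
  have finY: "finite Y"
  proof -
    have "Y \<subseteq> (\<lambda>g. \<Sum>i<n. g (\<alpha> i) * \<mu> ^ i) ` (PiE B (\<lambda>_. B))"
    proof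
      fix z assume "z \<in> Y"
      then obtain \<tau> where \<tau>: "\<tau> \<in> \<Gamma>" "z = \<tau> y" using D(1) by (auto simp: Y_def)
      have "z = (\<Sum>i<n. restrict \<tau> B (\<alpha> i) * \<mu> ^ i)"
        unfolding \<tau>(2) \<tau>y[OF \<tau>(1)] by (intro sum.cong refl) (use \<alpha>B in auto)
      moreover have "restrict \<tau> B \<in> PiE B (\<lambda>_. B)" using \<Gamma>B[OF \<tau>(1)] by auto
      ultimately show "z \<in> (\<lambda>g. \<Sum>i<n. g (\<alpha> i) * \<mu> ^ i) ` (PiE B (\<lambda>_. B))" by blast
    qed
    then show ?thesis using finB by (meson finite_PiE finite_imageI finite_subset)
  qed
  \<comment> \<open>The orbit polynomial of \<open>y\<close> under \<open>D\<close>. As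
    \<open>D\<close> permutes the roots, the coefficients lie in \<open>W\<close> and are fixed by
    \<sigma>.\<close>
  define P where "P = (\<Prod>z\<in>Y. [:- z, 1:])"
  have YL: "Y \<subseteq> L" using YE EM M by blast
  have PE: "poly_over E P"
    unfolding P_def using YE by (intro poly_over_intros[OF E] subfield_closed[OF E]) auto
  have lin: "poly_over L [:- z, 1:]" if "z \<in> Y" for z
    using that YL by (intro poly_over_intros[OF L(1)] subfield_closed[OF L(1)]) auto
  have PD: "map_poly \<delta> P = P" if \<delta>: "\<delta> \<in> D" for \<delta>
  proof -
    have \<delta>\<Gamma>: "\<delta> \<in> \<Gamma>" using \<delta> D by blast
    note h = \<Gamma>_hom[OF \<delta>\<Gamma>]
    have "\<delta> z \<in> Y" if "z \<in> Y" for z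
    proof -
      obtain \<tau> where \<tau>: "\<tau> \<in> D" "z = \<tau> y" using \<open>z \<in> Y\<close> by (auto simp: Y_def)
      then have \<tau>\<Gamma>: "\<tau> \<in> \<Gamma>" using D by blast
      obtain \<rho> where \<rho>: "\<rho> \<in> D" "\<And>x. x \<in> T \<Longrightarrow> \<rho> x = \<delta> (\<tau> x)" using D(3)[OF \<delta> \<tau>(1)] by blast
      then have \<rho>\<Gamma>: "\<rho> \<in> \<Gamma>" using D by blast
      have "\<rho> y = \<delta> (\<tau> y)"
        by (rule eq_on_M[OF \<Gamma>_hom[OF \<rho>\<Gamma>] hom_on_comp[OF \<tau>\<Gamma> h]])
           (use \<rho> \<Gamma>_fix[OF \<rho>\<Gamma>] \<Gamma>_fix[OF \<tau>\<Gamma>] \<Gamma>_fix[OF \<delta>\<Gamma>] yE EM in auto)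
      then show ?thesis using \<rho>(1) \<tau>(2) unfolding Y_def by (metis imageI)
    qed
    moreover have inj: "inj_on \<delta> Y"
      using YL by (auto simp: inj_on_def hom_on_eq_iff[OF L(1) h] subset_iff)
    ultimately have img: "\<delta> ` Y = Y"
      using finY by (intro endo_inj_surj) auto
    have "map_poly \<delta> P = (\<Prod>z\<in>Y. map_poly \<delta> [:- z, 1:])"
      unfolding P_def by (rule map_poly_hom_prod[OF L(1) h lin])
    also have "\<dots> = (\<Prod>z\<in>Y. [:- \<delta> z, 1:])"
      using YL by (intro prod.cong refl)
        (simp add: map_poly_pCons hom_on_0[OF L(1) h] hom_on_1[OF L(1) h] hom_on_uminus[OF L(1) h] subset_iff)
    also have "\<dots> = (\<Prod>z\<in>\<delta> ` Y. [:- z, 1:])"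
      using inj by (simp add: prod.reindex)
    finally show ?thesis unfolding img P_def .
  qed
  have cW: "coeff P i \<in> W" for i
  proof -
    have "\<delta> (coeff P i) = coeff P i" if "\<delta> \<in> D" for \<delta>
      using arg_cong[OF PD[OF that], of "\<lambda>p. coeff p i"] D(1) that
      by (simp add: coeff_map_poly hom_on_0[OF L(1) \<Gamma>_hom] subset_iff)
    then show ?thesis using PE by (simp add: W_def poly_over_def)
  qed
  note h = \<Gamma>_hom[OF \<sigma>]
  have "map_poly \<sigma> P = P"
    by (rule poly_eqI) (simp add: coeff_map_poly hom_on_0[OF L(1) h] fixed[OF cW])
  moreover have PL: "poly_over L P" using PE EM M by (auto simp: poly_over_def)
  moreover have yL: "y \<in> L" using yE EM M by blast
  moreover have "poly P y = 0"
  proof -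
    \<comment> \<open>The commutator of \<open>\<delta>0\<close> with itself supplies an element of
      \<open>D\<close> acting trivially on the tree, so \<open>y\<close> is among its own
      conjugates.\<close>
    obtain \<epsilon> where \<epsilon>: "\<epsilon> \<in> D" "\<forall>x\<in>T. \<delta>0 (\<delta>0 x) = \<delta>0 (\<delta>0 (\<epsilon> x))"
      using comm[of \<delta>0 \<delta>0] D by blast
    then have \<epsilon>\<Gamma>: "\<epsilon> \<in> \<Gamma>" "\<delta>0 \<in> \<Gamma>" using D by blast+
    have "\<epsilon> x = x" if "x \<in> T" for x
    proof -
      have "x \<in> L" "\<epsilon> x \<in> L" using that T_L \<Gamma>_L[OF \<epsilon>\<Gamma>(1)] by auto
      then show ?thesis
        using \<epsilon>(2) that hom_on_eq_iff[OF L(1) \<Gamma>_hom[OF \<epsilon>\<Gamma>(2)]] \<Gamma>_L[OF \<epsilon>\<Gamma>(2)] by metis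
    qed
    moreover have "hom_on L (\<lambda>x. x)" by (simp add: hom_on_def)
    ultimately have "\<epsilon> y = y"
      using eq_on_M[OF \<Gamma>_hom[OF \<epsilon>\<Gamma>(1)], of "\<lambda>x. x" y] \<Gamma>_fix[OF \<epsilon>\<Gamma>(1)] yE EM by auto
    then have "y \<in> Y" using \<epsilon>(1) unfolding Y_def by (metis imageI)
    then show ?thesis unfolding P_def using finY by (auto simp: poly_prod)
  qed
  ultimately have "poly P (\<sigma> y) = 0"
    using hom_on_poly[OF L(1) h PL yL] hom_on_0[OF L(1) h] by simp
  then have "\<sigma> y \<in> Y"
    unfolding P_def using finY by (auto simp: poly_prod)
  then obtain \<tau> where "\<tau> \<in> D" "\<sigma> y = \<tau> y" by (auto simp: Y_def)
  then show ?thesis using sep_y[of \<tau>] D(1) AB by blast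
qed

end

section \<open>Topological groups\<close>

text \<open>The kernel is closed and contains all commutators because the target is Hausdorff and
  abelian; together with \<open>ker\<close> this makes it the closure. A continuous surjection from
  a compact to a Hausdorff space is a quotient map, so the induced bijection is a
  homeomorphism.\<close>

lemma topgroup_abelianization_iso:
  fixes G :: "'a topgroup" and H :: "'b topgroup"
  assumes G: "group (fst G)" and H: "comm_group (fst H)"
    and tG: "topspace (snd G) = carrier (fst G)" and tH: "topspace (snd H) = carrier (fst H)"
    and cG: "compact_space (snd G)" and hH: "Hausdorff_space (snd H)"
    and hom: "\<phi> \<in> hom (fst G) (fst H)" and onto: "\<phi> ` carrier (fst G) = carrier (fst H)"
    and cont: "continuous_map (snd G) (snd H) \<phi>"
    and ker: "\<And>x. x \<in> carrier (fst G) \<Longrightarrow> \<phi> x = \<one>\<^bsub>fst H\<^esub> \<Longrightarrow>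
      x \<in> Abstract_Topology.closure_of (snd G) (derived (fst G) (carrier (fst G)))"
  shows "topgroup_iso (topgroup_abelianization G) H"
proof -
  interpret H: comm_group "fst H" by fact
  interpret G: group "fst G" by fact
  interpret gh: group_hom "fst G" "fst H" \<phi>
    by (intro group_hom.intro group_hom_axioms.intro G hom H.group_axioms)
  let ?N = "Abstract_Topology.closure_of (snd G) (derived (fst G) (carrier (fst G)))"
  let ?K = "kernel (fst G) (fst H) \<phi>"
  have "derived_set (fst G) (carrier (fst G)) \<subseteq> ?K"
    by (auto simp: kernel_def H.m_comm H.inv_mult)
       (metis H.inv_closed H.m_assoc H.m_closed H.m_comm H.r_inv H.r_one gh.hom_closed)
  then have der: "derived (fst G) (carrier (fst G)) \<subseteq> ?K"
    unfolding derived_def by (rule G.generate_subgroup_incl[OF _ gh.subgroup_kernel])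
  have "closedin (snd H) {\<one>\<^bsub>fst H\<^esub>}"
    using hH tH by (simp add: closedin_t1_singleton Hausdorff_imp_t1_space)
  then have "closedin (snd G) {x \<in> topspace (snd G). \<phi> x \<in> {\<one>\<^bsub>fst H\<^esub>}}"
    by (rule closedin_continuous_map_preimage[OF cont])
  then have "closedin (snd G) ?K"
    by (simp add: kernel_def tG)
  then have "?N \<subseteq> ?K" using der by (intro closure_of_minimal)
  moreover have "?K \<subseteq> ?N" using ker by (auto simp: kernel_def)
  ultimately have N: "?N = ?K" by blast
  let ?q = "\<lambda>x. ?K #>\<^bsub>fst G\<^esub> x"
  let ?\<psi> = "\<lambda>Z. the_elem (\<phi> ` Z)"
  have iso: "?\<psi> \<in> iso (fst G Mod ?K) (fst H)"
    by (rule gh.FactGroup_iso_set[OF onto])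
  have \<psi>q: "?\<psi> (?q x) = \<phi> x" if x: "x \<in> carrier (fst G)" for x
  proof -
    have "\<phi> ` ?q x = {\<phi> x}"
    proof
      show "\<phi> ` ?q x \<subseteq> {\<phi> x}" using x by (auto simp: r_coset_def kernel_def)
      have "x \<in> ?q x" using x by (auto simp: r_coset_def kernel_def intro!: exI[of _ "\<one>\<^bsub>fst G\<^esub>"])
      then show "{\<phi> x} \<subseteq> \<phi> ` ?q x" by blast
    qed
    then show ?thesis by simp
  qed
  let ?T = "final_topology (snd G) ?q"
  have qm: "quotient_map (snd G) ?T ?q" by (rule quotient_map_final_topology)
  have "quotient_map (snd G) (snd H) \<phi>"
    by (rule continuous_imp_quotient_map[OF cont cG hH]) (simp add: tG tH onto)
  then have qm2: "quotient_map (snd G) (snd H) (?\<psi> \<circ> ?q)"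
    by (rule quotient_map_eq) (simp add: tG \<psi>q)
  have cont\<psi>: "continuous_map ?T (snd H) ?\<psi>"
    by (rule continuous_compose_quotient_map[OF qm quotient_imp_continuous_map[OF qm2]])
  have "quotient_map ?T (snd H) ?\<psi>"
    by (rule quotient_map_from_composition[OF quotient_imp_continuous_map[OF qm] cont\<psi> qm2])
  moreover have "inj_on ?\<psi> (topspace ?T)"
  proof -
    have "topspace ?T = carrier (fst G Mod ?K)"
      by (auto simp: topspace_final_topology tG FactGroup_def RCOSETS_def)
    then show ?thesis using iso by (simp add: iso_def bij_betw_def)
  qed
  ultimately have "homeomorphic_map ?T (snd H) ?\<psi>"
    by (simp add: homeomorphic_map_def)
  then show ?thesis
    unfolding topgroup_iso_def topgroup_abelianization_def topgroup_quotient_def N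
    using iso by auto
qed

text \<open>Basic open sets constrain finitely many coordinates, and over discrete factors each
  constraint can be shrunk to one value.\<close>

lemma openin_product_discrete:
  "openin (product_topology (\<lambda>i. discrete_topology (R i)) I) U \<longleftrightarrow>
     U \<subseteq> PiE I R \<and>
     (\<forall>g\<in>U. \<exists>A. finite A \<and> A \<subseteq> I \<and> (\<forall>h\<in>PiE I R. (\<forall>x\<in>A. h x = g x) \<longrightarrow> h \<in> U))"
  (is "?l \<longleftrightarrow> ?r")
proof
  assume l: ?l
  then have "U \<subseteq> PiE I R"
    using openin_subset by fastforce
  moreover have "\<exists>A. finite A \<and> A \<subseteq> I \<and> (\<forall>h\<in>PiE I R. (\<forall>x\<in>A. h x = g x) \<longrightarrow> h \<in> U)" if g: "g \<in> U" for g
  proof -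
    obtain V where V: "finite {i \<in> I. V i \<noteq> R i}" "g \<in> PiE I V" "PiE I V \<subseteq> U"
      using l g unfolding openin_product_topology_alt by auto
    have "h \<in> U" if h: "h \<in> PiE I R" "\<forall>x\<in>{i \<in> I. V i \<noteq> R i}. h x = g x" for h
    proof -
      have "h \<in> PiE I V"
      proof (rule PiE_I)
        fix i assume "i \<in> I"
        then show "h i \<in> V i"
          using h V(2) by (cases "V i = R i") (auto simp: PiE_iff)
      qed (rule PiE_arb[OF h(1)])
      then show ?thesis using V(3) by blast
    qed
    then show ?thesis
      using V(1) by (intro exI[of _ "{i \<in> I. V i \<noteq> R i}"]) auto
  qed
  ultimately show ?r by blast
next
  assume r: ?r
  show ?l
    unfolding openin_product_topology_alt
  proof
    fix g assume g: "g \<in> U"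
    obtain A where A: "finite A" "A \<subseteq> I" "\<And>h. h \<in> PiE I R \<Longrightarrow> \<forall>x\<in>A. h x = g x \<Longrightarrow> h \<in> U"
      using bspec[OF conjunct2[OF r] g] by auto
    define V where "V i = (if i \<in> A then {g i} else R i)" for i
    have gR: "g \<in> PiE I R" using r g by blast
    have "{i \<in> I. V i \<noteq> topspace (discrete_topology (R i))} \<subseteq> A"
      by (auto simp: V_def)
    then have "finite {i \<in> I. V i \<noteq> topspace (discrete_topology (R i))}"
      using A(1) finite_subset by blast
    moreover have "\<forall>i\<in>I. openin (discrete_topology (R i)) (V i)"
      using gR by (auto simp: V_def PiE_iff)
    moreover have "g \<in> PiE I V" using gR by (auto simp: V_def PiE_iff)
    moreover have "PiE I V \<subseteq> U"
    proof
      fix h assume h: "h \<in> PiE I V"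
      show "h \<in> U"
      proof (rule A(3))
        show "h \<in> PiE I R" using h gR A(2) by (auto simp: V_def PiE_iff split: if_splits)
        show "\<forall>x\<in>A. h x = g x" using h A(2) by (force simp: V_def PiE_iff)
      qed
    qed
    ultimately show "\<exists>V. finite {i \<in> I. V i \<noteq> topspace (discrete_topology (R i))} \<and>
        (\<forall>i\<in>I. openin (discrete_topology (R i)) (V i)) \<and> g \<in> PiE I V \<and> PiE I V \<subseteq> U"
      by blast
  qed
qed

lemma closedin_product_discrete:
  assumes "C \<subseteq> PiE I R"
    and "\<And>g. g \<in> PiE I R \<Longrightarrow> g \<notin> C \<Longrightarrow>
      \<exists>A. finite A \<and> A \<subseteq> I \<and> (\<forall>h\<in>C. \<not> (\<forall>x\<in>A. h x = g x))"
  shows "closedin (product_topology (\<lambda>i. discrete_topology (R i)) I) C"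
  unfolding closedin_def openin_product_discrete
  using assms by (auto simp: topspace_product_topology) metis

section \<open>Compactness of Galois groups\<close>

text \<open>
  A Galois group is closed in the product, over \<open>x\<close>, of the finite sets of conjugates of \<open>x\<close>.
\<close>

lemma galois_group_compact:
  assumes F: "is_subfield F" and L: "is_subfield L" "F \<subseteq> L" and alg: "\<And>x. x \<in> L \<Longrightarrow> algebraic_elem F x"
  obtains R where "\<And>x. x \<in> L \<Longrightarrow> finite (R x)"
    "galois_group L F \<subseteq> PiE L R"
    "compactin (product_topology (\<lambda>x. discrete_topology (R x)) L) (galois_group L F)"
proof -
  have "\<exists>p. poly_over F p \<and> p \<noteq> 0 \<and> poly p x = 0" if "x \<in> L" for x
    using alg[OF that] by (auto simp: algebraic_elem_def)
  then obtain p where p: "\<And>x. x \<in> L \<Longrightarrow> poly_over F (p x) \<and> p x \<noteq> 0 \<and> poly (p x) x = 0"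
    by metis
  define R where "R x = {y\<in>L. poly (p x) y = 0}" for x
  let ?X = "product_topology (\<lambda>x. discrete_topology (R x)) L"
  let ?\<Gamma> = "galois_group L F"
  have fin: "finite (R x)" if "x \<in> L" for x
    unfolding R_def using p[OF that] poly_roots_finite[of "p x"] by (auto intro: finite_subset)
  have \<Gamma>R: "?\<Gamma> \<subseteq> PiE L R"
  proof
    fix \<sigma> assume \<sigma>: "\<sigma> \<in> ?\<Gamma>"
    note h = galois_group_hom[OF F \<sigma>]
    show "\<sigma> \<in> PiE L R"
    proof (rule PiE_I)
      fix x assume x: "x \<in> L"
      have "poly_over L (p x)" using p[OF x] L(2) by (auto simp: poly_over_def)
      then have "poly (map_poly \<sigma> (p x)) (\<sigma> x) = 0"
        using hom_on_poly[OF L(1) h(1) _ x] p[OF x] hom_on_0[OF L(1) h(1)] by metis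
      moreover have "map_poly \<sigma> (p x) = p x"
        using p[OF x] h(3) hom_on_0[OF L(1) h(1)] by (intro poly_eqI) (simp add: coeff_map_poly poly_over_def)
      ultimately show "\<sigma> x \<in> R x" using h(2)[OF x] by (simp add: R_def)
    qed (use h(4) in \<open>auto simp: extensional_def\<close>)
  qed
  have "closedin ?X ?\<Gamma>"
  proof (rule closedin_product_discrete[OF \<Gamma>R])
    fix g assume g: "g \<in> PiE L R" "g \<notin> ?\<Gamma>"
    have gL: "g x \<in> L" if "x \<in> L" for x using g that by (auto simp: PiE_iff R_def)
    have gext: "g \<in> extensional L" using g by (simp add: PiE_iff)
    \<comment> \<open>Failure to be an automorphism over \<open>F\<close> is witnessed on at most
      three points, hence is an open condition.\<close>
    consider (one) "g 1 \<noteq> 1" | (add) x y where "x \<in> L" "y \<in> L" "g (x + y) \<noteq> g x + g y"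
      | (mult) x y where "x \<in> L" "y \<in> L" "g (x * y) \<noteq> g x * g y" | (fixp) x where "x \<in> F" "g x \<noteq> x"
    proof -
      have "hom_on L g \<and> (\<forall>x\<in>F. g x = x) \<longrightarrow> g \<in> ?\<Gamma>"
        using galois_groupI[OF L alg, of g] gL gext by blast
      then show thesis using that g(2) unfolding hom_on_def by blast
    qed
    then show "\<exists>A. finite A \<and> A \<subseteq> L \<and> (\<forall>h\<in>?\<Gamma>. \<not> (\<forall>x\<in>A. h x = g x))"
    proof cases
      case one
      then show ?thesis
        using hom_on_1[OF L(1) galois_group_hom(1)[OF F]] subfield_1[OF L(1)]
        by (intro exI[of _ "{1}"] conjI ballI) (simp_all, metis)
    next
      case add
      have "h (x + y) = h x + h y" if "h \<in> ?\<Gamma>" for h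
        using hom_on_add[OF L(1) galois_group_hom(1)[OF F that] add(1,2)] .
      moreover have "finite {x, y, x + y}" "{x, y, x + y} \<subseteq> L"
        using add subfield_add[OF L(1) add(1,2)] by auto
      ultimately show ?thesis
        using add(3) by (metis insertCI)
    next
      case mult
      have "h (x * y) = h x * h y" if "h \<in> ?\<Gamma>" for h
        using hom_on_mult[OF L(1) galois_group_hom(1)[OF F that] mult(1,2)] .
      moreover have "finite {x, y, x * y}" "{x, y, x * y} \<subseteq> L"
        using mult subfield_mult[OF L(1) mult(1,2)] by auto
      ultimately show ?thesis
        using mult(3) by (metis insertCI)
    next
      case fixp
      have "h x = x" if "h \<in> ?\<Gamma>" for h
        using galois_group_hom(3)[OF F that fixp(1)] .
      then show ?thesis
        using fixp L(2) by (intro exI[of _ "{x}"] conjI ballI) (auto, metis)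
    qed
  qed
  moreover have "compact_space ?X"
    using fin by (simp add: compact_space_product_topology compact_space_discrete_topology)
  ultimately have "compactin ?X ?\<Gamma>" by (intro closedin_compact_space)
  then show thesis using that fin \<Gamma>R by blast
qed

text \<open>Prescribing one value is a closed condition, so compactness turns finite solvability
  into simultaneous solvability.\<close>

lemma galois_group_finite_intersection:
  assumes F: "is_subfield F" and L: "is_subfield L" "F \<subseteq> L" and alg: "\<And>x. x \<in> L \<Longrightarrow> algebraic_elem F x"
    and w: "\<And>j. j \<in> J \<Longrightarrow> w j \<in> L"
    and fin: "\<And>J0. finite J0 \<Longrightarrow> J0 \<subseteq> J \<Longrightarrow> \<exists>\<sigma>\<in>galois_group L F. \<forall>j\<in>J0. \<sigma> (w j) = v j"
  shows "\<exists>\<sigma>\<in>galois_group L F. \<forall>j\<in>J. \<sigma> (w j) = v j"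
proof -
  obtain R where R: "galois_group L F \<subseteq> PiE L R"
    "compactin (product_topology (\<lambda>x. discrete_topology (R x)) L) (galois_group L F)"
    using galois_group_compact[OF F L alg] by metis
  let ?X = "product_topology (\<lambda>x. discrete_topology (R x)) L"
  define C where "C j = {g \<in> PiE L R. g (w j) = v j}" for j
  have cl: "closedin ?X (C j)" if "j \<in> J" for j
    by (rule closedin_product_discrete) (use w[OF that] in \<open>auto simp: C_def intro!: exI[of _ "{w j}"]\<close>)
  have "galois_group L F \<inter> \<Inter>(C ` J) \<noteq> {}"
  proof -
    have "galois_group L F \<inter> \<Inter>\<F> \<noteq> {}" if \<F>: "finite \<F>" "\<F> \<subseteq> C ` J" for \<F>
    proof -
      obtain J0 where J0: "J0 \<subseteq> J" "finite J0" "\<F> = C ` J0"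
        using finite_subset_image[OF \<F>] by blast
      obtain \<sigma> where \<sigma>: "\<sigma> \<in> galois_group L F" "\<forall>j\<in>J0. \<sigma> (w j) = v j"
        using fin[OF J0(2,1)] by blast
      then have "\<sigma> \<in> galois_group L F \<inter> \<Inter>\<F>"
        using R(1) unfolding J0(3) C_def by blast
      then show ?thesis by blast
    qed
    then show ?thesis
      using R(2) cl unfolding compactin_fip by (metis (no_types, lifting) imageE)
  qed
  then show ?thesis unfolding C_def by blast
qed

context unicritical
begin

section \<open>The arboreal group as a topological group\<close>

text \<open>This is \<open>geometric_Arb\<close> once \<open>k\<close> is the separable closure of
  \<open>K\<close> in \<open>L\<close>.\<close>

definition arb :: "('l \<Rightarrow> 'l) topgroup" where
  "arb = topgroup_sub (tree_Aut L t f) ((\<lambda>\<sigma>. restrict \<sigma> T) ` \<Gamma>)"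

abbreviation "res \<equiv> \<lambda>\<sigma>. restrict \<sigma> T"

lemma \<Gamma>_comp:
  assumes "\<sigma> \<in> \<Gamma>" "\<tau> \<in> \<Gamma>"
  shows "compose L \<sigma> \<tau> \<in> \<Gamma>"
proof (rule galois_groupI[OF L(1) FL alg_L])
  show "hom_on L (compose L \<sigma> \<tau>)"
    using hom_on_comp[OF assms(2) \<Gamma>_hom[OF assms(1)]]
    by (auto simp: hom_on_def compose_def subfield_closed[OF L(1)])
  show "compose L \<sigma> \<tau> x = x" if "x \<in> F" for x
    using that FL \<Gamma>_fix[OF assms(1)] \<Gamma>_fix[OF assms(2)] by (auto simp: compose_def)
qed (use \<Gamma>_L assms in \<open>auto simp: compose_def\<close>)

lemma \<Gamma>_id: "(\<lambda>x\<in>L. x) \<in> \<Gamma>"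
  by (rule galois_groupI[OF L(1) FL alg_L]) (use FL in \<open>auto simp: hom_on_def subfield_closed[OF L(1)]\<close>)

lemma \<Gamma>_inv:
  assumes "\<sigma> \<in> \<Gamma>"
  obtains \<sigma>' where "\<sigma>' \<in> \<Gamma>" "\<And>x. x \<in> L \<Longrightarrow> \<sigma>' (\<sigma> x) = x" "\<And>x. x \<in> L \<Longrightarrow> \<sigma> (\<sigma>' x) = x"
proof -
  note h = galois_group_hom[OF F(1) assms]
  define \<sigma>' where "\<sigma>' = restrict (inv_into L \<sigma>) L"
  have 1: "\<sigma>' x \<in> L" "\<sigma> (\<sigma>' x) = x" if "x \<in> L" for x
    using h(5) that by (auto simp: \<sigma>'_def bij_betw_def inv_into_into f_inv_into_f)
  have 2: "\<sigma>' (\<sigma> x) = x" if "x \<in> L" for x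
    using h(5) that h(2)[OF that] by (auto simp: \<sigma>'_def bij_betw_def)
  have "\<sigma>' \<in> \<Gamma>"
  proof (rule galois_groupI[OF L(1) FL alg_L])
    have "\<sigma>' 1 = 1" using 2[OF subfield_1[OF L(1)]] hom_on_1[OF L(1) h(1)] by simp
    moreover have "\<sigma>' (x + y) = \<sigma>' x + \<sigma>' y" "\<sigma>' (x * y) = \<sigma>' x * \<sigma>' y" if "x \<in> L" "y \<in> L" for x y
    proof -
      have "\<sigma> (\<sigma>' x + \<sigma>' y) = x + y" "\<sigma> (\<sigma>' x * \<sigma>' y) = x * y"
        using that 1 by (simp_all add: hom_on_add[OF L(1) h(1)] hom_on_mult[OF L(1) h(1)])
      then show "\<sigma>' (x + y) = \<sigma>' x + \<sigma>' y" "\<sigma>' (x * y) = \<sigma>' x * \<sigma>' y"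
        using 2[of "\<sigma>' x + \<sigma>' y"] 2[of "\<sigma>' x * \<sigma>' y"] that 1 subfield_closed[OF L(1)] by auto
    qed
    ultimately show "hom_on L \<sigma>'" by (simp add: hom_on_def)
    show "\<sigma>' x = x" if "x \<in> F" for x
      using 2[of x] that FL \<Gamma>_fix[OF assms that] by auto
  qed (use 1 in \<open>auto simp: \<sigma>'_def\<close>)
  then show thesis using that 1 2 by blast
qed

lemma res_Bij: "\<sigma> \<in> \<Gamma> \<Longrightarrow> res \<sigma> \<in> Bij T" "\<sigma> \<in> \<Gamma> \<Longrightarrow> res \<sigma> \<in> tree_automorphisms L t f"
proof -
  assume \<sigma>: "\<sigma> \<in> \<Gamma>"
  show "res \<sigma> \<in> tree_automorphisms L t f"
    using restrict_galois_tree_automorphism[OF \<sigma> F(3) FL, of f] f_L \<Gamma>_f[OF \<sigma>] by blast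
  then show "res \<sigma> \<in> Bij T"
    by (simp add: tree_automorphisms_def)
qed

lemma fst_arb: "fst arb = (BijGroup T)\<lparr>carrier := res ` \<Gamma>\<rparr>"
  by (simp add: arb_def topgroup_sub_def tree_Aut_def)

lemma snd_arb: "snd arb = subtopology (product_topology (\<lambda>_. discrete_topology T) T) (res ` \<Gamma>)"
proof -
  have "tree_automorphisms L t f \<inter> res ` \<Gamma> = res ` \<Gamma>"
    using res_Bij(2) by blast
  then show ?thesis
    by (simp add: arb_def topgroup_sub_def tree_Aut_def subtopology_subtopology)
qed

lemma res_PiE: "\<sigma> \<in> \<Gamma> \<Longrightarrow> res \<sigma> \<in> PiE T (\<lambda>_. T)"
  using \<Gamma>_T by auto

lemma carrier_arb: "carrier (fst arb) = res ` \<Gamma>"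
  by (simp add: fst_arb)

lemma topspace_arb: "topspace (snd arb) = res ` \<Gamma>"
proof -
  have "res ` \<Gamma> \<subseteq> PiE T (\<lambda>_. T)" using res_PiE by blast
  then show ?thesis
    by (simp only: snd_arb topspace_subtopology topspace_product_topology topspace_discrete_topology inf_absorb2)
qed

lemma mult_arb:
  assumes "\<sigma> \<in> \<Gamma>" "\<tau> \<in> \<Gamma>"
  shows "res \<sigma> \<otimes>\<^bsub>fst arb\<^esub> res \<tau> = res (compose L \<sigma> \<tau>)"
proof -
  have "res \<sigma> \<otimes>\<^bsub>fst arb\<^esub> res \<tau> = compose T (res \<sigma>) (res \<tau>)"
    using res_Bij(1) assms by (simp add: fst_arb BijGroup_def)
  also have "\<dots> = res (compose L \<sigma> \<tau>)"
    using \<Gamma>_T[OF assms(2)] T_L by (auto simp: compose_def restrict_def fun_eq_iff)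
  finally show ?thesis .
qed

lemma group_arb: "group (fst arb)"
proof -
  interpret B: group "BijGroup T" by (rule group_BijGroup)
  have carrB: "carrier (BijGroup T) = Bij T" by (simp add: BijGroup_def)
  have mB: "res \<sigma> \<otimes>\<^bsub>BijGroup T\<^esub> res \<tau> = res (compose L \<sigma> \<tau>)" if "\<sigma> \<in> \<Gamma>" "\<tau> \<in> \<Gamma>" for \<sigma> \<tau>
    using mult_arb[OF that] by (simp add: fst_arb)
  have "subgroup (res ` \<Gamma>) (BijGroup T)"
  proof (rule B.subgroupI)
    show "res ` \<Gamma> \<subseteq> carrier (BijGroup T)" using res_Bij carrB by auto
    show "res ` \<Gamma> \<noteq> {}" using \<Gamma>_id by blast
    fix g assume "g \<in> res ` \<Gamma>"
    then obtain \<sigma> where \<sigma>: "\<sigma> \<in> \<Gamma>" "g = res \<sigma>" by blast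
    obtain \<sigma>' where \<sigma>': "\<sigma>' \<in> \<Gamma>" "\<And>x. x \<in> L \<Longrightarrow> \<sigma>' (\<sigma> x) = x" using \<Gamma>_inv[OF \<sigma>(1)] by blast
    have "res (compose L \<sigma>' \<sigma>) = \<one>\<^bsub>BijGroup T\<^esub>"
      using \<sigma>'(2) T_L by (auto simp: BijGroup_def compose_def restrict_def fun_eq_iff)
    then have "res \<sigma>' \<otimes>\<^bsub>BijGroup T\<^esub> g = \<one>\<^bsub>BijGroup T\<^esub>"
      using mB[OF \<sigma>'(1) \<sigma>(1)] \<sigma>(2) by simp
    then have "inv\<^bsub>BijGroup T\<^esub> g = res \<sigma>'"
      using res_Bij(1) \<sigma> \<sigma>'(1) carrB by (intro B.inv_equality) auto
    then show "inv\<^bsub>BijGroup T\<^esub> g \<in> res ` \<Gamma>" using \<sigma>'(1) by blast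
    fix h assume "h \<in> res ` \<Gamma>"
    then obtain \<tau> where \<tau>: "\<tau> \<in> \<Gamma>" "h = res \<tau>" by blast
    show "g \<otimes>\<^bsub>BijGroup T\<^esub> h \<in> res ` \<Gamma>"
      using mB[OF \<sigma>(1) \<tau>(1)] \<Gamma>_comp[OF \<sigma>(1) \<tau>(1)] \<sigma>(2) \<tau>(2) by blast
  qed
  then show ?thesis
    unfolding fst_arb by (rule subgroup.subgroup_is_group) (rule B.group_axioms)
qed

lemma openin_arbI:
  assumes "U \<subseteq> res ` \<Gamma>"
    and "\<And>g. g \<in> U \<Longrightarrow> \<exists>A. finite A \<and> A \<subseteq> T \<and> (\<forall>\<sigma>\<in>\<Gamma>. (\<forall>x\<in>A. \<sigma> x = g x) \<longrightarrow> res \<sigma> \<in> U)"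
  shows "openin (snd arb) U"
proof -
  obtain A where A: "\<And>g. g \<in> U \<Longrightarrow> finite (A g) \<and> A g \<subseteq> T \<and> (\<forall>\<sigma>\<in>\<Gamma>. (\<forall>x\<in>A g. \<sigma> x = g x) \<longrightarrow> res \<sigma> \<in> U)"
    using assms(2) by metis
  define V where "V = (\<Union>g\<in>U. {h \<in> PiE T (\<lambda>_. T). \<forall>x\<in>A g. h x = g x})"
  have "openin (product_topology (\<lambda>_. discrete_topology T) T) V"
    unfolding V_def
  proof (intro openin_Union ballI)
    fix W assume "W \<in> (\<lambda>g. {h \<in> PiE T (\<lambda>_. T). \<forall>x\<in>A g. h x = g x}) ` U"
    then obtain g where g: "g \<in> U" "W = {h \<in> PiE T (\<lambda>_. T). \<forall>x\<in>A g. h x = g x}" by blast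
    show "openin (product_topology (\<lambda>_. discrete_topology T) T) W"
      unfolding openin_product_discrete g(2) using A[OF g(1)] by (auto intro!: exI[of _ "A g"])
  qed
  moreover have "U = V \<inter> res ` \<Gamma>"
  proof
    show "U \<subseteq> V \<inter> res ` \<Gamma>"
      using assms(1) res_PiE by (fastforce simp: V_def)
    show "V \<inter> res ` \<Gamma> \<subseteq> U"
    proof
      fix h assume h: "h \<in> V \<inter> res ` \<Gamma>"
      then obtain \<sigma> g where \<sigma>: "\<sigma> \<in> \<Gamma>" "h = res \<sigma>" "g \<in> U" "\<forall>x\<in>A g. h x = g x"
        by (auto simp: V_def)
      have "\<sigma> x = g x" if "x \<in> A g" for x
        using \<sigma>(2,4) that A[OF \<sigma>(3)] by (metis restrict_apply' subsetD)
      then show "h \<in> U" using A[OF \<sigma>(3)] \<sigma> by blast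
    qed
  qed
  ultimately show ?thesis
    unfolding snd_arb openin_subtopology by blast
qed

lemma openin_arbD:
  assumes "openin (snd arb) U" "g \<in> U"
  obtains A where "finite A" "A \<subseteq> T" "\<And>\<sigma>. \<sigma> \<in> \<Gamma> \<Longrightarrow> \<forall>x\<in>A. \<sigma> x = g x \<Longrightarrow> res \<sigma> \<in> U"
proof -
  obtain V where V: "openin (product_topology (\<lambda>_. discrete_topology T) T) V" "U = V \<inter> res ` \<Gamma>"
    using assms(1) unfolding snd_arb openin_subtopology by blast
  have "g \<in> V" using V(2) assms(2) by blast
  then obtain A where A: "finite A" "A \<subseteq> T" "\<forall>h\<in>PiE T (\<lambda>_. T). (\<forall>x\<in>A. h x = g x) \<longrightarrow> h \<in> V"
    using V(1) unfolding openin_product_discrete by blast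
  have "res \<sigma> \<in> U" if "\<sigma> \<in> \<Gamma>" "\<forall>x\<in>A. \<sigma> x = g x" for \<sigma>
  proof -
    have "\<forall>x\<in>A. res \<sigma> x = g x" using that A(2) by auto
    then have "res \<sigma> \<in> V" using A(3) res_PiE[OF that(1)] by blast
    then show ?thesis using V(2) that by blast
  qed
  then show thesis using that A(1,2) by blast
qed

text \<open>The group is the image of the compact Galois group under restriction to the tree, which
  is continuous because its coordinates are projections.\<close>

lemma compact_arb: "compact_space (snd arb)"
proof -
  obtain R where R: "galois_group L F \<subseteq> PiE L R"
    "compactin (product_topology (\<lambda>x. discrete_topology (R x)) L) (galois_group L F)"
    using galois_group_compact[OF F(1) L(1) FL alg_L] by metis
  let ?P = "product_topology (\<lambda>x. discrete_topology (R x)) L"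
  let ?X = "subtopology ?P \<Gamma>"
  have tX: "topspace ?X = \<Gamma>" using R(1) by auto
  have "continuous_map ?X (product_topology (\<lambda>_. discrete_topology T) T) res"
    unfolding continuous_map_componentwise
  proof (intro conjI ballI)
    fix x assume x: "x \<in> T"
    then have xL: "x \<in> L" using T_L by blast
    have proj: "continuous_map ?X (discrete_topology (R x)) (\<lambda>\<sigma>. \<sigma> x)"
      using continuous_map_from_subtopology[OF continuous_map_product_projection[OF xL, of "\<lambda>x. discrete_topology (R x)"]] .
    show "continuous_map ?X (discrete_topology T) (\<lambda>\<sigma>. res \<sigma> x)"
      unfolding continuous_map
    proof (intro conjI allI impI)
      show "(\<lambda>\<sigma>. res \<sigma> x) ` topspace ?X \<subseteq> topspace (discrete_topology T)"
        unfolding tX using \<Gamma>_T x by auto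
      fix U assume "openin (discrete_topology T) U"
      have "openin ?X {\<sigma> \<in> topspace ?X. \<sigma> x \<in> U \<inter> R x}"
        by (rule openin_continuous_map_preimage[OF proj]) simp
      moreover have "{\<sigma> \<in> topspace ?X. \<sigma> x \<in> U \<inter> R x} = {\<sigma> \<in> topspace ?X. res \<sigma> x \<in> U}"
        using x xL R(1) unfolding tX by auto
      ultimately show "openin ?X {\<sigma> \<in> topspace ?X. res \<sigma> x \<in> U}" by simp
    qed
  qed auto
  then have "compactin (product_topology (\<lambda>_. discrete_topology T) T) (res ` \<Gamma>)"
    using R(2) image_compactin[of ?X \<Gamma>] by (simp add: compactin_subtopology)
  then show ?thesis
    unfolding snd_arb by (simp add: compact_space_subtopology)
qed

lemma eq_T_imp_eq_M:
  assumes "\<sigma> \<in> \<Gamma>" "\<tau> \<in> \<Gamma>" "\<And>x. x \<in> T \<Longrightarrow> \<sigma> x = \<tau> x" "y \<in> M"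
  shows "\<sigma> y = \<tau> y"
  using eq_on_M[OF \<Gamma>_hom[OF assms(1)] \<Gamma>_hom[OF assms(2)]] \<Gamma>_fix[OF assms(1)] \<Gamma>_fix[OF assms(2)] assms(3,4)
  by auto

text \<open>Elements whose image depends on finitely many vertices form a subfield containing
  \<open>F\<close> and \<open>T\<close>. Applied to radicals, this gives continuity of the Kummer
  coordinates.\<close>

lemma M_finitely_determined:
  assumes "y \<in> M"
  obtains A where "finite A" "A \<subseteq> T"
    "\<And>\<sigma> \<tau>. \<sigma> \<in> \<Gamma> \<Longrightarrow> \<tau> \<in> \<Gamma> \<Longrightarrow> \<forall>x\<in>A. \<sigma> x = \<tau> x \<Longrightarrow> \<sigma> y = \<tau> y"
proof -
  define P where "P A y \<longleftrightarrow> finite A \<and> A \<subseteq> T \<and> (\<forall>\<sigma>\<in>\<Gamma>. \<forall>\<tau>\<in>\<Gamma>. (\<forall>x\<in>A. \<sigma> x = \<tau> x) \<longrightarrow> \<sigma> y = \<tau> y)"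
    for A y
  let ?E = "{y\<in>L. \<exists>A. P A y}"
  have "is_subfield ?E"
    unfolding is_subfield_iff
  proof (intro conjI ballI)
    have "P {} 1"
      unfolding P_def using hom_on_1[OF L(1) \<Gamma>_hom] by (simp, metis)
    then show "1 \<in> ?E"
      using subfield_1[OF L(1)] by blast
    fix x y assume "x \<in> ?E" "y \<in> ?E"
    then obtain A B where AB: "P A x" "P B y" "x \<in> L" "y \<in> L" by blast
    have fin: "finite (A \<union> B)" "A \<union> B \<subseteq> T" using AB by (auto simp: P_def)
    have agree: "\<sigma> x = \<tau> x \<and> \<sigma> y = \<tau> y" if "\<sigma> \<in> \<Gamma>" "\<tau> \<in> \<Gamma>" "\<forall>z\<in>A \<union> B. \<sigma> z = \<tau> z" for \<sigma> \<tau>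
      using AB(1,2) that unfolding P_def by blast
    have "\<sigma> (x - y) = \<tau> (x - y) \<and> \<sigma> (x * y) = \<tau> (x * y)"
      if st: "\<sigma> \<in> \<Gamma>" "\<tau> \<in> \<Gamma>" "\<forall>z\<in>A \<union> B. \<sigma> z = \<tau> z" for \<sigma> \<tau>
      using agree[OF st] AB(3,4)
      by (simp add: hom_on_diff[OF L(1) \<Gamma>_hom[OF st(1)]] hom_on_mult[OF L(1) \<Gamma>_hom[OF st(1)]]
          hom_on_diff[OF L(1) \<Gamma>_hom[OF st(2)]] hom_on_mult[OF L(1) \<Gamma>_hom[OF st(2)]])
    then have "P (A \<union> B) (x - y)" "P (A \<union> B) (x * y)"
      unfolding P_def using fin by blast+
    then show "x - y \<in> ?E" "x * y \<in> ?E"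
      using AB(3,4) subfield_diff[OF L(1)] subfield_mult[OF L(1)] by blast+
  next
    fix x assume "x \<in> ?E"
    then obtain A where A: "P A x" "x \<in> L" by blast
    have "P A (inverse x)"
      unfolding P_def
    proof (intro conjI ballI impI)
      fix \<sigma> \<tau> assume st: "\<sigma> \<in> \<Gamma>" "\<tau> \<in> \<Gamma>" "\<forall>z\<in>A. \<sigma> z = \<tau> z"
      then have "\<sigma> x = \<tau> x" using A(1) unfolding P_def by blast
      then show "\<sigma> (inverse x) = \<tau> (inverse x)"
        using A(2) st by (simp add: hom_on_inverse[OF L(1) \<Gamma>_hom])
    qed (use A in \<open>auto simp: P_def\<close>)
    then show "inverse x \<in> ?E" using A(2) subfield_inverse[OF L(1)] by blast
  qed
  moreover have "F \<union> T \<subseteq> ?E"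
  proof
    fix x assume x: "x \<in> F \<union> T"
    then consider "x \<in> F" | "x \<in> T" by blast
    then show "x \<in> ?E"
    proof cases
      case 1
      then have "P {} x" unfolding P_def by (metis \<Gamma>_fix[OF _ 1] empty_subsetI finite.emptyI)
      then show ?thesis using 1 FL by blast
    next
      case 2
      then have "P {x} x" unfolding P_def by blast
      then show ?thesis using 2 T_L by blast
    qed
  qed
  ultimately have "M \<subseteq> ?E" unfolding M_def by (rule generate_field_least)
  then obtain A where "P A y" using assms by blast
  then show thesis using that unfolding P_def by blast
qed

text \<open>A neighbourhood of \<open>res \<sigma>\<close> prescribes finitely many vertices, so
  membership in the closure is the density on finite sets of vertices, applied to the lifts of the
  derived subgroup.\<close>

lemma radicals_fixed_imp_closure_derived:
  assumes \<sigma>: "\<sigma> \<in> \<Gamma>"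
    and rads: "\<And>c n w. c \<in> S \<Longrightarrow> w \<in> L \<Longrightarrow> w ^ rad n = t - c \<Longrightarrow> \<sigma> w = w"
  shows "res \<sigma> \<in> Abstract_Topology.closure_of (snd arb) (derived (fst arb) (carrier (fst arb)))"
proof -
  interpret G: group "fst arb" by (rule group_arb)
  let ?D = "derived (fst arb) (carrier (fst arb))"
  define D where "D = {\<tau> \<in> \<Gamma>. res \<tau> \<in> ?D}"
  have sub: "subgroup ?D (fst arb)" by (rule G.derived_is_subgroup) simp
  have resT: "\<tau> x = \<rho> x" if "res \<tau> = res \<rho>" "x \<in> T" for \<tau> \<rho> x
    using that by (metis restrict_apply')
  have D1: "D \<subseteq> \<Gamma>" by (auto simp: D_def)
  have D3: "\<exists>\<delta>''\<in>D. \<forall>x\<in>T. \<delta>'' x = \<delta> (\<delta>' x)" if "\<delta> \<in> D" "\<delta>' \<in> D" for \<delta> \<delta>'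
  proof (intro bexI[of _ "compose L \<delta> \<delta>'"] ballI)
    show "compose L \<delta> \<delta>' x = \<delta> (\<delta>' x)" if "x \<in> T" for x using that T_L by (auto simp: compose_def)
    have "res \<delta> \<otimes>\<^bsub>fst arb\<^esub> res \<delta>' \<in> ?D" using that subgroup.m_closed[OF sub] by (auto simp: D_def)
    then show "compose L \<delta> \<delta>' \<in> D" using that \<Gamma>_comp mult_arb by (auto simp: D_def)
  qed
  have D4: "\<exists>\<epsilon>\<in>D. \<forall>x\<in>T. \<tau> (\<tau>' x) = \<tau>' (\<tau> (\<epsilon> x))" if \<tau>: "\<tau> \<in> \<Gamma>" "\<tau>' \<in> \<Gamma>" for \<tau> \<tau>'
  proof -
    let ?g = "res \<tau>" and ?h = "res \<tau>'"
    have gh: "?g \<in> carrier (fst arb)" "?h \<in> carrier (fst arb)" using \<tau> carrier_arb by auto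
    \<comment> \<open>The commutator of the inverses: it has the shape demanded by the derived
      subgroup and satisfies g h = h g e.\<close>
    let ?e = "inv\<^bsub>fst arb\<^esub> ?g \<otimes>\<^bsub>fst arb\<^esub> inv\<^bsub>fst arb\<^esub> ?h \<otimes>\<^bsub>fst arb\<^esub> inv\<^bsub>fst arb\<^esub> (inv\<^bsub>fst arb\<^esub> ?g) \<otimes>\<^bsub>fst arb\<^esub> inv\<^bsub>fst arb\<^esub> (inv\<^bsub>fst arb\<^esub> ?h)"
    have eD: "?e \<in> ?D"
      unfolding derived_def using gh by (intro generate.incl) (use G.inv_closed in blast)
    then have "?e \<in> carrier (fst arb)" using subgroup.subset[OF sub] by blast
    then obtain \<epsilon> where \<epsilon>: "\<epsilon> \<in> \<Gamma>" "?e = res \<epsilon>" unfolding carrier_arb by blast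
    have "?h \<otimes>\<^bsub>fst arb\<^esub> (?g \<otimes>\<^bsub>fst arb\<^esub> ?e) = ?g \<otimes>\<^bsub>fst arb\<^esub> ?h"
      using gh by (simp add: G.m_assoc[symmetric])
    then have "?g \<otimes>\<^bsub>fst arb\<^esub> ?h = ?h \<otimes>\<^bsub>fst arb\<^esub> (?g \<otimes>\<^bsub>fst arb\<^esub> res \<epsilon>)"
      unfolding \<epsilon>(2) by simp
    then have eq: "res (compose L \<tau> \<tau>') = res (compose L \<tau>' (compose L \<tau> \<epsilon>))"
      using \<tau> \<epsilon>(1) \<Gamma>_comp by (simp add: mult_arb)
    have "\<tau> (\<tau>' x) = \<tau>' (\<tau> (\<epsilon> x))" if "x \<in> T" for x
      using resT[OF eq that] that T_L by (auto simp: compose_def)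
    moreover have "\<epsilon> \<in> D" using \<epsilon> eD by (simp add: D_def)
    ultimately show ?thesis by blast
  qed
  obtain \<delta>0 where "\<delta>0 \<in> D" using D4[OF \<Gamma>_id \<Gamma>_id] by blast
  show ?thesis
    unfolding in_closure_of topspace_arb
  proof (intro conjI allI impI)
    show "res \<sigma> \<in> res ` \<Gamma>" using \<sigma> by blast
    fix U assume U: "res \<sigma> \<in> U \<and> openin (snd arb) U"
    obtain A where A: "finite A" "A \<subseteq> T" "\<And>\<tau>. \<tau> \<in> \<Gamma> \<Longrightarrow> \<forall>x\<in>A. \<tau> x = res \<sigma> x \<Longrightarrow> res \<tau> \<in> U"
      using openin_arbD[of U "res \<sigma>"] U by blast
    obtain \<tau> where \<tau>: "\<tau> \<in> D" "\<forall>x\<in>A. \<tau> x = \<sigma> x"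
    proof -
      have "\<exists>\<tau>\<in>D. \<forall>x\<in>A. \<tau> x = \<sigma> x"
        by (rule radicals_fixed_dense[of D \<delta>0 \<sigma> A]) (fact D1 \<open>\<delta>0 \<in> D\<close> D3 D4 \<sigma> rads A(1) A(2))+
      then show thesis using that by blast
    qed
    have "\<forall>x\<in>A. \<tau> x = res \<sigma> x" using \<tau>(2) A(2) by auto
    then have "res \<tau> \<in> U" using A(3) \<tau>(1) D1 by blast
    then show "\<exists>y. y \<in> ?D \<and> y \<in> U" using \<tau>(1) by (auto simp: D_def)
  qed
qed

end

section \<open>The target groups\<close>

lemma comm_group_Zmod: "comm_group (fst (Zmod n))"
  by (simp add: Zmod_def)

lemma comm_group_topgroup_power:
  assumes "comm_group (fst G)"
  shows "comm_group (fst (topgroup_power G I))"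
proof -
  interpret G: comm_group "fst G" by fact
  have "group (product_group I (\<lambda>_. fst G))" using G.group_axioms by simp
  then show ?thesis
    unfolding topgroup_power_def fst_conv
    by (rule group.group_comm_groupI) (auto intro!: ext simp: restrict_def G.m_comm PiE_iff)
qed

lemma topspace_topgroup_power:
  "topspace (snd G) = carrier (fst G) \<Longrightarrow> topspace (snd (topgroup_power G I)) = carrier (fst (topgroup_power G I))"
  by (simp add: topgroup_power_def)

lemma Hausdorff_topgroup_power:
  "Hausdorff_space (snd G) \<Longrightarrow> Hausdorff_space (snd (topgroup_power G I))"
  by (simp add: topgroup_power_def Hausdorff_space_product_topology)

lemma fst_dadic: "fst (dadic d) = (product_group UNIV (\<lambda>k. integer_mod_group (d ^ k)))\<lparr>carrier := dadic_carrier d\<rparr>"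
  by (simp add: dadic_def)

lemma dadic_carrier_iff:
  assumes "d > 0"
  shows "x \<in> dadic_carrier d \<longleftrightarrow> (\<forall>k. 0 \<le> x k \<and> x k < int (d ^ k) \<and> x (Suc k) mod int (d ^ k) = x k)"
  using assms by (auto simp: dadic_carrier_def carrier_integer_mod_group)

lemma comm_group_dadic:
  assumes d: "d > 0"
  shows "comm_group (fst (dadic d))"
proof -
  let ?G = "product_group UNIV (\<lambda>k. integer_mod_group (d ^ k))"
  interpret G: group ?G by simp
  have dvd: "int (d ^ k) dvd int (d ^ Suc k)" for k by simp
  have pos: "int (d ^ k) > 0" for k using d by simp
  have "subgroup (dadic_carrier d) ?G"
  proof (rule G.subgroupI)
    show "dadic_carrier d \<subseteq> carrier ?G"
      by (auto simp: dadic_carrier_def)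
    have "(\<lambda>k. 0) \<in> dadic_carrier d"
      using d by (simp add: dadic_carrier_iff)
    then show "dadic_carrier d \<noteq> {}" by blast
    fix x assume x: "x \<in> dadic_carrier d"
    then have xc: "x k \<in> carrier (integer_mod_group (d ^ k))" for k by (simp add: dadic_carrier_def)
    have xm: "x (Suc k) mod int (d ^ k) = x k" for k using x by (simp add: dadic_carrier_def)
    have "inv\<^bsub>?G\<^esub> x = (\<lambda>k. (- x k) mod int (d ^ k))"
      using xc by (subst inv_product_group) (auto simp: fun_eq_iff)
    moreover have "((- x (Suc k)) mod int (d ^ Suc k)) mod int (d ^ k) = (- x k) mod int (d ^ k)" for k
      using mod_mod_cancel[OF dvd] xm by (metis mod_minus_eq)
    ultimately show "inv\<^bsub>?G\<^esub> x \<in> dadic_carrier d"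
      using pos by (simp add: dadic_carrier_iff[OF d])
    fix y assume y: "y \<in> dadic_carrier d"
    have ym: "y (Suc k) mod int (d ^ k) = y k" for k using y by (simp add: dadic_carrier_def)
    have "((x (Suc k) + y (Suc k)) mod int (d ^ Suc k)) mod int (d ^ k) = (x k + y k) mod int (d ^ k)" for k
      using mod_mod_cancel[OF dvd] xm ym by (metis mod_add_eq)
    then show "x \<otimes>\<^bsub>?G\<^esub> y \<in> dadic_carrier d"
      using pos by (simp add: dadic_carrier_iff[OF d])
  qed
  then have "group (fst (dadic d))"
    unfolding fst_dadic by (rule subgroup.subgroup_is_group) (rule G.group_axioms)
  then show ?thesis
    by (rule group.group_comm_groupI) (simp add: fst_dadic add.commute)
qed

lemma topspace_dadic: "topspace (snd (dadic d)) = carrier (fst (dadic d))"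
  by (auto simp: dadic_def dadic_carrier_def)

lemma Hausdorff_dadic: "Hausdorff_space (snd (dadic d))"
  by (simp add: dadic_def Hausdorff_space_subtopology Hausdorff_space_product_topology)

text \<open>The n distinct powers of \<open>z\<close> exhaust the at most n roots of X^n -
  1.\<close>

lemma power_unity_primitive:
  fixes z :: "'a::field"
  assumes z: "primitive_root n z" and n: "n > 0" and x: "x ^ n = 1"
  obtains j where "j < n" "x = z ^ j"
proof -
  have z0: "z \<noteq> 0" using primitive_rootD[OF z] n by (auto simp: zero_power)
  have inj: "inj_on (\<lambda>j. z ^ j) {..<n}"
  proof (rule linorder_inj_onI')
    fix i j assume ij: "i \<in> {..<n}" "j \<in> {..<n}" "i < j"
    show "z ^ i \<noteq> z ^ j"
    proof
      assume "z ^ i = z ^ j"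
      then have "z ^ i * 1 = z ^ i * z ^ (j - i)"
        using ij(3) power_add[of z i "j - i"] by simp
      then have "z ^ (j - i) = 1" using z0 by simp
      then have "n dvd j - i" using z by (simp add: primitive_root_def)
      then show False using ij by (auto dest: dvd_imp_le)
    qed
  qed
  let ?p = "monom 1 n - [:1:] :: 'a poly"
  have "coeff ?p n = 1" using n by (cases n) (auto simp: coeff_pCons)
  then have p0: "?p \<noteq> 0" by (metis coeff_0 zero_neq_one)
  have "degree ?p \<le> n" by (rule degree_le) (use n in \<open>auto simp: coeff_pCons split: nat.splits\<close>)
  then have "card {y. poly ?p y = 0} \<le> n"
    using card_poly_roots_bound[OF p0] by linarith
  moreover have "(\<lambda>j. z ^ j) ` {..<n} \<subseteq> {y. poly ?p y = 0}"
    using primitive_rootD[OF z] by (auto simp: poly_monom mult.commute power_mult simp flip: power_mult)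
       (metis mult.commute power_mult power_one)
  moreover have "card ((\<lambda>j. z ^ j) ` {..<n}) = n" using card_image[OF inj] by simp
  ultimately have "(\<lambda>j. z ^ j) ` {..<n} = {y. poly ?p y = 0}"
    using poly_roots_finite[OF p0] by (intro card_subset_eq) (auto dest: card_mono)
  moreover have "x \<in> {y. poly ?p y = 0}" using x by (simp add: poly_monom)
  ultimately show thesis using that by blast
qed

section \<open>Compatible systems of roots of unity and of radicals\<close>

context unicritical
begin

text \<open>The exponent leading from level n + 1 back to level n; without periodicity all levels
  have the same degree, hence the value 1.\<close>

definition rstep :: nat where "rstep = (if 0 \<in> S then d else 1)"

lemma rad_Suc: "rad (Suc n) = rad n * rstep"
  by (simp add: rad_def rstep_def)

lemma rad_pos: "rad n > 0"
  using d0 by (simp add: rad_def)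

lemma of_nat_rstep: "of_nat rstep \<noteq> (0::'l)"
  using d(2) by (simp add: rstep_def)

text \<open>For n > 0 any d-th root of a primitive d^n-th root is primitive of order d^(n+1),
  because \<open>d\<close> divides d^n. At n = 0 a d-th root of 1 may have smaller order than
  \<open>d\<close>, so a primitive one is chosen.\<close>

lemma compatible_unity_roots:
  "\<exists>\<zeta>. \<forall>n. (\<zeta> n \<in> k \<and> primitive_root (rad n) (\<zeta> n)) \<and> \<zeta> (Suc n) ^ rstep = \<zeta> n"
proof (rule dependent_nat_choice)
  show "\<exists>x. x \<in> k \<and> primitive_root (rad 0) x"
    using primitive_root_exists[OF k of_nat_rad] by metis
  fix z n assume z: "z \<in> k \<and> primitive_root (rad n) z"
  show "\<exists>y. (y \<in> k \<and> primitive_root (rad (Suc n)) y) \<and> y ^ rstep = z"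
  proof (cases "0 \<in> S")
    case False
    then show ?thesis using z by (intro exI[of _ z]) (simp add: rad_def rstep_def)
  next
    case True
    then have r: "rad m = d ^ m" "rstep = d" for m by (simp_all add: rad_def rstep_def)
    show ?thesis
    proof (cases n)
      case 0
      then have "z = 1" using z r primitive_rootD[of "rad 0" z] by simp
      obtain y where y: "y \<in> k" "primitive_root d y"
        using primitive_root_exists[OF k d(2)] by blast
      then show ?thesis
        using \<open>z = 1\<close> 0 r primitive_rootD[OF y(2)] by (intro exI[of _ y]) simp
    next
      case (Suc n')
      obtain y where y: "y \<in> k" "y ^ d = z"
        using separably_closed_nth_root[OF k d(2)] z by blast
      have "y ^ j = 1 \<longleftrightarrow> d ^ Suc n dvd j" for j
      proof
        assume j: "y ^ j = 1"
        have "z ^ j = 1" using j y(2) by (metis mult.commute power_mult power_one)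
        then have "d ^ n dvd j" using z r by (simp add: primitive_root_def)
        moreover have "d dvd d ^ n" using Suc by simp
        ultimately have "d dvd j" by (rule dvd_trans[rotated])
        then obtain i where i: "j = d * i" by blast
        then have "z ^ i = 1" using j y(2) by (simp add: power_mult)
        then have "d ^ n dvd i" using z r by (simp add: primitive_root_def)
        then show "d ^ Suc n dvd j" using i by simp
      next
        assume "d ^ Suc n dvd j"
        then obtain i where i: "j = d * (d ^ n * i)" by (metis dvdE mult.assoc power_Suc)
        have "z ^ (d ^ n * i) = 1" using z r by (simp add: primitive_root_def)
        then show "y ^ j = 1" using i y(2) by (simp add: power_mult)
      qed
      then have "primitive_root (rad (Suc n)) y" unfolding primitive_root_def r by blast
      then show ?thesis using y r(2) by auto
    qed
  qed
qed

lemma compatible_radicals: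
  assumes "c \<in> S"
  shows "\<exists>\<rho>. \<forall>n. (\<rho> n \<in> L \<and> \<rho> n ^ rad n = t - c) \<and> \<rho> (Suc n) ^ rstep = \<rho> n"
proof (rule dependent_nat_choice)
  have "t - c \<in> L" using assms S_k F by (intro subfield_diff[OF L(1)]) auto
  then show "\<exists>x. x \<in> L \<and> x ^ rad 0 = t - c"
    using nth_root_L[OF of_nat_rad] by metis
  fix x n assume x: "x \<in> L \<and> x ^ rad n = t - c"
  then obtain y where "y \<in> L" "y ^ rstep = x" using nth_root_L[OF of_nat_rstep] by blast
  then show "\<exists>y. (y \<in> L \<and> y ^ rad (Suc n) = t - c) \<and> y ^ rstep = x"
    using x by (intro exI[of _ y]) (simp add: rad_Suc mult.commute power_mult)
qed

end

section \<open>Kummer coordinates on the arboreal group\<close>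

text \<open>The orbit is enumerated by natural numbers so that the target is a power over such an
  index set, finite or infinite. Radicals and roots of unity form coherent towers, so the
  coordinates at successive levels reduce to each other.\<close>

locale radical_coordinates = unicritical k L t a b d
  for k L :: "'l::field set" and t a b :: 'l and d :: nat +
  fixes I :: "nat set" and c :: "nat \<Rightarrow> 'l" and \<rho> :: "nat \<Rightarrow> nat \<Rightarrow> 'l" and \<zeta> :: "nat \<Rightarrow> 'l"
  assumes c: "bij_betw c I S"
    and \<zeta>: "\<And>n. \<zeta> n \<in> k" "\<And>n. primitive_root (rad n) (\<zeta> n)" "\<And>n. \<zeta> (Suc n) ^ rstep = \<zeta> n"
    and \<rho>: "\<And>i n. i \<in> I \<Longrightarrow> \<rho> i n \<in> L" "\<And>i n. i \<in> I \<Longrightarrow> \<rho> i n ^ rad n = t - c i"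
      "\<And>i n. i \<in> I \<Longrightarrow> \<rho> i (Suc n) ^ rstep = \<rho> i n"
begin

lemma c_S: "i \<in> I \<Longrightarrow> c i \<in> S"
  using c by (auto simp: bij_betw_def)

lemma \<rho>_nz: "i \<in> I \<Longrightarrow> \<rho> i n \<noteq> 0"
proof
  assume "i \<in> I" "\<rho> i n = 0"
  then have "t - c i = 0" using \<rho>(2)[of i n] rad_pos[of n] by (simp add: zero_power)
  then show False using c_S[OF \<open>i \<in> I\<close>] S_k t_notin_k by auto
qed

lemma \<rho>_M: "i \<in> I \<Longrightarrow> \<rho> i n \<in> M"
  using radical_M[OF c_S \<rho>(2)] .

lemma \<zeta>_pow_cong: "\<zeta> n ^ i = \<zeta> n ^ j \<longleftrightarrow> i mod rad n = j mod rad n"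
proof -
  have red: "\<zeta> n ^ i = \<zeta> n ^ (i mod rad n)" for i
  proof -
    have "\<zeta> n ^ i = \<zeta> n ^ (rad n * (i div rad n) + i mod rad n)" by simp
    also have "\<dots> = \<zeta> n ^ (i mod rad n)"
      unfolding power_add power_mult primitive_rootD[OF \<zeta>(2)] by simp
    finally show ?thesis .
  qed
  have \<zeta>0: "\<zeta> n \<noteq> 0" using primitive_rootD[OF \<zeta>(2)[of n]] rad_pos[of n] by (auto simp: zero_power)
  have *: "i = j" if "i < rad n" "j < rad n" "\<zeta> n ^ i = \<zeta> n ^ j" "i \<le> j" for i j
  proof -
    have "\<zeta> n ^ i * 1 = \<zeta> n ^ i * \<zeta> n ^ (j - i)" using that power_add[of "\<zeta> n" i "j - i"] by simp
    then have "\<zeta> n ^ (j - i) = 1" using \<zeta>0 by simp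
    then have "rad n dvd j - i" using \<zeta>(2)[of n] by (simp add: primitive_root_def)
    then show ?thesis using that by (auto dest: dvd_imp_le)
  qed
  show ?thesis
  proof
    assume "\<zeta> n ^ i = \<zeta> n ^ j"
    then have "\<zeta> n ^ (i mod rad n) = \<zeta> n ^ (j mod rad n)" using red by metis
    then show "i mod rad n = j mod rad n"
      using *[of "i mod rad n" "j mod rad n"] *[of "j mod rad n" "i mod rad n"] rad_pos[of n]
      by (metis mod_less_divisor nle_le)
  qed (metis red)
qed

text \<open>The Kummer character of the radical \<open>\<rho> i n\<close>, read in exponents of
  \<open>\<zeta> n\<close>; the value is the representative used by
  \<open>integer_mod_group\<close>.\<close>

definition \<kappa> :: "nat \<Rightarrow> nat \<Rightarrow> ('l \<Rightarrow> 'l) \<Rightarrow> int" where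
  "\<kappa> i n \<sigma> = int (THE j. j < rad n \<and> \<sigma> (\<rho> i n) = \<zeta> n ^ j * \<rho> i n)"

lemma \<kappa>_eqI:
  assumes "i \<in> I" "\<sigma> (\<rho> i n) = \<zeta> n ^ j * \<rho> i n"
  shows "\<kappa> i n \<sigma> = int (j mod rad n)"
proof -
  have "(THE j. j < rad n \<and> \<sigma> (\<rho> i n) = \<zeta> n ^ j * \<rho> i n) = j mod rad n"
  proof (rule the_equality)
    show "j mod rad n < rad n \<and> \<sigma> (\<rho> i n) = \<zeta> n ^ (j mod rad n) * \<rho> i n"
      using assms(2) rad_pos[of n] \<zeta>_pow_cong[of n j "j mod rad n"] by simp
    show "j' = j mod rad n" if "j' < rad n \<and> \<sigma> (\<rho> i n) = \<zeta> n ^ j' * \<rho> i n" for j'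
      using that assms(2) \<rho>_nz[OF assms(1), of n] \<zeta>_pow_cong[of n j j'] by simp
  qed
  then show ?thesis by (simp add: \<kappa>_def)
qed

lemma \<kappa>_exists:
  assumes "i \<in> I" "\<sigma> \<in> \<Gamma>"
  obtains j where "j < rad n" "\<sigma> (\<rho> i n) = \<zeta> n ^ j * \<rho> i n" "\<kappa> i n \<sigma> = int j"
proof -
  note h = \<Gamma>_hom[OF assms(2)]
  have "t - c i \<in> F" using c_S[OF assms(1)] S_k F by (intro subfield_diff[OF F(1)]) auto
  then have "\<sigma> (\<rho> i n ^ rad n) = \<rho> i n ^ rad n"
    using \<Gamma>_fix[OF assms(2)] \<rho>(2)[OF assms(1)] by simp
  then have "(\<sigma> (\<rho> i n) / \<rho> i n) ^ rad n = 1"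
    using \<rho>(1)[OF assms(1)] \<rho>_nz[OF assms(1), of n] by (simp add: hom_on_power[OF L(1) h] power_divide)
  then obtain j where j: "j < rad n" "\<sigma> (\<rho> i n) / \<rho> i n = \<zeta> n ^ j"
    using power_unity_primitive[OF \<zeta>(2) rad_pos] by blast
  then have "\<sigma> (\<rho> i n) = \<zeta> n ^ j * \<rho> i n"
    using \<rho>_nz[OF assms(1), of n] by (simp add: field_simps)
  then show thesis using that j(1) \<kappa>_eqI[of i \<sigma> n j] assms(1) by simp
qed

lemma \<zeta>_fix: "\<sigma> \<in> \<Gamma> \<Longrightarrow> \<sigma> (\<zeta> n ^ j) = \<zeta> n ^ j"
  using \<Gamma>_fix \<zeta>(1) F(2) subfield_power[OF F(1)] by blast

lemma \<zeta>_L: "\<zeta> n ^ j \<in> L"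
  using \<zeta>(1) F(4) subfield_power[OF L(1)] by blast

lemma \<kappa>_comp:
  assumes "i \<in> I" "\<sigma> \<in> \<Gamma>" "\<tau> \<in> \<Gamma>"
  shows "\<kappa> i n (compose L \<sigma> \<tau>) = (\<kappa> i n \<sigma> + \<kappa> i n \<tau>) mod int (rad n)"
proof -
  obtain j where j: "\<sigma> (\<rho> i n) = \<zeta> n ^ j * \<rho> i n" "\<kappa> i n \<sigma> = int j" using \<kappa>_exists[OF assms(1,2)] by blast
  obtain l where l: "\<tau> (\<rho> i n) = \<zeta> n ^ l * \<rho> i n" "\<kappa> i n \<tau> = int l" using \<kappa>_exists[OF assms(1,3)] by blast
  have "compose L \<sigma> \<tau> (\<rho> i n) = \<zeta> n ^ (j + l) * \<rho> i n"
    using \<rho>(1)[OF assms(1)] l(1) j(1) \<zeta>_fix[OF assms(2)] \<zeta>_L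
    by (simp add: compose_def hom_on_mult[OF L(1) \<Gamma>_hom[OF assms(2)]] power_add mult_ac)
  then have "\<kappa> i n (compose L \<sigma> \<tau>) = int ((j + l) mod rad n)" by (rule \<kappa>_eqI[OF assms(1)])
  then show ?thesis using j(2) l(2) by (simp add: zmod_int)
qed

lemma \<kappa>_compat:
  assumes "i \<in> I" "\<sigma> \<in> \<Gamma>"
  shows "\<kappa> i (Suc n) \<sigma> mod int (rad n) = \<kappa> i n \<sigma>"
proof -
  obtain j where j: "\<sigma> (\<rho> i (Suc n)) = \<zeta> (Suc n) ^ j * \<rho> i (Suc n)" "\<kappa> i (Suc n) \<sigma> = int j"
    using \<kappa>_exists[OF assms] by blast
  have "\<sigma> (\<rho> i n) = \<sigma> (\<rho> i (Suc n)) ^ rstep"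
    using \<rho>(3)[OF assms(1), of n] \<rho>(1)[OF assms(1)] hom_on_power[OF L(1) \<Gamma>_hom[OF assms(2)]] by metis
  also have "\<dots> = (\<zeta> (Suc n) ^ rstep) ^ j * \<rho> i (Suc n) ^ rstep"
    unfolding j(1) by (simp add: power_mult_distrib mult.commute flip: power_mult)
  also have "\<dots> = \<zeta> n ^ j * \<rho> i n" using \<zeta>(3) \<rho>(3)[OF assms(1)] by simp
  finally have "\<kappa> i n \<sigma> = int (j mod rad n)" by (rule \<kappa>_eqI[OF assms(1)])
  then show ?thesis using j(2) by (simp add: zmod_int)
qed

lemma \<kappa>_range: "i \<in> I \<Longrightarrow> \<sigma> \<in> \<Gamma> \<Longrightarrow> 0 \<le> \<kappa> i n \<sigma> \<and> \<kappa> i n \<sigma> < int (rad n)"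
  using \<kappa>_exists[of i \<sigma> n] by (metis of_nat_0_le_iff of_nat_less_iff)

lemma \<kappa>_carrier: "i \<in> I \<Longrightarrow> \<sigma> \<in> \<Gamma> \<Longrightarrow> \<kappa> i n \<sigma> \<in> carrier (integer_mod_group (rad n))"
  using \<kappa>_range by (simp add: carrier_integer_mod_group)

text \<open>One index at a time: independence gives an automorphism that fixes the earlier radicals
  and corrects the new coordinate.\<close>

lemma coordinates_finite_onto:
  assumes "finite J" "J \<subseteq> I"
  shows "\<exists>\<sigma>\<in>\<Gamma>. \<forall>i\<in>J. \<sigma> (\<rho> i n) = \<zeta> n ^ y i * \<rho> i n"
  using assms
proof (induction J rule: finite_induct)
  case empty
  then show ?case using \<Gamma>_id by blast
next
  case (insert i J)
  then obtain \<sigma> where \<sigma>: "\<sigma> \<in> \<Gamma>" "\<forall>j\<in>J. \<sigma> (\<rho> j n) = \<zeta> n ^ y j * \<rho> j n" by blast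
  have i: "i \<in> I" using insert.prems by blast
  obtain e where e: "e < rad n" "\<sigma> (\<rho> i n) = \<zeta> n ^ e * \<rho> i n" using \<kappa>_exists[OF i \<sigma>(1)] by blast
  \<comment> \<open>The residue of y i - e modulo \<open>rad n\<close>, kept a natural number by e <
    rad n.\<close>
  define m where "m = y i + (rad n - e)"
  have "\<zeta> n ^ m * \<zeta> n ^ e = \<zeta> n ^ y i"
    using e(1) primitive_rootD[OF \<zeta>(2)[of n]] by (simp add: m_def flip: power_add) (simp add: power_add)
  obtain \<tau> where \<tau>: "\<tau> \<in> \<Gamma>" "\<And>x. x \<in> (\<lambda>j. \<rho> j n) ` J \<Longrightarrow> \<tau> x = x" "\<tau> (\<rho> i n) = \<zeta> n ^ m * \<rho> i n"
  proof (rule radical_independent[of "c i" "(\<lambda>j. \<rho> j n) ` J" "rad n" "\<rho> i n" "\<zeta> n ^ m"])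
    show "c i \<in> k" using c_S[OF i] S_k by blast
    show "(\<lambda>j. \<rho> j n) ` J \<subseteq> L" using \<rho>(1) insert.prems by blast
    show "of_nat (rad n) \<noteq> (0::'l)" by (rule of_nat_rad)
    show "\<rho> i n \<in> L" "\<rho> i n ^ rad n = t - c i" using \<rho> i by auto
    show "(\<zeta> n ^ m) ^ rad n = 1"
      using primitive_rootD[OF \<zeta>(2)[of n]] by (metis mult.commute power_mult power_one)
    show "\<exists>n c'. of_nat n \<noteq> (0::'l) \<and> c' \<in> k \<and> c' \<noteq> c i \<and> x ^ n = t - c'"
      if x: "x \<in> (\<lambda>j. \<rho> j n) ` J" for x
    proof -
      obtain j where j: "j \<in> J" "x = \<rho> j n" using x by blast
      then have jI: "j \<in> I" "j \<noteq> i" using insert by auto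
      then have "c j \<noteq> c i" using c i by (auto simp: bij_betw_def inj_on_def)
      then show ?thesis
        using j(2) \<rho>(2)[OF jI(1)] of_nat_rad[of n] c_S[OF jI(1)] S_k by blast
    qed
  qed (use that in blast)
  have "compose L \<sigma> \<tau> (\<rho> j n) = \<zeta> n ^ y j * \<rho> j n" if "j \<in> insert i J" for j
  proof (cases "j = i")
    case True
    then show ?thesis
      using \<rho>(1)[OF i] \<tau>(3) e(2) \<zeta>_fix[OF \<sigma>(1)] \<zeta>_L \<open>\<zeta> n ^ m * \<zeta> n ^ e = \<zeta> n ^ y i\<close>
      by (simp add: compose_def hom_on_mult[OF L(1) \<Gamma>_hom[OF \<sigma>(1)]] mult.assoc[symmetric])
  next
    case False
    then have "j \<in> J" "j \<in> I" using that insert.prems by auto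
    then show ?thesis using \<tau>(2)[of "\<rho> j n"] \<sigma>(2) \<rho>(1) by (simp add: compose_def)
  qed
  then show ?case using \<Gamma>_comp[OF \<sigma>(1) \<tau>(1)] by blast
qed

text \<open>Compactness reduces to finitely many pairs (i, n), and compatibility reduces these to a
  single level above all of them.\<close>

lemma coordinates_onto:
  assumes x: "\<And>i n. i \<in> I \<Longrightarrow> 0 \<le> x i n \<and> x i n < int (rad n) \<and> x i (Suc n) mod int (rad n) = x i n"
  shows "\<exists>\<sigma>\<in>\<Gamma>. \<forall>i\<in>I. \<forall>n. \<kappa> i n \<sigma> = x i n"
proof -
  have "\<exists>\<sigma>\<in>\<Gamma>. \<forall>p\<in>I \<times> UNIV. \<sigma> (case p of (i, n) \<Rightarrow> \<rho> i n) = (case p of (i, n) \<Rightarrow> \<zeta> n ^ nat (x i n) * \<rho> i n)"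
  proof (rule galois_group_finite_intersection[OF F(1) L(1) FL alg_L])
    show "(case p of (i, n) \<Rightarrow> \<rho> i n) \<in> L" if "p \<in> I \<times> UNIV" for p
      using that \<rho>(1) by auto
    fix P :: "(nat \<times> nat) set" assume P: "finite P" "P \<subseteq> I \<times> UNIV"
    define N where "N = sum snd P"
    have N: "n \<le> N" if "(i, n) \<in> P" for i n
      unfolding N_def using member_le_sum[of "(i, n)" P snd] that P(1) by auto
    have "fst ` P \<subseteq> I" using P(2) by auto
    then obtain \<sigma> where \<sigma>: "\<sigma> \<in> \<Gamma>" "\<forall>i\<in>fst ` P. \<sigma> (\<rho> i N) = \<zeta> N ^ nat (x i N) * \<rho> i N"
      using coordinates_finite_onto[of "fst ` P" N "\<lambda>i. nat (x i N)"] P(1) by blast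
    have "\<sigma> (\<rho> i n) = \<zeta> n ^ nat (x i n) * \<rho> i n" if "(i, n) \<in> P" for i n
    proof -
      have i: "i \<in> I" "i \<in> fst ` P" using that P(2) by force+
      have "\<kappa> i N \<sigma> = int (nat (x i N) mod rad N)"
        using \<kappa>_eqI[OF i(1)] \<sigma>(2) i(2) by blast
      also have "\<dots> = x i N" using x[OF i(1), of N] by (simp add: zmod_int)
      finally have \<kappa>N: "\<kappa> i N \<sigma> = x i N" .
      have "\<kappa> i n \<sigma> = x i n"
        using N[OF that]
      proof (induction rule: inc_induct)
        case base
        show ?case by (rule \<kappa>N)
      next
        case (step m)
        then show ?case using \<kappa>_compat[OF i(1) \<sigma>(1), of m] x[OF i(1), of m] by simp
      qed
      moreover obtain j where "\<sigma> (\<rho> i n) = \<zeta> n ^ j * \<rho> i n" "\<kappa> i n \<sigma> = int j"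
        using \<kappa>_exists[OF i(1) \<sigma>(1)] by blast
      ultimately show ?thesis by (metis nat_int)
    qed
    then show "\<exists>\<sigma>\<in>\<Gamma>. \<forall>p\<in>P. \<sigma> (case p of (i, n) \<Rightarrow> \<rho> i n) = (case p of (i, n) \<Rightarrow> \<zeta> n ^ nat (x i n) * \<rho> i n)"
      using \<sigma>(1) by (intro bexI[of _ \<sigma>]) auto
  qed
  then obtain \<sigma> where \<sigma>: "\<sigma> \<in> \<Gamma>" "\<And>i n. i \<in> I \<Longrightarrow> \<sigma> (\<rho> i n) = \<zeta> n ^ nat (x i n) * \<rho> i n"
    by auto
  have "\<kappa> i n \<sigma> = x i n" if "i \<in> I" for i n
    using \<kappa>_eqI[of i \<sigma> n "nat (x i n)"] that \<sigma>(2) x[OF that, of n] by (simp add: zmod_int)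
  then show ?thesis using \<sigma>(1) by blast
qed

text \<open>The chosen radicals represent all: another root of t - s of the same degree differs from
  \<open>\<rho> i n\<close> by a root of unity in \<open>k\<close>.\<close>

lemma coordinates_zero_imp_closure_derived:
  assumes \<sigma>: "\<sigma> \<in> \<Gamma>" and z: "\<And>i n. i \<in> I \<Longrightarrow> \<kappa> i n \<sigma> = 0"
  shows "res \<sigma> \<in> Abstract_Topology.closure_of (snd arb) (derived (fst arb) (carrier (fst arb)))"
proof (rule radicals_fixed_imp_closure_derived[OF \<sigma>])
  fix s n w assume s: "s \<in> S" and w: "w \<in> L" "w ^ rad n = t - s"
  have "s \<in> c ` I" using bij_betw_imp_surj_on[OF c] s by simp
  then obtain i where i: "i \<in> I" "c i = s" by blast
  have fx: "\<sigma> (\<rho> i n) = \<rho> i n"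
    using \<kappa>_exists[OF i(1) \<sigma>, of n] z[OF i(1), of n] by auto
  have "(w / \<rho> i n) ^ rad n = 1"
  proof -
    have "\<rho> i n ^ rad n \<noteq> 0" using \<rho>_nz[OF i(1), of n] by simp
    then show ?thesis using w(2) \<rho>(2)[OF i(1), of n] i(2) by (simp add: power_divide)
  qed
  then have "w / \<rho> i n \<in> F" using unity_root_k[OF of_nat_rad] F(2) by (meson subsetD)
  then have "\<sigma> (w / \<rho> i n) = w / \<rho> i n" by (rule \<Gamma>_fix[OF \<sigma>])
  then have "\<sigma> w / \<rho> i n = w / \<rho> i n"
    using hom_on_divide[OF L(1) \<Gamma>_hom[OF \<sigma>] w(1) \<rho>(1)[OF i(1)]] fx by simp
  then show "\<sigma> w = w" using \<rho>_nz[OF i(1), of n] by simp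
qed

text \<open>An arbitrary section of restriction to the tree. The coordinates do not depend on the
  choice, since the radicals lie in \<open>M\<close>, where the action on the tree decides.\<close>

definition lift where "lift g = (SOME \<sigma>. \<sigma> \<in> \<Gamma> \<and> res \<sigma> = g)"

lemma lift: "g \<in> res ` \<Gamma> \<Longrightarrow> lift g \<in> \<Gamma> \<and> res (lift g) = g"
  unfolding lift_def by (rule someI_ex[of "\<lambda>\<sigma>. \<sigma> \<in> \<Gamma> \<and> res \<sigma> = g"]) blast

lemma \<kappa>_lift:
  assumes "\<sigma> \<in> \<Gamma>" "i \<in> I"
  shows "\<kappa> i n (lift (res \<sigma>)) = \<kappa> i n \<sigma>"
proof -
  have l: "lift (res \<sigma>) \<in> \<Gamma>" "res (lift (res \<sigma>)) = res \<sigma>" using lift[of "res \<sigma>"] assms(1) by auto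
  have "lift (res \<sigma>) (\<rho> i n) = \<sigma> (\<rho> i n)"
    by (rule eq_T_imp_eq_M[OF l(1) assms(1) _ \<rho>_M[OF assms(2)]]) (metis l(2) restrict_apply')
  then show ?thesis by (simp add: \<kappa>_def)
qed

lemma continuous_\<kappa>:
  assumes i: "i \<in> I"
  shows "continuous_map (snd arb) (discrete_topology (carrier (integer_mod_group (rad n)))) (\<lambda>g. \<kappa> i n (lift g))"
  unfolding continuous_map
proof (intro conjI allI impI)
  show "(\<lambda>g. \<kappa> i n (lift g)) ` topspace (snd arb) \<subseteq> topspace (discrete_topology (carrier (integer_mod_group (rad n))))"
    using \<kappa>_carrier[OF i] lift by (auto simp: topspace_arb)
  fix U
  obtain A where A: "finite A" "A \<subseteq> T"
    "\<And>\<sigma> \<tau>. \<sigma> \<in> \<Gamma> \<Longrightarrow> \<tau> \<in> \<Gamma> \<Longrightarrow> \<forall>x\<in>A. \<sigma> x = \<tau> x \<Longrightarrow> \<sigma> (\<rho> i n) = \<tau> (\<rho> i n)"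
    using M_finitely_determined[OF \<rho>_M[OF i]] by blast
  show "openin (snd arb) {g \<in> topspace (snd arb). \<kappa> i n (lift g) \<in> U}"
  proof (rule openin_arbI)
    show "{g \<in> topspace (snd arb). \<kappa> i n (lift g) \<in> U} \<subseteq> res ` \<Gamma>" by (auto simp: topspace_arb)
    fix g assume "g \<in> {g \<in> topspace (snd arb). \<kappa> i n (lift g) \<in> U}"
    then obtain \<tau> where \<tau>: "\<tau> \<in> \<Gamma>" "g = res \<tau>" "\<kappa> i n \<tau> \<in> U"
      using \<kappa>_lift[OF _ i] by (auto simp: topspace_arb)
    have "res \<sigma> \<in> {g \<in> topspace (snd arb). \<kappa> i n (lift g) \<in> U}" if \<sigma>: "\<sigma> \<in> \<Gamma>" "\<forall>x\<in>A. \<sigma> x = g x" for \<sigma>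
    proof -
      have "\<forall>x\<in>A. \<sigma> x = \<tau> x" using \<sigma>(2) \<tau>(2) A(2) by (metis restrict_apply' subsetD)
      then have "\<sigma> (\<rho> i n) = \<tau> (\<rho> i n)" using A(3) \<sigma>(1) \<tau>(1) by blast
      then have "\<kappa> i n \<sigma> = \<kappa> i n \<tau>" by (simp add: \<kappa>_def)
      then show ?thesis using \<tau>(3) \<kappa>_lift[OF \<sigma>(1) i] \<sigma>(1) by (simp add: topspace_arb)
    qed
    then show "\<exists>A. finite A \<and> A \<subseteq> T \<and> (\<forall>\<sigma>\<in>\<Gamma>. (\<forall>x\<in>A. \<sigma> x = g x) \<longrightarrow> res \<sigma> \<in> {g \<in> topspace (snd arb). \<kappa> i n (lift g) \<in> U})"
      using A(1,2) by blast
  qed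
qed

text \<open>\<Phi> repackages the coordinates in the shape of the target group without losing any,
  so that one argument serves both kinds of target.\<close>

lemma arb_abelianization:
  fixes H :: "'h topgroup"
  assumes H: "comm_group (fst H)" "topspace (snd H) = carrier (fst H)" "Hausdorff_space (snd H)"
    and \<Phi>: "\<And>\<sigma>. \<sigma> \<in> \<Gamma> \<Longrightarrow> \<Phi> \<sigma> \<in> carrier (fst H)"
      "\<And>\<sigma> \<tau>. \<sigma> \<in> \<Gamma> \<Longrightarrow> \<tau> \<in> \<Gamma> \<Longrightarrow> \<Phi> (compose L \<sigma> \<tau>) = \<Phi> \<sigma> \<otimes>\<^bsub>fst H\<^esub> \<Phi> \<tau>"
      "\<And>\<sigma> \<tau>. (\<And>i n. i \<in> I \<Longrightarrow> \<kappa> i n \<sigma> = \<kappa> i n \<tau>) \<Longrightarrow> \<Phi> \<sigma> = \<Phi> \<tau>"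
      "\<And>y. y \<in> carrier (fst H) \<Longrightarrow> \<exists>\<sigma>\<in>\<Gamma>. \<Phi> \<sigma> = y"
      "\<And>\<sigma> i n. \<sigma> \<in> \<Gamma> \<Longrightarrow> \<Phi> \<sigma> = \<one>\<^bsub>fst H\<^esub> \<Longrightarrow> i \<in> I \<Longrightarrow> \<kappa> i n \<sigma> = 0"
    and cont: "continuous_map (snd arb) (snd H) (\<lambda>g. \<Phi> (lift g))"
  shows "topgroup_iso (topgroup_abelianization arb) H"
proof (rule topgroup_abelianization_iso[OF group_arb H(1) _ H(2) compact_arb H(3) _ _ cont])
  have \<Phi>l: "\<Phi> (lift (res \<sigma>)) = \<Phi> \<sigma>" if "\<sigma> \<in> \<Gamma>" for \<sigma>
    using \<Phi>(3) \<kappa>_lift[OF that] by blast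
  show "topspace (snd arb) = carrier (fst arb)" by (simp add: topspace_arb carrier_arb)
  show "(\<lambda>g. \<Phi> (lift g)) \<in> hom (fst arb) (fst H)"
  proof (rule homI)
    fix g h assume "g \<in> carrier (fst arb)" "h \<in> carrier (fst arb)"
    then obtain \<sigma> \<tau> where "\<sigma> \<in> \<Gamma>" "g = res \<sigma>" "\<tau> \<in> \<Gamma>" "h = res \<tau>" unfolding carrier_arb by blast
    then show "\<Phi> (lift g) \<in> carrier (fst H)"
      "\<Phi> (lift (g \<otimes>\<^bsub>fst arb\<^esub> h)) = \<Phi> (lift g) \<otimes>\<^bsub>fst H\<^esub> \<Phi> (lift h)"
      using \<Phi>l \<Phi>(1,2) \<Gamma>_comp by (simp_all add: mult_arb)
  qed
  show "(\<lambda>g. \<Phi> (lift g)) ` carrier (fst arb) = carrier (fst H)"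
  proof
    show "(\<lambda>g. \<Phi> (lift g)) ` carrier (fst arb) \<subseteq> carrier (fst H)"
      using \<Phi>l \<Phi>(1) by (auto simp: carrier_arb)
    show "carrier (fst H) \<subseteq> (\<lambda>g. \<Phi> (lift g)) ` carrier (fst arb)"
    proof
      fix y assume "y \<in> carrier (fst H)"
      then obtain \<sigma> where "\<sigma> \<in> \<Gamma>" "\<Phi> \<sigma> = y" using \<Phi>(4) by blast
      then show "y \<in> (\<lambda>g. \<Phi> (lift g)) ` carrier (fst arb)"
        using \<Phi>l[of \<sigma>] unfolding carrier_arb by (metis imageI)
    qed
  qed
  fix g assume g: "g \<in> carrier (fst arb)" "\<Phi> (lift g) = \<one>\<^bsub>fst H\<^esub>"
  then obtain \<sigma> where \<sigma>: "\<sigma> \<in> \<Gamma>" "g = res \<sigma>" unfolding carrier_arb by blast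
  then have "\<Phi> \<sigma> = \<one>\<^bsub>fst H\<^esub>" using g(2) \<Phi>l by simp
  then show "g \<in> Abstract_Topology.closure_of (snd arb) (derived (fst arb) (carrier (fst arb)))"
    unfolding \<sigma>(2) using coordinates_zero_imp_closure_derived[OF \<sigma>(1)] \<Phi>(5)[OF \<sigma>(1)] by blast
qed

text \<open>All levels have the same degree \<open>d\<close>, so compatibility makes the coordinates
  constant in n and level 0 carries everything.\<close>

lemma arb_abelianization_Zmod:
  assumes "0 \<notin> S"
  shows "topgroup_iso (topgroup_abelianization arb) (topgroup_power (Zmod d) I)"
proof -
  have r: "rad n = d" for n using assms by (simp add: rad_def)
  have const: "\<kappa> i n \<sigma> = \<kappa> i 0 \<sigma>" if "i \<in> I" "\<sigma> \<in> \<Gamma>" for i n \<sigma>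
  proof (induction n)
    case (Suc n)
    have "\<kappa> i (Suc n) \<sigma> mod int d = \<kappa> i (Suc n) \<sigma>" using \<kappa>_range[OF that, of "Suc n"] r by simp
    then show ?case using \<kappa>_compat[OF that, of n] Suc r by simp
  qed simp
  have cZ: "carrier (fst (topgroup_power (Zmod d) I)) = PiE I (\<lambda>_. carrier (integer_mod_group d))"
    by (simp add: topgroup_power_def Zmod_def)
  show ?thesis
  proof (rule arb_abelianization[where \<Phi> = "\<lambda>\<sigma>. \<lambda>i\<in>I. \<kappa> i 0 \<sigma>"])
    show "comm_group (fst (topgroup_power (Zmod d) I))"
      by (intro comm_group_topgroup_power comm_group_Zmod)
    show "topspace (snd (topgroup_power (Zmod d) I)) = carrier (fst (topgroup_power (Zmod d) I))"
      by (rule topspace_topgroup_power) (simp add: Zmod_def)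
    show "Hausdorff_space (snd (topgroup_power (Zmod d) I))"
      by (rule Hausdorff_topgroup_power) (simp add: Zmod_def)
    show "(\<lambda>i\<in>I. \<kappa> i 0 \<sigma>) \<in> carrier (fst (topgroup_power (Zmod d) I))" if "\<sigma> \<in> \<Gamma>" for \<sigma>
      unfolding cZ using \<kappa>_carrier[OF _ that, of _ 0] r by auto
    show "(\<lambda>i\<in>I. \<kappa> i 0 (compose L \<sigma> \<tau>)) = (\<lambda>i\<in>I. \<kappa> i 0 \<sigma>) \<otimes>\<^bsub>fst (topgroup_power (Zmod d) I)\<^esub> (\<lambda>i\<in>I. \<kappa> i 0 \<tau>)"
      if "\<sigma> \<in> \<Gamma>" "\<tau> \<in> \<Gamma>" for \<sigma> \<tau>
      using \<kappa>_comp[OF _ that, of _ 0] r by (auto simp: topgroup_power_def Zmod_def restrict_def)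
    show "(\<lambda>i\<in>I. \<kappa> i 0 \<sigma>) = (\<lambda>i\<in>I. \<kappa> i 0 \<tau>)" if "\<And>i n. i \<in> I \<Longrightarrow> \<kappa> i n \<sigma> = \<kappa> i n \<tau>" for \<sigma> \<tau>
      using that by (auto simp: restrict_def)
    show "\<exists>\<sigma>\<in>\<Gamma>. (\<lambda>i\<in>I. \<kappa> i 0 \<sigma>) = y" if y: "y \<in> carrier (fst (topgroup_power (Zmod d) I))" for y
    proof -
      have "\<exists>\<sigma>\<in>\<Gamma>. \<forall>i\<in>I. \<forall>n. \<kappa> i n \<sigma> = y i"
        by (rule coordinates_onto[of "\<lambda>i n. y i"])
           (use y d0 in \<open>auto simp: cZ r PiE_iff carrier_integer_mod_group\<close>)
      then obtain \<sigma> where "\<sigma> \<in> \<Gamma>" "\<forall>i\<in>I. \<kappa> i 0 \<sigma> = y i" by blast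
      then show ?thesis
        using y by (intro bexI[of _ \<sigma>]) (auto simp: cZ PiE_iff extensional_def restrict_def fun_eq_iff)
    qed
    show "\<kappa> i n \<sigma> = 0" if "\<sigma> \<in> \<Gamma>" "(\<lambda>i\<in>I. \<kappa> i 0 \<sigma>) = \<one>\<^bsub>fst (topgroup_power (Zmod d) I)\<^esub>" "i \<in> I" for \<sigma> i n
    proof -
      have "(\<lambda>i\<in>I. \<kappa> i 0 \<sigma>) i = (\<lambda>i\<in>I. 0) i"
        using that(2) by (simp add: topgroup_power_def Zmod_def)
      then show ?thesis using that(3) const[OF that(3,1), of n] by simp
    qed
    show "continuous_map (snd arb) (snd (topgroup_power (Zmod d) I)) (\<lambda>g. \<lambda>i\<in>I. \<kappa> i 0 (lift g))"
      unfolding topgroup_power_def snd_conv continuous_map_componentwise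
      using continuous_\<kappa>[of _ 0] by (auto simp: Zmod_def r)
  qed
qed

text \<open>For each index the coordinates at all levels form a coherent sequence of residues modulo
  d^n, that is, one d-adic integer.\<close>

lemma arb_abelianization_dadic:
  assumes "0 \<in> S"
  shows "topgroup_iso (topgroup_abelianization arb) (topgroup_power (dadic d) I)"
proof -
  have r: "rad n = d ^ n" for n using assms by (simp add: rad_def)
  have cZ: "carrier (fst (topgroup_power (dadic d) I)) = PiE I (\<lambda>_. dadic_carrier d)"
    by (simp add: topgroup_power_def fst_dadic)
  have \<kappa>d: "(\<lambda>n. \<kappa> i n \<sigma>) \<in> dadic_carrier d" if "i \<in> I" "\<sigma> \<in> \<Gamma>" for i \<sigma>
    unfolding dadic_carrier_iff[OF d0] using \<kappa>_range[OF that] \<kappa>_compat[OF that] r by simp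
  show ?thesis
  proof (rule arb_abelianization[where \<Phi> = "\<lambda>\<sigma>. \<lambda>i\<in>I. \<lambda>n. \<kappa> i n \<sigma>"])
    show "comm_group (fst (topgroup_power (dadic d) I))"
      by (intro comm_group_topgroup_power comm_group_dadic d0)
    show "topspace (snd (topgroup_power (dadic d) I)) = carrier (fst (topgroup_power (dadic d) I))"
      by (intro topspace_topgroup_power topspace_dadic)
    show "Hausdorff_space (snd (topgroup_power (dadic d) I))"
      by (intro Hausdorff_topgroup_power Hausdorff_dadic)
    show "(\<lambda>i\<in>I. \<lambda>n. \<kappa> i n \<sigma>) \<in> carrier (fst (topgroup_power (dadic d) I))" if "\<sigma> \<in> \<Gamma>" for \<sigma>
      unfolding cZ using \<kappa>d[OF _ that] by auto
    show "(\<lambda>i\<in>I. \<lambda>n. \<kappa> i n (compose L \<sigma> \<tau>)) = (\<lambda>i\<in>I. \<lambda>n. \<kappa> i n \<sigma>) \<otimes>\<^bsub>fst (topgroup_power (dadic d) I)\<^esub> (\<lambda>i\<in>I. \<lambda>n. \<kappa> i n \<tau>)"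
      if "\<sigma> \<in> \<Gamma>" "\<tau> \<in> \<Gamma>" for \<sigma> \<tau>
      using \<kappa>_comp[OF _ that] r by (auto simp: topgroup_power_def fst_dadic restrict_def fun_eq_iff)
    show "(\<lambda>i\<in>I. \<lambda>n. \<kappa> i n \<sigma>) = (\<lambda>i\<in>I. \<lambda>n. \<kappa> i n \<tau>)" if "\<And>i n. i \<in> I \<Longrightarrow> \<kappa> i n \<sigma> = \<kappa> i n \<tau>" for \<sigma> \<tau>
      using that by (auto simp: restrict_def fun_eq_iff)
    show "\<exists>\<sigma>\<in>\<Gamma>. (\<lambda>i\<in>I. \<lambda>n. \<kappa> i n \<sigma>) = y" if y: "y \<in> carrier (fst (topgroup_power (dadic d) I))" for y
    proof -
      have "y i \<in> dadic_carrier d" if "i \<in> I" for i using y that by (auto simp: cZ PiE_iff)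
      then have "\<exists>\<sigma>\<in>\<Gamma>. \<forall>i\<in>I. \<forall>n. \<kappa> i n \<sigma> = y i n"
        by (intro coordinates_onto) (simp add: dadic_carrier_iff[OF d0] r)
      then obtain \<sigma> where "\<sigma> \<in> \<Gamma>" "\<forall>i\<in>I. \<forall>n. \<kappa> i n \<sigma> = y i n" by blast
      then show ?thesis
        using y by (intro bexI[of _ \<sigma>]) (auto simp: cZ PiE_iff extensional_def restrict_def fun_eq_iff)
    qed
    show "\<kappa> i n \<sigma> = 0" if "\<sigma> \<in> \<Gamma>" "(\<lambda>i\<in>I. \<lambda>n. \<kappa> i n \<sigma>) = \<one>\<^bsub>fst (topgroup_power (dadic d) I)\<^esub>" "i \<in> I" for \<sigma> i n
    proof -
      have "(\<lambda>i\<in>I. \<lambda>n. \<kappa> i n \<sigma>) i n = (\<lambda>i\<in>I. \<lambda>n. 0) i n"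
        using that(2) by (simp add: topgroup_power_def fst_dadic restrict_def)
      then show ?thesis using that(3) by simp
    qed
    show "continuous_map (snd arb) (snd (topgroup_power (dadic d) I)) (\<lambda>g. \<lambda>i\<in>I. \<lambda>n. \<kappa> i n (lift g))"
      unfolding topgroup_power_def snd_conv continuous_map_componentwise
    proof (intro conjI ballI)
      fix i assume i: "i \<in> I"
      have "continuous_map (snd arb) (snd (dadic d)) (\<lambda>g n. \<kappa> i n (lift g))"
        unfolding dadic_def snd_conv continuous_map_in_subtopology continuous_map_componentwise_UNIV
        using continuous_\<kappa>[OF i] \<kappa>d[OF i] lift by (auto simp: r topspace_arb)
      then show "continuous_map (snd arb) (snd (dadic d)) (\<lambda>g. (\<lambda>i\<in>I. \<lambda>n. \<kappa> i n (lift g)) i)"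
        using i by simp
    qed auto
  qed
qed

end

section \<open>The constants of a separable closure of \<open>K(t)\<close>\<close>

lemma adjoin_common_denominator:
  fixes K :: "'a::field set" and t :: 'a
  assumes K: "is_subfield K" and q: "poly_over (adjoin K t) q"
  obtains r Q where "poly r t \<noteq> 0" "\<And>i. poly_over K (Q i)" "\<And>i. coeff q i * poly r t = poly (Q i) t"
proof -
  have "\<forall>i. \<exists>p s. poly_over K p \<and> poly_over K s \<and> poly s t \<noteq> 0 \<and> coeff q i = poly p t / poly s t"
  proof
    fix i
    have "coeff q i \<in> adjoin K t" using q by (simp add: poly_over_def)
    then show "\<exists>p s. poly_over K p \<and> poly_over K s \<and> poly s t \<noteq> 0 \<and> coeff q i = poly p t / poly s t"
      unfolding adjoin_eq[OF K] by blast
  qed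
  then obtain p s where ps: "\<And>i. poly_over K (p i)" "\<And>i. poly_over K (s i)" "\<And>i. poly (s i) t \<noteq> 0"
    "\<And>i. coeff q i = poly (p i) t / poly (s i) t"
    by metis
  define r where "r = (\<Prod>i\<le>degree q. s i)"
  define Q where "Q i = (if i \<le> degree q then p i * (\<Prod>j\<in>{..degree q} - {i}. s j) else 0)" for i
  show thesis
  proof (rule that)
    show "poly r t \<noteq> 0" using ps(3) by (simp add: r_def poly_prod)
    show "poly_over K (Q i)" for i
      unfolding Q_def using ps(1,2) by (auto intro!: poly_over_intros[OF K])
    show "coeff q i * poly r t = poly (Q i) t" for i
    proof (cases "i \<le> degree q")
      case True
      have "poly r t = poly (s i) t * poly (\<Prod>j\<in>{..degree q} - {i}. s j) t"
        unfolding r_def poly_mult[symmetric] using True by (subst prod.remove[of _ i]) auto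
      then show ?thesis using True ps(3,4)[of i] by (simp add: Q_def)
    next
      case False
      then show ?thesis by (simp add: Q_def coeff_eq_0)
    qed
  qed
qed

lemma transcendental_over_algebraics:
  assumes K: "is_subfield K" and t: "transcendental_over K t"
  shows "transcendental_over {x. algebraic_elem K x} t"
  using algebraic_elem_trans[OF K, of t] t
  unfolding transcendental_over_def algebraic_elem_def[of _ t] by blast

text \<open>
  Expanding a polynomial over \<open>K(t)\<close> in powers of \<open>t\<close>, each coefficient is a multiple of the minimal
  polynomial over \<open>K\<close> of any root that is algebraic over \<open>K\<close>.
\<close>

lemma separable_over_adjoin_transcendental:
  fixes K :: "'a::field set" and t :: 'a
  assumes K: "is_subfield K" and t: "transcendental_over K t"
    and x: "algebraic_elem K x" "separable_over (adjoin K t) x"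
  shows "separable_over K x"
proof -
  let ?A = "{x. algebraic_elem K x}"
  have A: "is_subfield ?A" by (rule is_subfield_algebraic[OF K])
  have KA: "K \<subseteq> ?A" using algebraic_elem_self[OF K] by blast
  obtain m where m: "min_poly K x m" using min_poly_exists[OF x(1)] .
  obtain q where q: "poly_over (adjoin K t) q" "separable_poly q" "poly q x = 0"
    using x(2) unfolding separable_over_def by blast
  obtain r Q where rQ: "poly r t \<noteq> 0" "\<And>i. poly_over K (Q i)" "\<And>i. coeff q i * poly r t = poly (Q i) t"
    using adjoin_common_denominator[OF K q(1)] by metis
  define n where "n = degree q"
  define N where "N = (\<Sum>i\<le>n. degree (Q i))"
  \<comment> \<open>\<open>R\<close> and the \<open>q'\<close> collect the same monomials x^i t^j in
    two ways: as a polynomial in t with \<open>x\<close> inserted, and, for each power of t, as a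
    polynomial in the variable of \<open>q\<close>.\<close>
  define R where "R = (\<Sum>i\<le>n. smult (x ^ i) (Q i))"
  define q' where "q' j = (\<Sum>i\<le>n. monom (coeff (Q i) j) i)" for j
  have N: "degree (Q i) \<le> N" if "i \<le> n" for i
    unfolding N_def using that by (intro member_le_sum) auto
  have "poly_over ?A R"
    unfolding R_def
  proof (intro poly_over_sum[OF A] poly_over_smult[OF A])
    show "x ^ i \<in> ?A" for i using x(1) by (intro subfield_power[OF A]) simp
    show "poly_over ?A (Q i)" for i using rQ(2)[of i] KA unfolding poly_over_def by blast
  qed
  moreover have "poly R t = 0"
  proof -
    have "poly R t = (\<Sum>i\<le>n. coeff q i * x ^ i) * poly r t"
      unfolding R_def poly_sum sum_distrib_right
      by (intro sum.cong refl) (simp add: mult_ac flip: rQ(3))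
    also have "\<dots> = 0" using q(3) by (simp add: poly_altdef n_def)
    finally show ?thesis .
  qed
  \<comment> \<open>As \<open>t\<close> is transcendental over the algebraic elements, vanishing at
    \<open>t\<close> kills every coefficient, and the coefficients are the values of the
    \<open>q'\<close> at \<open>x\<close>.\<close>
  ultimately have "R = 0"
    using transcendental_over_algebraics[OF K t] unfolding transcendental_over_def by blast
  have "m dvd q' j" for j
  proof -
    have "poly (q' j) x = coeff R j"
      unfolding q'_def R_def poly_sum coeff_sum by (intro sum.cong refl) (simp add: poly_monom mult.commute)
    then have "poly (q' j) x = 0" using \<open>R = 0\<close> by simp
    moreover have "poly_over K (q' j)"
      unfolding q'_def using rQ(2) by (intro poly_over_sum[OF K] poly_over_monom[OF K]) (auto simp: poly_over_def)
    ultimately show ?thesis using min_poly_dvd[OF K m] by (metis dvd_triv_left)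
  qed
  then have "m dvd (\<Sum>j\<le>N. smult (t ^ j) (q' j))" by (intro dvd_sum dvd_smult) auto
  also have "(\<Sum>j\<le>N. smult (t ^ j) (q' j)) = smult (poly r t) q"
  proof (rule poly_eqI)
    fix i
    show "coeff (\<Sum>j\<le>N. smult (t ^ j) (q' j)) i = coeff (smult (poly r t) q) i"
    proof (cases "i \<le> n")
      case True
      have "poly (Q i) t = (\<Sum>j\<le>N. coeff (Q i) j * t ^ j)"
        unfolding poly_altdef using N[OF True] by (intro sum.mono_neutral_left) (auto simp: coeff_eq_0)
      then show ?thesis
        using rQ(3)[of i] True by (simp add: coeff_sum q'_def coeff_monom mult.commute)
    next
      case False
      then show ?thesis by (simp add: coeff_sum q'_def coeff_eq_0 n_def)
    qed
  qed
  finally have "m dvd q" using rQ(1) by (simp add: dvd_smult_iff)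
  then have "separable_poly m" using q(2) separable_poly_factor(1) by (metis dvdE)
  then show ?thesis using m unfolding separable_over_def min_poly_def by blast
qed

context
  fixes K L :: "'l::field set" and t :: 'l
  assumes K: "is_subfield K" and t: "transcendental_over K t"
    and L: "is_separable_closure (adjoin K t) L"
begin

text \<open>Inside a separable extension of K(t), elements algebraic over \<open>K\<close> are
  separable over \<open>K\<close>. The constants can thus be handled through algebraicity and its
  transitivity.\<close>

lemma constants_eq: "separable_closure_in K L = L \<inter> {x. algebraic_elem K x}"
  using separable_over_adjoin_transcendental[OF K t] separable_over_imp_algebraic L
  unfolding separable_closure_in_def is_separable_closure_def by blast

lemma constants_superset: "K \<subseteq> separable_closure_in K L"
  using L generate_field_superset[of "insert t K"] algebraic_elem_self[OF K]
  unfolding constants_eq is_separable_closure_def by blast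

text \<open>A separable polynomial of positive degree over the constants has a root in
  \<open>L\<close>; by transitivity it is algebraic over \<open>K\<close>, hence a constant. So the
  constants are separably closed.\<close>

lemma constants_unicritical:
  assumes a: "a \<in> K" "a \<noteq> 0" and b: "b \<in> K" and d: "d \<ge> 2" "of_nat d \<noteq> (0::'l)"
  shows "unicritical (separable_closure_in K L) L t a b d"
proof (rule unicritical.intro)
  let ?k = "separable_closure_in K L" and ?A = "{x. algebraic_elem K x}"
  have A: "is_subfield ?A" by (rule is_subfield_algebraic[OF K])
  show L': "is_subfield L" "separably_closed L" using L by (auto simp: is_separable_closure_def)
  show k: "is_subfield ?k"
    using A L'(1) unfolding constants_eq is_subfield_iff by blast
  show "separably_closed ?k"
    unfolding separably_closed_def
  proof (intro allI impI)
    fix p assume p: "poly_over ?k p \<and> separable_poly p \<and> degree p > 0"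
    then have "poly_over L p" unfolding poly_over_def constants_eq by blast
    then obtain x where x: "x \<in> L" "poly p x = 0"
      using p L'(2) unfolding separably_closed_def by blast
    have "p \<noteq> 0" using p by auto
    then have "algebraic_elem ?A x"
      using p x(2) unfolding algebraic_elem_def[of ?A] poly_over_def constants_eq by blast
    then show "\<exists>x\<in>?k. poly p x = 0"
      using x algebraic_elem_trans[OF K] unfolding constants_eq by blast
  qed
  have "t \<in> L" using L generate_field_superset[of "insert t K"] by (auto simp: is_separable_closure_def)
  then show "adjoin ?k t \<subseteq> L"
    by (intro generate_field_least[OF L'(1)]) (auto simp: constants_eq)
  have "adjoin K t \<subseteq> adjoin ?k t"
    using generate_field_superset[of "insert t ?k"] constants_superset
    by (intro generate_field_least is_subfield_generate_field) blast
  then show "separable_over (adjoin ?k t) x" if "x \<in> L" for x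
    using that L separable_over_mono unfolding is_separable_closure_def by blast
  show "transcendental_over ?k t"
    using transcendental_over_algebraics[OF K t]
    unfolding transcendental_over_def poly_over_def constants_eq by blast
  show "a \<in> ?k" "b \<in> ?k" using a b constants_superset by blast+
qed (fact a d)+

end

section \<open>The three orbit types\<close>

context unicritical
begin

lemma radical_coordinates_exist:
  assumes "bij_betw c I S"
  obtains \<rho> \<zeta> where "radical_coordinates k L t a b d I c \<rho> \<zeta>"
proof -
  obtain \<zeta> where \<zeta>: "\<And>n. (\<zeta> n \<in> k \<and> primitive_root (rad n) (\<zeta> n)) \<and> \<zeta> (Suc n) ^ rstep = \<zeta> n"
    using compatible_unity_roots by blast
  have "\<forall>i\<in>I. \<exists>\<rho>. \<forall>n. (\<rho> n \<in> L \<and> \<rho> n ^ rad n = t - c i) \<and> \<rho> (Suc n) ^ rstep = \<rho> n"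
    using compatible_radicals assms by (auto simp: bij_betw_def)
  then obtain \<rho> where \<rho>: "\<forall>i\<in>I. \<forall>n. (\<rho> i n \<in> L \<and> \<rho> i n ^ rad n = t - c i) \<and> \<rho> i (Suc n) ^ rstep = \<rho> i n"
    using bchoice[of I "\<lambda>i \<rho>. \<forall>n. (\<rho> n \<in> L \<and> \<rho> n ^ rad n = t - c i) \<and> \<rho> (Suc n) ^ rstep = \<rho> n"] by blast
  have "radical_coordinates k L t a b d I c \<rho> \<zeta>"
    by unfold_locales (use assms \<zeta> \<rho> in blast)+
  then show thesis by (rule that)
qed

lemma S_bij_card:
  assumes "finite S"
  obtains c where "bij_betw c {..<card S} S"
  using ex_bij_betw_nat_finite[OF assms] unfolding atLeast0LessThan by blast

lemma forward_orbit_eq: "forward_orbit f 0 = insert 0 S"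
proof -
  have "(f ^^ i) 0 \<in> insert 0 S" for i
    by (cases "i = 0") (auto simp: strict_forward_orbit_def)
  then show ?thesis
    by (auto simp: forward_orbit_def strict_forward_orbit_def intro: exI[of _ 0])
qed

text \<open>After a repetition every iterate can be replaced by one of index below
  \<open>j\<close>.\<close>

lemma preperiodic_imp_finite:
  assumes "preperiodic_point f 0"
  shows "finite S"
proof -
  obtain i j where ij: "i < j" "(f ^^ i) 0 = (f ^^ j) 0"
    using assms by (auto simp: preperiodic_point_def)
  have "\<exists>m'<j. (f ^^ m) 0 = (f ^^ m') 0" for m
  proof (induction m)
    case 0
    then show ?case using ij(1) by (intro exI[of _ 0]) simp
  next
    case (Suc m)
    then obtain m' where "m' < j" "(f ^^ m) 0 = (f ^^ m') 0" by blast
    then have m': "Suc m' \<le> j" "(f ^^ Suc m) 0 = (f ^^ Suc m') 0" by auto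
    then show ?case using ij by (cases "Suc m' = j") (metis, metis le_neq_implies_less)
  qed
  then have "S \<subseteq> (\<lambda>m. (f ^^ m) 0) ` {..<j}"
    unfolding strict_forward_orbit_def by fastforce
  then show ?thesis using finite_surj by blast
qed

lemma periodic_imp_preperiodic: "periodic_point f 0 \<Longrightarrow> preperiodic_point f 0"
  unfolding periodic_point_def preperiodic_point_def by (metis One_nat_def Suc_le_eq funpow_0)

text \<open>A periodic orbit is finite, so an infinite orbit leaves 0 outside \<open>S\<close>, as
  in the strictly preperiodic case; these two cases differ only in the index set.\<close>

lemma arb_abelianization_cases:
  shows "infinite (forward_orbit f 0) \<Longrightarrow>
      topgroup_iso (topgroup_abelianization arb) (topgroup_power (Zmod d) (UNIV :: nat set))"
    and "periodic_point f 0 \<Longrightarrow>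
      topgroup_iso (topgroup_abelianization arb) (topgroup_power (dadic d) {..<card S})"
    and "strictly_preperiodic_point f 0 \<Longrightarrow>
      topgroup_iso (topgroup_abelianization arb) (topgroup_power (Zmod d) {..<card S})"
proof -
  show "topgroup_iso (topgroup_abelianization arb) (topgroup_power (Zmod d) (UNIV :: nat set))"
    if inf: "infinite (forward_orbit f 0)"
  proof -
    have S: "infinite S" using inf forward_orbit_eq by simp
    then have 0: "0 \<notin> S"
      using preperiodic_imp_finite periodic_imp_preperiodic periodic_iff by blast
    have "S = range (\<lambda>i. (f ^^ Suc i) 0)"
      unfolding strict_forward_orbit_def by (auto simp del: funpow.simps dest: Suc_le_D)
    then have "countable S" by (metis countable_image countableI_type)
    then obtain c where "bij_betw c (UNIV :: nat set) S"
      using S by (metis bij_betw_from_nat_into)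
    then obtain \<rho> \<zeta> where "radical_coordinates k L t a b d UNIV c \<rho> \<zeta>"
      by (rule radical_coordinates_exist)
    then show ?thesis using 0 by (rule radical_coordinates.arb_abelianization_Zmod)
  qed
  show "topgroup_iso (topgroup_abelianization arb) (topgroup_power (dadic d) {..<card S})"
    if per: "periodic_point f 0"
  proof -
    obtain c where "bij_betw c {..<card S} S"
      using S_bij_card preperiodic_imp_finite periodic_imp_preperiodic[OF per] by blast
    then obtain \<rho> \<zeta> where "radical_coordinates k L t a b d {..<card S} c \<rho> \<zeta>"
      by (rule radical_coordinates_exist)
    then show ?thesis
      using per unfolding periodic_iff by (rule radical_coordinates.arb_abelianization_dadic)
  qed
  show "topgroup_iso (topgroup_abelianization arb) (topgroup_power (Zmod d) {..<card S})"
    if pre: "strictly_preperiodic_point f 0"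
  proof -
    have 0: "0 \<notin> S" using pre periodic_iff by (simp add: strictly_preperiodic_point_def)
    obtain c where "bij_betw c {..<card S} S"
      using S_bij_card preperiodic_imp_finite pre unfolding strictly_preperiodic_point_def by blast
    then obtain \<rho> \<zeta> where "radical_coordinates k L t a b d {..<card S} c \<rho> \<zeta>"
      by (rule radical_coordinates_exist)
    then show ?thesis using 0 by (rule radical_coordinates.arb_abelianization_Zmod)
  qed
qed

end

theorem proposition1p3:
  fixes K L :: "'l::field set" and a b t :: 'l and d :: nat and f :: "'l \<Rightarrow> 'l"
  assumes "is_subfield K"
    and "a \<in> K" and "b \<in> K" and "a \<noteq> 0"
    and "d \<ge> 2" and "CHAR('l) = 0 \<or> coprime d CHAR('l)"
    and "f = (\<lambda>x. a * x ^ d + b)"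
    and "transcendental_over K t"
    and "is_separable_closure (adjoin K t) L"
  shows "(infinite (forward_orbit f 0) \<longrightarrow>
            topgroup_iso (topgroup_abelianization (geometric_Arb K L t f))
              (topgroup_power (Zmod d) (UNIV :: nat set))) \<and>
         (periodic_point f 0 \<longrightarrow>
            topgroup_iso (topgroup_abelianization (geometric_Arb K L t f))
              (topgroup_power (dadic d) {..<card (strict_forward_orbit f 0)})) \<and>
         (strictly_preperiodic_point f 0 \<longrightarrow>
            topgroup_iso (topgroup_abelianization (geometric_Arb K L t f))
              (topgroup_power (Zmod d) {..<card (strict_forward_orbit f 0)}))"
proof -
  have "of_nat d \<noteq> (0::'l)"
  proof
    assume "of_nat d = (0::'l)"
    then have "CHAR('l) dvd d" by (simp add: of_nat_eq_0_iff_char_dvd)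
    then have "CHAR('l) = 1"
      using assms(5,6) by (metis coprime_absorb_right coprime_commute dvd_0_left_iff not_numeral_le_zero normalize_nat_def nat_dvd_1_iff_1)
    then show False by (simp add: CHAR_not_1)
  qed
  then interpret U: unicritical "separable_closure_in K L" L t a b d
    using constants_unicritical assms by blast
  have f: "U.f = f" using assms(7) by (simp add: U.f_def fun_eq_iff)
  have "U.arb = geometric_Arb K L t f"
    by (simp add: U.arb_def geometric_Arb_def f)
  then show ?thesis using U.arb_abelianization_cases unfolding f by simp
qed

end
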